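(* Let $C>1$ be an integer. For all $j\in[t]$, let $G^{(j)}$ be a $d_j$-regular connected graph with $1<|V(G^{(j)})|\le C$. Let $G=\square_{j=1}^t G^{(j)}$, let $n:=|V(G)|$ and let $d:=\sum_{j=1}^t d_j$. Let $\epsilon>0$ be a small enough constant and let $p=\frac{1+\epsilon}{d}$. Let $L_1$ be the largest component in $G_p$. Then there exists a positive constant $c=c(\epsilon)$ such that whp: (a) for all $k\le \frac{3\epsilon n}{2}$ and all subsets $S\subseteq V(L_1)$ with $|S|=k$, $$|\partial_{G_p}(S)|\ge \frac{c|S|}{d\ln d};$$ (b) for all $\epsilon^2 n\le k\le \frac{3\epsilon n}{2}$ and all subsets $S\subseteq V(L_1)$ with $|S|=k$, $$|N_{G_p}(S)|\ge \frac{c|S|}{d\ln d}.$$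
   Context: Graphs are finite and simple; $[m]=\{1,\ldots,m\}$. The Cartesian product $\square_{j=1}^t G^{(j)}$ is the graph with vertex set $V(G^{(1)})\times\cdots\times V(G^{(t)})$ in which $u$ and $v$ are adjacent iff there is some $j\in[t]$ with $u_jv_j\in E(G^{(j)})$ and $u_m=v_m$ for all $m\ne j$. $G_p$ is the random subgraph of $G$ on $V(G)$ obtained by retaining every edge of $G$ independently with probability $p$. "Whp" means with probability tending to $1$ as $t\to\infty$, where $C,\epsilon$ are fixed and the base graphs may vary with $t$. "$\epsilon$ small enough" means $0<\epsilon\le\epsilon_0$ for some $\epsilon_0>0$ depending only on $C$; constants do not depend on $t$ or on the base graphs. The largest component is the one with most vertices (ties broken arbitrarily). For a graph $H$ and $S\subseteq V(H)$, $\partial_H(S)$ is the set of edges of $H$ with exactly one endpoint in $S$, and $N_H(S)$ is the set of vertices in $V(H)\setminus S$ having a neighbour in $S$ in $H$. *)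

theory Defs
  imports "HOL-Probability.Probability" "HOL-Probability.Product_PMF"
begin

record 'a ugraph =
  verts :: "'a set"
  edges :: "'a set set"

definition simple_graph :: "'a ugraph \<Rightarrow> bool" where
  "simple_graph G \<longleftrightarrow> finite (verts G) \<and> (\<forall>e\<in>edges G. e \<subseteq> verts G \<and> card e = 2)"

definition adj :: "'a ugraph \<Rightarrow> 'a \<Rightarrow> 'a \<Rightarrow> bool" where
  "adj G u v \<longleftrightarrow> {u, v} \<in> edges G"

definition regular_graph :: "'a ugraph \<Rightarrow> nat \<Rightarrow> bool" where
  "regular_graph G r \<longleftrightarrow> (\<forall>v\<in>verts G. card {e \<in> edges G. v \<in> e} = r)"

definition connected_graph :: "'a ugraph \<Rightarrow> bool" where
  "connected_graph G \<longleftrightarrow> verts G \<noteq> {} \<and> (\<forall>u\<in>verts G. \<forall>v\<in>verts G. (adj G)\<^sup>*\<^sup>* u v)"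

(* Vertices are extensional functions on {1..t}, so each t-tuple has exactly one representative. *)
definition cartesian_product :: "nat \<Rightarrow> (nat \<Rightarrow> 'a ugraph) \<Rightarrow> (nat \<Rightarrow> 'a) ugraph" where
  "cartesian_product t B = \<lparr>
     verts = (\<Pi>\<^sub>E j\<in>{1..t}. verts (B j)),
     edges = {{u, v} | u v.
        u \<in> (\<Pi>\<^sub>E j\<in>{1..t}. verts (B j)) \<and> v \<in> (\<Pi>\<^sub>E j\<in>{1..t}. verts (B j)) \<and>
        (\<exists>j\<in>{1..t}. {u j, v j} \<in> edges (B j) \<and> (\<forall>m\<in>{1..t} - {j}. u m = v m))} \<rparr>"

(* For p outside [0,1], bernoulli_pmf truncates p to that interval; the False argument of
   Pi_pmf is the value taken off the (finite) edge set and plays no role. *)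
definition percolation :: "'a ugraph \<Rightarrow> real \<Rightarrow> 'a ugraph pmf" where
  "percolation G p =
     map_pmf (\<lambda>\<omega>. \<lparr> verts = verts G, edges = {e \<in> edges G. \<omega> e} \<rparr>)
       (Pi_pmf (edges G) False (\<lambda>_. bernoulli_pmf p))"

(* Components are represented by their vertex sets. *)
definition components :: "'a ugraph \<Rightarrow> 'a set set" where
  "components H = {{v \<in> verts H. (adj H)\<^sup>*\<^sup>* u v} | u. u \<in> verts H}"

(* A relation rather than a choice function: several components may tie for the maximum. *)
definition largest_component :: "'a ugraph \<Rightarrow> 'a set \<Rightarrow> bool" where
  "largest_component H L \<longleftrightarrow> L \<in> components H \<and> (\<forall>K\<in>components H. card K \<le> card L)"

definition edge_boundary :: "'a ugraph \<Rightarrow> 'a set \<Rightarrow> 'a set set" where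
  "edge_boundary H S = {e \<in> edges H. card (e \<inter> S) = 1}"

definition nbhd :: "'a ugraph \<Rightarrow> 'a set \<Rightarrow> 'a set" where
  "nbhd H S = {v \<in> verts H - S. \<exists>u\<in>S. adj H u v}"

end

(* Expose the edges in a first round, with probability slightly below (1 + eps) / d, and five
   sprinkling rounds of probability delta / d. A supermartingale for the exploration process shows
   that a vertex lies in a large component of the first round with probability close to 2 eps, and a
   first-moment bound over connected sets, based on the fact that small sets have almost maximal edge
   boundary, shows that every connected set of the whole graph of size at least of order d has a
   constant fraction of its vertices in the union W of these large components. Sprinkling then joins
   any two sets A and W - A: every vertex has of order d^2 walks of length two into W, so that the
   edge-isoperimetric inequality |bd U| >= |U| ln (n / |U|) / C, proved by induction on the number of
   factors, yields many edges between the vertices close to A and those close to W - A, and each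
   of these lies on an open crossing path of length five with probability of order 1 / d. The number of
   edges or vertices cut by a set S bounds the number of choices for S \<inter> W, because S \<inter> W is
   determined by the neighbourhood N of S, the vertices of S next to N, and the components contained
   in S. A union bound shows that crossing paths avoiding N exist for all such choices unless N is
   at least as large as claimed. *)
theory Submission
  imports Defs "HOL-Real_Asymp.Real_Asymp"
begin

text \<open>The obstacle is entropy: there are far more sets \<open>S\<close> than the failure
  probability of a sprinkling can pay for, so only data recoverable from the cut are enumerated.
  With \<open>L = 1 + ln (n / k)\<close>, the choice of a set of \<open>k / (d * ln d)\<close>
  vertices costs an exponent of order \<open>k * L / d\<close>, since its logarithm exceeds
  \<open>ln (n / k)\<close> by at most a multiple of \<open>ln d\<close>; this is where the factor
  \<open>ln d\<close> of the claim is spent. The isoperimetric inequality carries the same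
  \<open>L\<close>, so the crossing exponent matches the count at every scale of \<open>k\<close>;
  without that logarithm the count would win for \<open>k\<close> much smaller than
  \<open>n\<close>. Components of \<open>W\<close> have at least \<open>d ^ 3\<close> vertices, so a
  set of size \<open>k\<close> contains at most \<open>k / d ^ 3\<close> of them and one
  representative of each can be listed. Claim (b) starts at \<open>\<epsilon>\<^sup>2 * n\<close>
  because cut edges are controlled by cut vertices only through a degree bound of order
  \<open>ln d\<close>, which some vertices violate. Percolation is treated as a weighted sum over
  edge subsets; \<open>prob_percolation\<close> links it to the measure at the very end.\<close>

definition expect :: "'e set \<Rightarrow> real \<Rightarrow> ('e set \<Rightarrow> real) \<Rightarrow> real" where
  "expect E p f = (\<Sum>F\<in>Pow E. p ^ card F * (1 - p) ^ card (E - F) * f F)"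

abbreviation pr :: "'e set \<Rightarrow> real \<Rightarrow> ('e set \<Rightarrow> bool) \<Rightarrow> real" where
  "pr E p P \<equiv> expect E p (\<lambda>F. of_bool (P F))"

lemma expect_empty [simp]: "expect {} p f = f {}"
  by (simp add: expect_def)

text \<open>Conditioning on whether \<open>e\<close> is retained; this recursion drives the
  inductions over the edge set that replace arguments with product measures.\<close>

lemma expect_insert:
  assumes "finite E" "e \<notin> E"
  shows "expect (insert e E) p f = p * expect E p (\<lambda>F. f (insert e F)) + (1 - p) * expect E p f"
proof -
  have inj: "inj_on (insert e) (Pow E)"
    using assms(2) by (auto simp: inj_on_def)
  have disj: "Pow E \<inter> insert e ` Pow E = {}"
    using assms(2) by auto
  have "expect (insert e E) p f =
      (\<Sum>F\<in>Pow E. p ^ card F * (1 - p) ^ card (insert e E - F) * f F) +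
      (\<Sum>F\<in>insert e ` Pow E. p ^ card F * (1 - p) ^ card (insert e E - F) * f F)"
    unfolding expect_def Pow_insert using assms disj by (intro sum.union_disjoint) auto
  also have "(\<Sum>F\<in>Pow E. p ^ card F * (1 - p) ^ card (insert e E - F) * f F) =
      (1 - p) * expect E p f"
    unfolding expect_def sum_distrib_left
  proof (rule sum.cong)
    fix F assume F: "F \<in> Pow E"
    then have "insert e E - F = insert e (E - F)" using assms(2) by auto
    then have "card (insert e E - F) = Suc (card (E - F))"
      using assms by simp
    then show "p ^ card F * (1 - p) ^ card (insert e E - F) * f F =
      (1 - p) * (p ^ card F * (1 - p) ^ card (E - F) * f F)" by simp
  qed simp
  also have "(\<Sum>F\<in>insert e ` Pow E. p ^ card F * (1 - p) ^ card (insert e E - F) * f F) =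
      p * expect E p (\<lambda>F. f (insert e F))"
    unfolding expect_def sum_distrib_left sum.reindex[OF inj] o_def
  proof (rule sum.cong)
    fix F assume F: "F \<in> Pow E"
    then have "insert e E - insert e F = E - F" "e \<notin> F" "finite F"
      using assms by (auto intro: finite_subset)
    then show "p ^ card (insert e F) * (1 - p) ^ card (insert e E - insert e F) * f (insert e F) =
      p * (p ^ card F * (1 - p) ^ card (E - F) * f (insert e F))" by simp
  qed simp
  finally show ?thesis by simp
qed

lemma expect_cong:
  assumes "\<And>F. F \<subseteq> E \<Longrightarrow> f F = g F"
  shows "expect E p f = expect E p g"
  unfolding expect_def using assms by (intro sum.cong) auto

lemma expect_mono:
  assumes "0 \<le> p" "p \<le> 1" "\<And>F. F \<subseteq> E \<Longrightarrow> f F \<le> g F"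
  shows "expect E p f \<le> expect E p g"
  unfolding expect_def using assms by (intro sum_mono mult_left_mono) auto

lemma expect_const [simp]: "finite E \<Longrightarrow> expect E p (\<lambda>_. c) = c"
  by (induction E rule: finite_induct) (simp_all add: expect_insert algebra_simps)

lemma expect_add: "expect E p (\<lambda>F. f F + g F) = expect E p f + expect E p g"
  by (simp add: expect_def distrib_left sum.distrib)

lemma expect_diff: "expect E p (\<lambda>F. f F - g F) = expect E p f - expect E p g"
  by (simp add: expect_def right_diff_distrib sum_subtractf)

lemma expect_cmult: "expect E p (\<lambda>F. c * f F) = c * expect E p f"
  unfolding expect_def sum_distrib_left by (intro sum.cong) simp_all

lemma expect_multc: "expect E p (\<lambda>F. f F * c) = expect E p f * c"
  unfolding expect_def sum_distrib_right by (intro sum.cong) simp_all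

lemma expect_sum: "expect E p (\<lambda>F. \<Sum>i\<in>I. f i F) = (\<Sum>i\<in>I. expect E p (f i))"
  unfolding expect_def sum_distrib_left by (rule sum.swap)

lemma expect_nonneg:
  assumes "0 \<le> p" "p \<le> 1" "\<And>F. F \<subseteq> E \<Longrightarrow> 0 \<le> f F"
  shows "0 \<le> expect E p f"
  unfolding expect_def using assms by (intro sum_nonneg mult_nonneg_nonneg) auto

lemma expect_le_const:
  assumes "finite E" "0 \<le> p" "p \<le> 1" "\<And>F. F \<subseteq> E \<Longrightarrow> f F \<le> c"
  shows "expect E p f \<le> c"
proof -
  have "expect E p f \<le> expect E p (\<lambda>_. c)"
    using assms by (intro expect_mono) auto
  with assms(1) show ?thesis by simp
qed

lemma pr_mono:
  assumes "0 \<le> p" "p \<le> 1" "\<And>F. F \<subseteq> E \<Longrightarrow> P F \<Longrightarrow> Q F"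
  shows "pr E p P \<le> pr E p Q"
  using assms by (intro expect_mono) auto

lemma pr_nonneg: "0 \<le> p \<Longrightarrow> p \<le> 1 \<Longrightarrow> 0 \<le> pr E p P"
  by (intro expect_nonneg) auto

lemma pr_le_1: "finite E \<Longrightarrow> 0 \<le> p \<Longrightarrow> p \<le> 1 \<Longrightarrow> pr E p P \<le> 1"
  by (intro expect_le_const) auto

lemma pr_not: "finite E \<Longrightarrow> pr E p (\<lambda>F. \<not> P F) = 1 - pr E p P"
proof -
  assume "finite E"
  have "pr E p (\<lambda>F. \<not> P F) = expect E p (\<lambda>F. 1 - of_bool (P F))"
    by (intro expect_cong) auto
  with \<open>finite E\<close> show ?thesis by (simp add: expect_diff)
qed

lemma pr_union_bound:
  assumes "0 \<le> p" "p \<le> 1" "finite I" "\<And>F. F \<subseteq> E \<Longrightarrow> P F \<Longrightarrow> \<exists>i\<in>I. Q i F"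
  shows "pr E p P \<le> (\<Sum>i\<in>I. pr E p (Q i))"
proof -
  have "pr E p P \<le> expect E p (\<lambda>F. \<Sum>i\<in>I. of_bool (Q i F))"
  proof (intro expect_mono assms(1,2))
    fix F assume F: "F \<subseteq> E"
    show "of_bool (P F) \<le> (\<Sum>i\<in>I. of_bool (Q i F) :: real)"
    proof (cases "P F")
      case True
      then obtain i where i: "i \<in> I" "Q i F" using assms(4) F by blast
      have "(of_bool (Q i F) :: real) \<le> (\<Sum>i\<in>I. of_bool (Q i F))"
        using i assms(3) by (intro member_le_sum) auto
      with i show ?thesis by simp
    qed (simp add: sum_nonneg)
  qed
  then show ?thesis by (simp only: expect_sum)
qed

lemma pr_disj_le:
  assumes "0 \<le> p" "p \<le> 1" "\<And>F. F \<subseteq> E \<Longrightarrow> P F \<Longrightarrow> Q F \<or> R F"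
  shows "pr E p P \<le> pr E p Q + pr E p R"
proof -
  have "pr E p P \<le> expect E p (\<lambda>F. of_bool (Q F) + of_bool (R F))"
  proof (intro expect_mono assms(1,2))
    fix F assume "F \<subseteq> E"
    from assms(3)[OF this]
    show "(of_bool (P F) :: real) \<le> of_bool (Q F) + of_bool (R F)" by auto
  qed
  then show ?thesis by (simp only: expect_add)
qed

lemma expect_markov:
  assumes "0 \<le> p" "p \<le> 1" "0 < a" "\<And>F. F \<subseteq> E \<Longrightarrow> 0 \<le> f F"
  shows "pr E p (\<lambda>F. a \<le> f F) \<le> expect E p f / a"
proof -
  have "pr E p (\<lambda>F. a \<le> f F) \<le> expect E p (\<lambda>F. inverse a * f F)"
    using assms by (intro expect_mono) (auto simp: field_simps)
  then show ?thesis by (simp only: expect_cmult) (simp add: divide_inverse mult.commute)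
qed

lemma expect_Un_disjoint:
  assumes "finite E1" "finite E2" "E1 \<inter> E2 = {}"
  shows "expect (E1 \<union> E2) p f = expect E1 p (\<lambda>F1. expect E2 p (\<lambda>F2. f (F1 \<union> F2)))"
  using assms
proof (induction E1 arbitrary: f rule: finite_induct)
  case (insert e E)
  then have "e \<notin> E \<union> E2" "finite (E \<union> E2)" by auto
  then have "expect (insert e E \<union> E2) p f =
      p * expect (E \<union> E2) p (\<lambda>F. f (insert e F)) + (1 - p) * expect (E \<union> E2) p f"
    by (simp add: expect_insert)
  also have "\<dots> = expect (insert e E) p (\<lambda>F1. expect E2 p (\<lambda>F2. f (F1 \<union> F2)))"
    using insert by (simp add: expect_insert)
  finally show ?case .
qed simp

text \<open>Sprinkling: an edge is missing from \<open>F1 \<union> F2\<close> iff it is missing from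
  both independent rounds, which has probability \<open>(1 - a) * (1 - b)\<close>.\<close>

lemma expect_two_rounds:
  assumes "finite E"
  shows "expect E (1 - (1 - a) * (1 - b)) f = expect E a (\<lambda>F1. expect E b (\<lambda>F2. f (F1 \<union> F2)))"
  using assms
proof (induction E arbitrary: f rule: finite_induct)
  case (insert e E)
  show ?case
    by (simp add: expect_insert insert expect_add expect_cmult) (simp add: algebra_simps)
qed simp

text \<open>The counterpart of sprinkling: keeping each edge of an \<open>a\<close>-random set with
  probability \<open>b\<close> yields an \<open>a * b\<close>-random set. It compares one event at
  two densities.\<close>

lemma expect_thinning:
  assumes "finite E"
  shows "expect E (a * b) f = expect E a (\<lambda>F1. expect F1 b f)"
  using assms
proof (induction E arbitrary: f rule: finite_induct)
  case (insert e E)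
  have "expect E a (\<lambda>F1. expect (insert e F1) b f) =
    expect E a (\<lambda>F1. b * expect F1 b (\<lambda>F. f (insert e F)) + (1 - b) * expect F1 b f)"
    using insert.hyps by (intro expect_cong expect_insert) (auto intro: finite_subset)
  then show ?case
    by (simp add: expect_insert insert expect_add expect_cmult) (simp add: algebra_simps)
qed simp

lemma expect_restrict:
  assumes "finite E"
  shows "expect E p (\<lambda>F. f (F \<inter> X)) = expect (E \<inter> X) p f"
proof -
  have "expect E p (\<lambda>F. f (F \<inter> X)) = expect ((E \<inter> X) \<union> (E - X)) p (\<lambda>F. f (F \<inter> X))"
    by (simp add: Int_Diff_Un)
  also have "\<dots> = expect (E \<inter> X) p (\<lambda>F1. expect (E - X) p (\<lambda>F2. f ((F1 \<union> F2) \<inter> X)))"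
    using assms by (intro expect_Un_disjoint) auto
  also have "\<dots> = expect (E \<inter> X) p (\<lambda>F1. expect (E - X) p (\<lambda>F2. f F1))"
  proof (intro expect_cong)
    fix F1 F2 assume "F1 \<subseteq> E \<inter> X" "F2 \<subseteq> E - X"
    then have "(F1 \<union> F2) \<inter> X = F1" by auto
    then show "f ((F1 \<union> F2) \<inter> X) = f F1" by simp
  qed
  finally show ?thesis using assms by simp
qed

text \<open>\<open>f\<close> and \<open>g\<close> inspect disjoint edge sets and are therefore
  independent. Dependence on an edge set is expressed throughout by the shape
  \<open>f (F \<inter> X)\<close>.\<close>

lemma expect_indep:
  assumes "finite E" "X \<inter> Y = {}"
  shows "expect E p (\<lambda>F. f (F \<inter> X) * g (F \<inter> Y)) =
    expect E p (\<lambda>F. f (F \<inter> X)) * expect E p (\<lambda>F. g (F \<inter> Y))"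
proof -
  have "expect E p (\<lambda>F. f (F \<inter> X) * g (F \<inter> Y)) =
     expect ((E \<inter> X) \<union> (E - X)) p (\<lambda>F. f (F \<inter> X) * g (F \<inter> Y))"
    by (simp add: Int_Diff_Un)
  also have "\<dots> = expect (E \<inter> X) p (\<lambda>F1. expect (E - X) p (\<lambda>F2. f ((F1 \<union> F2) \<inter> X) * g ((F1 \<union> F2) \<inter> Y)))"
    using assms by (intro expect_Un_disjoint) auto
  also have "\<dots> = expect (E \<inter> X) p (\<lambda>F1. expect (E - X) p (\<lambda>F2. f F1 * g (F2 \<inter> Y)))"
  proof (intro expect_cong)
    fix F1 F2 assume "F1 \<subseteq> E \<inter> X" "F2 \<subseteq> E - X"
    then have "(F1 \<union> F2) \<inter> X = F1" "(F1 \<union> F2) \<inter> Y = F2 \<inter> Y" using assms(2) by auto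
    then show "f ((F1 \<union> F2) \<inter> X) * g ((F1 \<union> F2) \<inter> Y) = f F1 * g (F2 \<inter> Y)" by simp
  qed
  also have "\<dots> = expect (E \<inter> X) p f * expect (E - X) p (\<lambda>F. g (F \<inter> Y))"
    by (simp add: expect_cmult expect_multc)
  also have "expect (E - X) p (\<lambda>F. g (F \<inter> Y)) = expect E p (\<lambda>F. g (F \<inter> Y))"
  proof -
    have "(E - X) \<inter> Y = E \<inter> Y" using assms(2) by auto
    then show ?thesis using assms(1) by (simp add: expect_restrict)
  qed
  also have "expect (E \<inter> X) p f = expect E p (\<lambda>F. f (F \<inter> X))"
    using assms(1) by (simp add: expect_restrict)
  finally show ?thesis .
qed

lemma expect_prod:
  assumes "finite E" "finite J" "\<And>i j. i \<in> J \<Longrightarrow> j \<in> J \<Longrightarrow> i \<noteq> j \<Longrightarrow> X i \<inter> X j = {}"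
  shows "expect E p (\<lambda>F. \<Prod>j\<in>J. g j (F \<inter> X j)) = (\<Prod>j\<in>J. expect E p (\<lambda>F. g j (F \<inter> X j)))"
  using assms(2,3)
proof (induction J rule: finite_induct)
  case (insert i J)
  define Y where "Y = (\<Union>j\<in>J. X j)"
  have disj: "X i \<inter> Y = {}" using insert by (auto simp: Y_def)
  have eq: "(\<Prod>j\<in>J. g j (F \<inter> X j)) = (\<Prod>j\<in>J. g j ((F \<inter> Y) \<inter> X j))" for F
  proof (rule prod.cong)
    fix j assume "j \<in> J"
    then have "(F \<inter> Y) \<inter> X j = F \<inter> X j" by (auto simp: Y_def)
    then show "g j (F \<inter> X j) = g j ((F \<inter> Y) \<inter> X j)" by simp
  qed simp
  have "expect E p (\<lambda>F. \<Prod>j\<in>insert i J. g j (F \<inter> X j)) =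
     expect E p (\<lambda>F. g i (F \<inter> X i) * (\<lambda>G. \<Prod>j\<in>J. g j (G \<inter> X j)) (F \<inter> Y))"
    using insert.hyps by (simp add: eq[symmetric])
  also have "\<dots> = expect E p (\<lambda>F. g i (F \<inter> X i)) * expect E p (\<lambda>F. (\<lambda>G. \<Prod>j\<in>J. g j (G \<inter> X j)) (F \<inter> Y))"
    by (rule expect_indep[OF assms(1) disj])
  also have "expect E p (\<lambda>F. (\<lambda>G. \<Prod>j\<in>J. g j (G \<inter> X j)) (F \<inter> Y)) =
     expect E p (\<lambda>F. \<Prod>j\<in>J. g j (F \<inter> X j))"
    by (simp add: eq[symmetric])
  finally show ?case using insert by simp
qed (use assms(1) in simp)

lemma pr_avoid:
  assumes "finite E"
  shows "pr E p (\<lambda>F. F \<inter> X = {}) = (1 - p) ^ card (E \<inter> X)"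
proof -
  have "pr E p (\<lambda>F. F \<inter> X = {}) = pr (E \<inter> X) p (\<lambda>F. F = {})"
    by (rule expect_restrict[OF assms, where f = "\<lambda>F. of_bool (F = {})"])
  also have "\<dots> = (\<Sum>F\<in>{{}}. p ^ card F * (1 - p) ^ card (E \<inter> X - F))"
    unfolding expect_def using assms by (intro sum.mono_neutral_cong_right) auto
  finally show ?thesis by simp
qed

lemma pr_contains:
  assumes "finite E" "T \<subseteq> E"
  shows "pr E p (\<lambda>F. T \<subseteq> F) = p ^ card T"
proof -
  have "pr E p (\<lambda>F. T \<subseteq> F) = pr E p (\<lambda>F. F \<inter> T = T)"
    by (intro expect_cong) (simp add: Int_absorb1 inf.absorb_iff2)
  also have "\<dots> = pr (E \<inter> T) p (\<lambda>F. F = T)"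
    by (rule expect_restrict[OF assms(1), where f = "\<lambda>F. of_bool (F = T)"])
  also have "E \<inter> T = T" using assms by auto
  also have "pr T p (\<lambda>F. F = T) = (\<Sum>F\<in>{T}. p ^ card F * (1 - p) ^ card (T - F))"
    unfolding expect_def using assms by (intro sum.mono_neutral_cong_right) (auto intro: finite_subset)
  finally show ?thesis by simp
qed

section \<open>Concentration: a Chernoff lower tail and a Chebyshev bound for random edge
  sets\<close>

lemma one_minus_exp_ge:
  fixes x :: real
  assumes "0 \<le> x" "x \<le> 1 / 3"
  shows "3 / 4 * x \<le> 1 - exp (- x)"
proof -
  have "exp (- x) \<le> 1 / (1 + x)"
    using exp_ge_add_one_self[of x] assms by (simp add: exp_minus field_simps)
  also have "\<dots> \<le> 1 - 3 / 4 * x"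
  proof -
    have "x * (1 / 4 - 3 / 4 * x) \<ge> 0" using assms by (intro mult_nonneg_nonneg) auto
    then show ?thesis using assms by (simp add: field_simps)
  qed
  finally show ?thesis by simp
qed

text \<open>Chernoff's method with the exponential moment of the negative sum; it factorises because
  the events inspect disjoint edge sets. The weights let a vertex count with the number of edges it
  contributes.\<close>

lemma pr_weighted_lower_tail:
  fixes w :: "'i \<Rightarrow> real"
  assumes fin: "finite E" "finite J" and p: "0 \<le> p" "p \<le> 1"
    and disj: "\<And>i j. i \<in> J \<Longrightarrow> j \<in> J \<Longrightarrow> i \<noteq> j \<Longrightarrow> X i \<inter> X j = {}"
    and w: "\<And>j. j \<in> J \<Longrightarrow> 0 \<le> w j" "\<And>j. j \<in> J \<Longrightarrow> w j \<le> b" and b: "0 < b"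
    and M: "M \<le> (\<Sum>j\<in>J. w j * pr E p (\<lambda>F. P j (F \<inter> X j)))"
  shows "pr E p (\<lambda>F. (\<Sum>j\<in>J. w j * of_bool (P j (F \<inter> X j))) < M / 2) \<le> exp (- M / (12 * b))"
proof -
  \<comment> \<open>\<open>s * w j \<le> 1 / 3\<close> puts the exponent in the range of
    \<open>one_minus_exp_ge\<close>; its factor \<open>3 / 4\<close> against the
    \<open>1 / 2\<close> of the threshold leaves \<open>s * M / 4 = M / (12 * b)\<close>.\<close>
  define s where "s = 1 / (3 * b)"
  have s: "0 < s" using b by (simp add: s_def)
  define g where "g = (\<lambda>j F. exp (- (s * w j * of_bool (P j F))))"
  have "pr E p (\<lambda>F. (\<Sum>j\<in>J. w j * of_bool (P j (F \<inter> X j))) < M / 2)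
     \<le> expect E p (\<lambda>F. exp (s * M / 2) * (\<Prod>j\<in>J. g j (F \<inter> X j)))"
  proof (intro expect_mono p)
    fix F assume "F \<subseteq> E"
    let ?S = "\<Sum>j\<in>J. w j * of_bool (P j (F \<inter> X j))"
    have "exp (s * M / 2) * (\<Prod>j\<in>J. g j (F \<inter> X j)) = exp (s * M / 2) * exp (- (s * ?S))"
      unfolding g_def using fin
      by (simp add: exp_sum[symmetric] sum_negf sum_distrib_left mult.assoc del: sum_mult_of_bool_eq)
    also have "\<dots> = exp (s * (M / 2 - ?S))"
      by (simp add: mult_exp_exp algebra_simps)
    finally have eq: "exp (s * M / 2) * (\<Prod>j\<in>J. g j (F \<inter> X j)) = exp (s * (M / 2 - ?S))" .
    show "of_bool (?S < M / 2) \<le> exp (s * M / 2) * (\<Prod>j\<in>J. g j (F \<inter> X j))"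
      unfolding eq using s by (cases "?S < M / 2") auto
  qed
  also have "\<dots> = exp (s * M / 2) * (\<Prod>j\<in>J. expect E p (\<lambda>F. g j (F \<inter> X j)))"
    using fin disj by (simp only: expect_cmult) (subst expect_prod; simp)
  also have "(\<Prod>j\<in>J. expect E p (\<lambda>F. g j (F \<inter> X j))) \<le>
      (\<Prod>j\<in>J. exp (- (3 / 4 * s * (w j * pr E p (\<lambda>F. P j (F \<inter> X j))))))"
  proof (intro prod_mono conjI)
    fix j assume j: "j \<in> J"
    show "0 \<le> expect E p (\<lambda>F. g j (F \<inter> X j))"
      using p by (intro expect_nonneg) (auto simp: g_def)
    let ?\<pi> = "pr E p (\<lambda>F. P j (F \<inter> X j))"
    have pi: "0 \<le> ?\<pi>" using p by (intro pr_nonneg)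
    have "expect E p (\<lambda>F. g j (F \<inter> X j)) =
      expect E p (\<lambda>F. 1 - (1 - exp (- (s * w j))) * of_bool (P j (F \<inter> X j)))"
      by (intro expect_cong) (simp add: g_def)
    also have "\<dots> = 1 - (1 - exp (- (s * w j))) * ?\<pi>"
      using fin by (simp add: expect_diff expect_cmult)
    also have "\<dots> \<le> 1 - (3 / 4 * (s * w j)) * ?\<pi>"
    proof -
      have "s * w j \<le> s * b" using w(2)[OF j] s by simp
      then have "s * w j \<le> 1 / 3" using b by (simp add: s_def)
      then have "3 / 4 * (s * w j) \<le> 1 - exp (- (s * w j))"
        using w(1)[OF j] s by (intro one_minus_exp_ge) auto
      from mult_right_mono[OF this pi] show ?thesis by simp
    qed
    also have "\<dots> \<le> exp (- (3 / 4 * s * (w j * ?\<pi>)))"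
      using exp_ge_add_one_self[of "- (3 / 4 * s * (w j * ?\<pi>))"] by (simp add: mult_ac)
    finally show "expect E p (\<lambda>F. g j (F \<inter> X j)) \<le> exp (- (3 / 4 * s * (w j * ?\<pi>)))" .
  qed
  also have "(\<Prod>j\<in>J. exp (- (3 / 4 * s * (w j * pr E p (\<lambda>F. P j (F \<inter> X j)))))) =
     exp (- (3 / 4 * s * (\<Sum>j\<in>J. w j * pr E p (\<lambda>F. P j (F \<inter> X j)))))"
    using fin by (simp add: exp_sum[symmetric] sum_negf sum_distrib_left)
  also have "\<dots> \<le> exp (- (3 / 4 * s * M))"
    using M s by simp
  also have "exp (s * M / 2) * exp (- (3 / 4 * s * M)) = exp (- M / (12 * b))"
    using b by (simp add: mult_exp_exp s_def field_simps)
  finally show ?thesis by simp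
qed

text \<open>A bound of Efron-Stein type: conditioning on one edge splits the variance into the
  average of the two conditional variances and \<open>p * (1 - p)\<close> times the squared
  difference of the conditional means, which is at most \<open>K\<close>.\<close>

lemma variance_le_bounded_differences:
  fixes p :: real
  assumes "finite E" and p: "0 \<le> p" "p \<le> 1"
    and "\<And>e F. F \<subseteq> E \<Longrightarrow> e \<in> E \<Longrightarrow> \<bar>f (insert e F) - f F\<bar> \<le> K"
  shows "expect E p (\<lambda>F. (f F)\<^sup>2) - (expect E p f)\<^sup>2 \<le> card E * p * K\<^sup>2"
  using assms(1,4)
proof (induction E arbitrary: f rule: finite_induct)
  case (insert e E)
  let ?f1 = "\<lambda>F. f (insert e F)"
  have K: "0 \<le> K" using insert.prems[of "{}" e] by auto
  have IH1: "expect E p (\<lambda>F. (?f1 F)\<^sup>2) - (expect E p ?f1)\<^sup>2 \<le> card E * p * K\<^sup>2"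
  proof (rule insert.IH)
    fix a F assume "F \<subseteq> E" "a \<in> E"
    then show "\<bar>f (insert e (insert a F)) - f (insert e F)\<bar> \<le> K"
      using insert.prems[of "insert e F" a] by (auto simp: insert_commute)
  qed
  have IH0: "expect E p (\<lambda>F. (f F)\<^sup>2) - (expect E p f)\<^sup>2 \<le> card E * p * K\<^sup>2"
    using insert.prems by (intro insert.IH) auto
  have diff: "\<bar>expect E p ?f1 - expect E p f\<bar> \<le> K"
  proof -
    have d: "?f1 F - f F \<le> K" "f F - ?f1 F \<le> K" if "F \<subseteq> E" for F
      using insert.prems[OF _ insertI1, of F] subset_insertI2[OF that, of e] by auto
    have "expect E p (\<lambda>F. ?f1 F - f F) \<le> K"
      by (rule expect_le_const[OF insert.hyps(1) p d(1)])
    moreover have "expect E p (\<lambda>F. f F - ?f1 F) \<le> K"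
      by (rule expect_le_const[OF insert.hyps(1) p d(2)])
    ultimately show ?thesis by (simp add: expect_diff)
  qed
  have "(expect E p ?f1 - expect E p f)\<^sup>2 \<le> K\<^sup>2"
    using diff K by (simp add: abs_le_square_iff[symmetric])
  then have sq: "p * (1 - p) * (expect E p ?f1 - expect E p f)\<^sup>2 \<le> p * K\<^sup>2"
    using p by (intro mult_mono) (auto simp: mult_left_le)
  have "expect (insert e E) p (\<lambda>F. (f F)\<^sup>2) - (expect (insert e E) p f)\<^sup>2 =
      p * (expect E p (\<lambda>F. (?f1 F)\<^sup>2) - (expect E p ?f1)\<^sup>2) +
      (1 - p) * (expect E p (\<lambda>F. (f F)\<^sup>2) - (expect E p f)\<^sup>2) +
      p * (1 - p) * (expect E p ?f1 - expect E p f)\<^sup>2"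
    using insert.hyps by (simp add: expect_insert) (simp add: power2_eq_square algebra_simps)
  also have "\<dots> \<le> p * (card E * p * K\<^sup>2) + (1 - p) * (card E * p * K\<^sup>2) + p * K\<^sup>2"
    using IH1 IH0 sq p by (intro add_mono mult_left_mono) auto
  also have "\<dots> = card (insert e E) * p * K\<^sup>2"
    using insert.hyps by (simp add: algebra_simps)
  finally show ?case .
qed simp

lemma pr_chebyshev:
  fixes p :: real
  assumes fin: "finite E" and p: "0 \<le> p" "p \<le> 1" and a: "0 < a"
    and diff: "\<And>e F. F \<subseteq> E \<Longrightarrow> e \<in> E \<Longrightarrow> \<bar>f (insert e F) - f F\<bar> \<le> K"
  shows "pr E p (\<lambda>F. expect E p f + a \<le> f F) \<le> card E * p * K\<^sup>2 / a\<^sup>2"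
proof -
  define m where "m = expect E p f"
  have "pr E p (\<lambda>F. m + a \<le> f F) \<le> pr E p (\<lambda>F. a\<^sup>2 \<le> (f F - m)\<^sup>2)"
  proof (intro pr_mono p)
    fix F assume "m + a \<le> f F"
    then show "a\<^sup>2 \<le> (f F - m)\<^sup>2" using a by (intro power_mono) auto
  qed
  also have "\<dots> \<le> expect E p (\<lambda>F. (f F - m)\<^sup>2) / a\<^sup>2"
    using a by (intro expect_markov p) auto
  also have "expect E p (\<lambda>F. (f F - m)\<^sup>2) = expect E p (\<lambda>F. (f F)\<^sup>2 - 2 * m * f F + m\<^sup>2)"
    by (intro expect_cong) (simp add: power2_eq_square algebra_simps)
  also have "\<dots> = expect E p (\<lambda>F. (f F)\<^sup>2) - m\<^sup>2"
    using fin by (simp add: expect_add expect_diff expect_cmult m_def power2_eq_square)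
  also have "\<dots> / a\<^sup>2 \<le> card E * p * K\<^sup>2 / a\<^sup>2"
    unfolding m_def using variance_le_bounded_differences[OF fin p diff]
    by (intro divide_right_mono) auto
  finally show ?thesis by (simp add: m_def)
qed

section \<open>Reachability and connected sets\<close>

definition graph_on :: "'v set \<Rightarrow> 'v set set \<Rightarrow> bool" where
  "graph_on V E \<longleftrightarrow> finite V \<and> (\<forall>e\<in>E. e \<subseteq> V \<and> card e = 2)"

definition nb :: "'v set set \<Rightarrow> 'v \<Rightarrow> 'v set" where
  "nb E x = {y. {x, y} \<in> E}"

definition bd :: "'v set set \<Rightarrow> 'v set \<Rightarrow> 'v set set" where
  "bd E U = {e \<in> E. e \<inter> U \<noteq> {} \<and> \<not> e \<subseteq> U}"

definition inn :: "'v set set \<Rightarrow> 'v set \<Rightarrow> 'v set set" where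
  "inn E U = {e \<in> E. e \<subseteq> U}"

definition reach :: "'v set set \<Rightarrow> 'v set \<Rightarrow> 'v set" where
  "reach F X = {v. \<exists>u\<in>X. (\<lambda>x y. {x, y} \<in> F)\<^sup>*\<^sup>* u v}"

text \<open>Connectedness of the subgraph induced by \<open>U\<close>, by cuts instead of paths; the empty set is connected.\<close>

definition conn :: "'v set set \<Rightarrow> 'v set \<Rightarrow> bool" where
  "conn F U \<longleftrightarrow> (\<forall>A. A \<subseteq> U \<and> A \<noteq> {} \<and> A \<noteq> U \<longrightarrow> (\<exists>x\<in>A. \<exists>y\<in>U - A. {x, y} \<in> F))"

lemma graph_on_finite: "graph_on V E \<Longrightarrow> finite V \<and> finite E"
  unfolding graph_on_def by (metis Pow_iff finite_Pow_iff finite_subset subsetI)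

lemma graph_on_subset: "graph_on V E \<Longrightarrow> F \<subseteq> E \<Longrightarrow> graph_on V F"
  unfolding graph_on_def by auto

lemma graph_on_inn: "graph_on V E \<Longrightarrow> Y \<subseteq> V \<Longrightarrow> graph_on Y (inn E Y)"
  unfolding graph_on_def inn_def by (auto intro: finite_subset)

lemma nb_mono: "F \<subseteq> E \<Longrightarrow> nb F x \<subseteq> nb E x"
  by (auto simp: nb_def)

lemma nb_subset: "graph_on V E \<Longrightarrow> nb E x \<subseteq> V - {x}"
  unfolding graph_on_def nb_def by force

lemma finite_nb: "graph_on V E \<Longrightarrow> finite (nb E x)"
  by (meson finite_Diff finite_subset graph_on_finite nb_subset)

lemma edge_cases:
  assumes "graph_on V E" "e \<in> E"
  obtains x y where "e = {x, y}" "x \<noteq> y" "x \<in> V" "y \<in> V"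
  using assms unfolding graph_on_def by (metis card_2_iff insert_subset)

lemma bd_iff: "graph_on V E \<Longrightarrow> e \<in> bd E U \<longleftrightarrow> e \<in> E \<and> (\<exists>x y. e = {x, y} \<and> x \<in> U \<and> y \<notin> U)"
  by (auto simp: bd_def elim!: edge_cases)

lemma edge_in_bd: "{x, y} \<in> E \<Longrightarrow> x \<in> U \<Longrightarrow> y \<notin> U \<Longrightarrow> {x, y} \<in> bd E U"
  by (auto simp: bd_def)

lemma card_edges_between:
  assumes "graph_on V E" "finite A" "A \<inter> B = {}"
  shows "card {e \<in> E. \<exists>x y. e = {x, y} \<and> x \<in> A \<and> y \<in> B} = (\<Sum>u\<in>A. card (nb E u \<inter> B))"
proof -
  have "bij_betw (\<lambda>(u, v). {u, v}) (SIGMA u:A. nb E u \<inter> B) {e \<in> E. \<exists>x y. e = {x, y} \<and> x \<in> A \<and> y \<in> B}"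
    unfolding bij_betw_def
  proof
    show "inj_on (\<lambda>(u, v). {u, v}) (SIGMA u:A. nb E u \<inter> B)"
      using assms(3) by (auto simp: inj_on_def doubleton_eq_iff)
    show "(\<lambda>(u, v). {u, v}) ` (SIGMA u:A. nb E u \<inter> B) = {e \<in> E. \<exists>x y. e = {x, y} \<and> x \<in> A \<and> y \<in> B}"
      by (fastforce simp: nb_def image_iff)
  qed
  then have "card {e \<in> E. \<exists>x y. e = {x, y} \<and> x \<in> A \<and> y \<in> B} = card (SIGMA u:A. nb E u \<inter> B)"
    by (simp add: bij_betw_same_card)
  also have "\<dots> = (\<Sum>u\<in>A. card (nb E u \<inter> B))"
    using assms finite_nb[OF assms(1)] by (intro card_SigmaI) auto
  finally show ?thesis .
qed

lemma card_bd:
  assumes "graph_on V E" "U \<subseteq> V"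
  shows "card (bd E U) = (\<Sum>u\<in>U. card (nb E u - U))"
proof -
  have "bd E U = {e \<in> E. \<exists>x y. e = {x, y} \<and> x \<in> U \<and> y \<in> V - U}"
  proof (intro set_eqI iffI)
    fix e assume "e \<in> bd E U"
    then obtain x y where xy: "e \<in> E" "e = {x, y}" "x \<in> U" "y \<notin> U" by (auto simp: bd_iff[OF assms(1)])
    then have "y \<in> V" using assms(1) by (auto simp: graph_on_def)
    with xy show "e \<in> {e \<in> E. \<exists>x y. e = {x, y} \<and> x \<in> U \<and> y \<in> V - U}" by blast
  qed (use bd_iff[OF assms(1)] in blast)
  moreover have "nb E u \<inter> (V - U) = nb E u - U" for u
    using nb_subset[OF assms(1)] by blast
  ultimately show ?thesis
    using card_edges_between[OF assms(1), of U "V - U"] assms graph_on_finite[OF assms(1)]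
    by (simp add: finite_subset)
qed

text \<open>Both sides are the sum of \<open>f u * g v\<close> over adjacent pairs. This double
  count moves weights from one end of the edges to the other in the walk estimates.\<close>

lemma sum_nb_swap:
  fixes f g :: "'v \<Rightarrow> real"
  assumes "finite A" "finite B"
  shows "(\<Sum>u\<in>A. f u * (\<Sum>v\<in>nb E u \<inter> B. g v)) = (\<Sum>v\<in>B. g v * (\<Sum>u\<in>nb E v \<inter> A. f u))"
proof -
  have "(\<Sum>u\<in>A. f u * (\<Sum>v\<in>nb E u \<inter> B. g v)) = (\<Sum>u\<in>A. \<Sum>v\<in>B. if {u, v} \<in> E then f u * g v else 0)"
    unfolding sum_distrib_left using assms
    by (intro sum.cong refl sum.mono_neutral_cong_left) (auto simp: nb_def)
  also have "\<dots> = (\<Sum>v\<in>B. \<Sum>u\<in>A. if {u, v} \<in> E then f u * g v else 0)"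
    by (rule sum.swap)
  also have "\<dots> = (\<Sum>v\<in>B. g v * (\<Sum>u\<in>nb E v \<inter> A. f u))"
    unfolding sum_distrib_left using assms
    by (intro sum.cong refl sum.mono_neutral_cong_right) (auto simp: nb_def insert_commute)
  finally show ?thesis .
qed

lemma reach_refl: "X \<subseteq> reach F X"
  by (auto simp: reach_def)

lemma reach_step: "x \<in> reach F X \<Longrightarrow> {x, y} \<in> F \<Longrightarrow> y \<in> reach F X"
  unfolding reach_def by (auto intro: rtranclp.rtrancl_into_rtrancl)

lemma reach_least:
  assumes "X \<subseteq> S" "\<And>x y. x \<in> S \<Longrightarrow> {x, y} \<in> F \<Longrightarrow> y \<in> S"
  shows "reach F X \<subseteq> S"
proof
  fix v assume "v \<in> reach F X"
  then obtain u where u: "u \<in> X" "(\<lambda>x y. {x, y} \<in> F)\<^sup>*\<^sup>* u v" by (auto simp: reach_def)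
  from u(2) show "v \<in> S"
    by (induction rule: rtranclp_induct) (use u(1) assms in auto)
qed

lemma reach_mono: "F \<subseteq> F' \<Longrightarrow> X \<subseteq> X' \<Longrightarrow> reach F X \<subseteq> reach F' X'"
  by (rule reach_least) (meson reach_refl reach_step subset_iff)+

lemma reach_subset: "graph_on V E \<Longrightarrow> X \<subseteq> V \<Longrightarrow> reach E X \<subseteq> V"
  by (rule reach_least) (auto simp: graph_on_def)

lemma reach_trans: "Y \<subseteq> reach F X \<Longrightarrow> reach F Y \<subseteq> reach F X"
  by (rule reach_least) (auto intro: reach_step)

lemma comp_sym: "v \<in> reach F {u} \<Longrightarrow> u \<in> reach F {v}"
proof -
  assume "v \<in> reach F {u}"
  then have "(\<lambda>x y. {x, y} \<in> F)\<^sup>*\<^sup>* u v" by (auto simp: reach_def)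
  then have "(\<lambda>x y. {x, y} \<in> F)\<^sup>*\<^sup>* v u"
    by (rule sympD[OF symp_rtranclp, rotated]) (auto intro!: sympI simp: insert_commute)
  then show ?thesis by (auto simp: reach_def)
qed

lemma comp_eq: "v \<in> reach F {u} \<Longrightarrow> reach F {v} = reach F {u}"
  by (meson comp_sym empty_subsetI insert_subset reach_trans subset_antisym)

lemma self_in_comp [simp]: "v \<in> reach F {v}"
  using reach_refl[of "{v}" F] by auto

lemma bd_comp: "graph_on V F \<Longrightarrow> bd F (reach F X) = {}"
  by (auto simp: bd_iff intro: reach_step)

lemma conn_comp: "conn F (reach F {v})"
  unfolding conn_def
proof (intro allI impI, elim conjE)
  fix A assume A: "A \<subseteq> reach F {v}" "A \<noteq> {}" "A \<noteq> reach F {v}"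
  show "\<exists>x\<in>A. \<exists>y\<in>reach F {v} - A. {x, y} \<in> F"
  proof (rule ccontr)
    assume no: "\<not> ?thesis"
    obtain a where a: "a \<in> A" using A by auto
    have "reach F {a} \<subseteq> A"
    proof (rule reach_least)
      fix x y assume "x \<in> A" "{x, y} \<in> F"
      then show "y \<in> A" using no A(1) reach_step[of x F "{v}" y] by blast
    qed (use a in auto)
    moreover have "reach F {a} = reach F {v}" using a A(1) by (intro comp_eq) auto
    ultimately show False using A by auto
  qed
qed

lemma conn_mono: "conn F U \<Longrightarrow> F \<subseteq> F' \<Longrightarrow> conn F' U"
  unfolding conn_def by blast

lemma conn_inn: "conn (inn F U) U \<longleftrightarrow> conn F U"
  unfolding conn_def inn_def by blast

lemma conn_Int: "inn E U \<subseteq> Y \<Longrightarrow> F \<subseteq> E \<Longrightarrow> conn (F \<inter> Y) U \<longleftrightarrow> conn F U"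
proof -
  assume Y: "inn E U \<subseteq> Y" and F: "F \<subseteq> E"
  have eq: "{x, y} \<in> F \<inter> Y \<longleftrightarrow> {x, y} \<in> F" if "x \<in> U" "y \<in> U" for x y
    using that Y F by (auto simp: inn_def)
  show ?thesis unfolding conn_def
    by (intro all_cong bex_cong refl eq) auto
qed

lemma conn_subset_comp: "conn F U \<Longrightarrow> v \<in> U \<Longrightarrow> U \<subseteq> reach F {v}"
proof (rule ccontr)
  assume c: "conn F U" "v \<in> U" and n: "\<not> U \<subseteq> reach F {v}"
  then have "U \<inter> reach F {v} \<noteq> {}" "U \<inter> reach F {v} \<noteq> U" using self_in_comp[of v F] by auto
  then obtain x y where "x \<in> U \<inter> reach F {v}" "y \<in> U - U \<inter> reach F {v}" "{x, y} \<in> F"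
    using c(1) unfolding conn_def by (meson Int_lower1)
  then show False using reach_step[of x F "{v}" y] by auto
qed

text \<open>Splits the event that the component of \<open>v\<close> is \<open>U\<close> into a
  condition on the edges inside \<open>U\<close> and one on its boundary edges; under percolation
  the two are independent.\<close>

lemma comp_eq_iff:
  assumes "graph_on V F" "v \<in> U"
  shows "reach F {v} = U \<longleftrightarrow> conn F U \<and> bd F U = {}"
proof
  assume "reach F {v} = U"
  then show "conn F U \<and> bd F U = {}" using conn_comp[of F v] bd_comp[OF assms(1), of "{v}"] by auto
next
  assume c: "conn F U \<and> bd F U = {}"
  have "reach F {v} \<subseteq> U"
    using assms c by (intro reach_least) (use edge_in_bd in fastforce)+
  then show "reach F {v} = U" using conn_subset_comp[of F U v] c assms(2) by auto
qed

lemma conn_singleton [simp]: "conn F {v}"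
  unfolding conn_def by auto

lemma conn_Un:
  assumes A: "conn F A" and B: "conn F B" and AB: "A \<inter> B \<noteq> {} \<or> (\<exists>x\<in>A. \<exists>y\<in>B. {x, y} \<in> F)"
  shows "conn F (A \<union> B)"
  unfolding conn_def
proof (intro allI impI, elim conjE)
  fix S assume S: "S \<subseteq> A \<union> B" "S \<noteq> {}" "S \<noteq> A \<union> B"
  show "\<exists>x\<in>S. \<exists>y\<in>A \<union> B - S. {x, y} \<in> F"
  proof (rule ccontr)
    assume "\<not> ?thesis"
    then have no: "{x, y} \<notin> F" "{y, x} \<notin> F" if "x \<in> S" "y \<in> A \<union> B - S" for x y
      using that by (auto simp: insert_commute)
    have cA: "S \<inter> A = {} \<or> A \<subseteq> S"
      using A[unfolded conn_def, rule_format, of "S \<inter> A"] no(1) by blast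
    have cB: "S \<inter> B = {} \<or> B \<subseteq> S"
      using B[unfolded conn_def, rule_format, of "S \<inter> B"] no(1) by blast
    consider "S \<inter> A = {}" "B \<subseteq> S" | "A \<subseteq> S" "S \<inter> B = {}"
      using cA cB S by fast
    then show False
    proof cases
      case 1
      then have "A \<inter> B = {}" by blast
      then obtain x y where "x \<in> A" "y \<in> B" "{x, y} \<in> F" using AB by blast
      moreover have "x \<notin> S" "y \<in> S" using 1 calculation by auto
      ultimately show False using no(2)[of y x] by auto
    next
      case 2
      then have "A \<inter> B = {}" by blast
      then obtain x y where "x \<in> A" "y \<in> B" "{x, y} \<in> F" using AB by blast
      moreover have "x \<in> S" "y \<notin> S" using 2 calculation by auto
      ultimately show False using no(1)[of x y] by auto
    qed
  qed
qed

lemma conn_insert: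
  "conn F U \<Longrightarrow> x \<in> U \<Longrightarrow> {x, y} \<in> F \<Longrightarrow> conn F (insert y U)"
  using conn_Un[of F U "{y}"] by auto

text \<open>A tree is grown from \<open>v\<close> along edges that leave the current vertex set. At
  \<open>k = card U\<close> this supplies a spanning edge set with at most \<open>card U - 1\<close>
  elements.\<close>

lemma connected_subset_tree:
  assumes U: "conn F U" "finite U" "v \<in> U" and k: "1 \<le> k" "k \<le> card U"
  shows "\<exists>X T. v \<in> X \<and> X \<subseteq> U \<and> card X = k \<and> T \<subseteq> inn F X \<and> finite T \<and> Suc (card T) \<le> k \<and> conn T X"
  using k
proof (induction k rule: nat_induct_at_least)
  case base
  show ?case by (intro exI[of _ "{v}"] exI[of _ "{}"]) (use U in auto)
next
  case (Suc k)
  then obtain X T where X: "v \<in> X" "X \<subseteq> U" "card X = k" "T \<subseteq> inn F X" "finite T" "Suc (card T) \<le> k" "conn T X"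
    by auto
  have "X \<noteq> U" using X Suc.prems by auto
  then obtain x y where xy: "x \<in> X" "y \<in> U - X" "{x, y} \<in> F"
    using U(1) X(1,2) unfolding conn_def by blast
  have finX: "finite X" using X U finite_subset by blast
  have "conn (insert {x, y} T) (insert y X)"
    by (rule conn_insert[OF conn_mono[OF X(7)] xy(1)]) auto
  moreover have "card (insert {x, y} T) \<le> Suc (card T)"
    by (rule card_insert_le_m1[of "Suc (card T)", simplified]) simp
  moreover have "insert {x, y} T \<subseteq> inn F (insert y X)"
    using X(4) xy by (auto simp: inn_def)
  moreover have "card (insert y X) = Suc k" "insert y X \<subseteq> U" "v \<in> insert y X"
    using X xy finX by auto
  ultimately show ?case
    using X(5,6) by (intro exI[of _ "insert y X"] exI[of _ "insert {x, y} T"]) simp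
qed

lemma conn_UN:
  assumes "\<And>i. i \<in> I \<Longrightarrow> conn F (A i) \<and> v \<in> A i"
  shows "conn F (\<Union>i\<in>I. A i)"
  unfolding conn_def
proof (intro allI impI, elim conjE, rule ccontr)
  fix S assume S: "S \<subseteq> (\<Union>i\<in>I. A i)" "S \<noteq> {}" "S \<noteq> (\<Union>i\<in>I. A i)"
    and no: "\<not> (\<exists>x\<in>S. \<exists>y\<in>(\<Union>i\<in>I. A i) - S. {x, y} \<in> F)"
  have dich: "S \<inter> A i = {} \<or> A i \<subseteq> S" if i: "i \<in> I" for i
  proof (rule ccontr)
    assume "\<not> ?thesis"
    then have "S \<inter> A i \<subseteq> A i" "S \<inter> A i \<noteq> {}" "S \<inter> A i \<noteq> A i" by auto
    then obtain x y where "x \<in> S \<inter> A i" "y \<in> A i - S \<inter> A i" "{x, y} \<in> F"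
      using assms[OF i] unfolding conn_def by meson
    then show False using no i by blast
  qed
  obtain i where i: "i \<in> I" "S \<inter> A i \<noteq> {}" using S by blast
  then have "v \<in> S" using dich assms by blast
  then have "A j \<subseteq> S" if "j \<in> I" for j using dich[OF that] assms[OF that] by blast
  then show False using S by blast
qed

text \<open>A smallest admissible \<open>P\<close> cannot be much larger than \<open>m\<close>: after removal of a vertex \<open>v\<close>
  adjacent to \<open>T - P\<close> every component of \<open>P - {v}\<close> would otherwise be a smaller choice.\<close>

lemma connected_piece:
  assumes F: "graph_on V F" and deg: "\<And>v. v \<in> V \<Longrightarrow> card (nb F v) \<le> \<Delta>"
    and T: "T \<subseteq> V" "conn F T" and m: "1 \<le> m" "m \<le> card T"
  shows "\<exists>P\<subseteq>T. conn F P \<and> conn F (T - P) \<and> m \<le> card P \<and> card P \<le> 1 + \<Delta> * m"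
proof -
  let ?ok = "\<lambda>P. P \<subseteq> T \<and> conn F P \<and> conn F (T - P) \<and> m \<le> card P"
  have "?ok T" using T m by (simp add: conn_def)
  then obtain P where P: "?ok P" and min: "\<And>Q. ?ok Q \<Longrightarrow> card P \<le> card Q"
    using ex_has_least_nat[of ?ok T card] by blast
  have finT: "finite T" using T(1) graph_on_finite[OF F] finite_subset by blast
  have finP: "finite P" using P finT finite_subset by blast
  have "P \<noteq> {}" using P m by auto
  obtain v where v: "v \<in> P" "T - P = {} \<or> (\<exists>y\<in>T - P. {v, y} \<in> F)"
  proof (cases "T - P = {}")
    case True
    then show ?thesis using that \<open>P \<noteq> {}\<close> by blast
  next
    case False
    then have "P \<subseteq> T \<and> P \<noteq> {} \<and> P \<noteq> T" using P \<open>P \<noteq> {}\<close> by blast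
    from T(2)[unfolded conn_def, rule_format, OF this] that show ?thesis by blast
  qed
  \<comment> \<open>Handing \<open>v\<close> over to \<open>T - P\<close> keeps that side connected.
    Every component of \<open>P - {v}\<close> is adjacent to \<open>v\<close>, so all of them but
    one can be handed over as well; the one kept is then an admissible choice if it has at least
    \<open>m\<close> vertices.\<close>
  have Q: "conn F (insert v (T - P))"
    using v(2)
  proof
    assume "T - P = {}"
    then show ?thesis by (simp only: conn_singleton)
  next
    assume "\<exists>y\<in>T - P. {v, y} \<in> F"
    then show ?thesis using P conn_insert[of F "T - P" _ v] by (auto simp: insert_commute)
  qed
  define K where "K = (\<lambda>w. reach (inn F (P - {v})) {w})"
  have K_sub: "K w \<subseteq> P - {v}" if "w \<in> P - {v}" for w
    unfolding K_def using that by (intro reach_least) (auto simp: inn_def)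
  have K_self: "w \<in> K w" for w by (simp add: K_def)
  have K_conn: "conn F (K w)" for w
    unfolding K_def by (rule conn_mono[OF conn_comp]) (auto simp: inn_def)
  have K_edge: "\<exists>x\<in>K w. {x, v} \<in> F" if w: "w \<in> P - {v}" for w
  proof -
    have "K w \<subseteq> P" "K w \<noteq> {}" "K w \<noteq> P" using K_sub[OF w] K_self[of w] v(1) by auto
    then obtain x y where xy: "x \<in> K w" "y \<in> P - K w" "{x, y} \<in> F"
      using P unfolding conn_def by meson
    have "y = v"
    proof (rule ccontr)
      assume "y \<noteq> v"
      then have "{x, y} \<in> inn F (P - {v})" using xy K_sub[OF w] by (auto simp: inn_def)
      then have "y \<in> K w" using xy(1) unfolding K_def by (rule reach_step[rotated])
      then show False using xy by auto
    qed
    then show ?thesis using xy by blast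
  qed
  have K_eq: "K z = K w" if "z \<in> K w" for z w
    using that unfolding K_def by (rule comp_eq)
  have K_small: "card (K w) < m" if w: "w \<in> P - {v}" for w
  proof (rule ccontr)
    assume "\<not> ?thesis"
    define I where "I = P - {v} - K w"
    have "conn F (\<Union>z\<in>insert v I. if z = v then insert v (T - P) else insert v (K z))"
    proof (rule conn_UN[of _ _ _ v])
      fix z assume "z \<in> insert v I"
      then show "conn F (if z = v then insert v (T - P) else insert v (K z)) \<and>
         v \<in> (if z = v then insert v (T - P) else insert v (K z))"
        using Q K_edge[of z] conn_insert[OF K_conn[of z], of _ v] by (auto simp: I_def)
    qed
    also have "(\<Union>z\<in>insert v I. if z = v then insert v (T - P) else insert v (K z)) = T - K w"
    proof (intro equalityI subsetI)
      fix y assume "y \<in> (\<Union>z\<in>insert v I. if z = v then insert v (T - P) else insert v (K z))"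
      then consider "y = v" | "y \<in> T - P" | z where "z \<in> I" "y \<in> K z" by (auto split: if_splits)
      then show "y \<in> T - K w"
      proof cases
        case 3
        then have "y \<in> T" using K_sub[of z] P by (auto simp: I_def)
        moreover have "y \<notin> K w"
        proof
          assume "y \<in> K w"
          then have "K z = K w" using K_eq[of y z] K_eq[of y w] 3 by simp
          then show False using 3 K_self[of z] by (auto simp: I_def)
        qed
        ultimately show ?thesis by blast
      qed (use v P K_sub[OF w] in auto)
    next
      fix y assume y: "y \<in> T - K w"
      consider "y \<in> T - P \<or> y = v" | "y \<in> I" using y by (auto simp: I_def)
      then show "y \<in> (\<Union>z\<in>insert v I. if z = v then insert v (T - P) else insert v (K z))"
      proof cases
        case 2
        then have "y \<noteq> v" by (auto simp: I_def)
        then show ?thesis using 2 K_self[of y] by (intro UN_I[of y]) auto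
      qed (auto intro!: UN_I[of v])
    qed
    finally have "?ok (K w)"
      using K_conn[of w] K_sub[OF w] P \<open>\<not> card (K w) < m\<close> by auto
    then have "card P \<le> card (K w)" by (rule min)
    moreover have "card (K w) < card P"
      using K_sub[OF w] v(1) finP by (intro psubset_card_mono) auto
    ultimately show False by simp
  qed
  \<comment> \<open>Each component of \<open>P - {v}\<close> contains a neighbour of
    \<open>v\<close>, so there are at most \<open>\<Delta>\<close> of them, and each has fewer than
    \<open>m\<close> vertices.\<close>
  have "P \<subseteq> insert v (\<Union>w\<in>nb F v \<inter> (P - {v}). K w)"
  proof
    fix z assume z: "z \<in> P"
    show "z \<in> insert v (\<Union>w\<in>nb F v \<inter> (P - {v}). K w)"
    proof (cases "z = v")
      case False
      then obtain x where x: "x \<in> K z" "{x, v} \<in> F" using K_edge[of z] z by auto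
      then have "x \<in> nb F v \<inter> (P - {v})" using K_sub[of z] z False by (auto simp: nb_def insert_commute)
      moreover have "z \<in> K x" using K_eq[OF x(1)] K_self[of z] by simp
      ultimately show ?thesis by blast
    qed simp
  qed
  moreover have fin: "finite (\<Union>w\<in>nb F v \<inter> (P - {v}). K w)"
  proof (intro finite_UN_I)
    fix w assume "w \<in> nb F v \<inter> (P - {v})"
    then show "finite (K w)" using K_sub[of w] finP finite_subset by blast
  qed (use finP in auto)
  ultimately have "card P \<le> card (insert v (\<Union>w\<in>nb F v \<inter> (P - {v}). K w))"
    by (intro card_mono) auto
  also have "\<dots> \<le> 1 + card (\<Union>w\<in>nb F v \<inter> (P - {v}). K w)"
    using fin by (simp add: card_insert_if)
  also have "card (\<Union>w\<in>nb F v \<inter> (P - {v}). K w) \<le> (\<Sum>w\<in>nb F v \<inter> (P - {v}). card (K w))"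
    using finP by (intro card_UN_le) auto
  also have "\<dots> \<le> (\<Sum>w\<in>nb F v \<inter> (P - {v}). m)"
    using K_small by (intro sum_mono) (auto intro: less_imp_le)
  also have "\<dots> \<le> \<Delta> * m"
    using deg[of v] v(1) P T(1) card_mono[OF finite_nb[OF F, of v], of "nb F v \<inter> (P - {v})"]
    by (simp add: mult_le_mono1) (meson Int_lower1 deg le_trans mult_le_mono1 subsetD)
  finally show ?thesis using P by auto
qed

text \<open>Peels off a connected piece of size between \<open>m\<close> and
  \<open>1 + \<Delta> * m\<close> whose complement in \<open>T\<close> stays connected. If
  \<open>T\<close> has more than \<open>1 + (\<Delta> + 1) * m\<close> vertices, at least
  \<open>m\<close> of them remain, so the induction applies to the rest and the two estimates add
  up.\<close>

lemma connected_dense_from_pieces: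
  assumes F: "graph_on V F" and deg: "\<And>v. v \<in> V \<Longrightarrow> card (nb F v) \<le> \<Delta>" and m: "1 \<le> m"
    and pieces: "\<And>P. P \<subseteq> V \<Longrightarrow> conn F P \<Longrightarrow> m \<le> card P \<Longrightarrow> card P \<le> 1 + (\<Delta> + 1) * m \<Longrightarrow>
      c * real (card P) \<le> card (P \<inter> W)"
    and T: "T \<subseteq> V" "conn F T" "m \<le> card T"
  shows "c * real (card T) \<le> card (T \<inter> W)"
  using T
proof (induction "card T" arbitrary: T rule: less_induct)
  case less
  show ?case
  proof (cases "card T \<le> 1 + (\<Delta> + 1) * m")
    case False
    obtain P where P: "P \<subseteq> T" "conn F P" "conn F (T - P)" "m \<le> card P" "card P \<le> 1 + \<Delta> * m"
      using connected_piece[OF F deg less.prems(1,2) m less.prems(3)] by blast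
    have finT: "finite T" using less.prems(1) graph_on_finite[OF F] finite_subset by blast
    have finP: "finite P" using P(1) finT finite_subset by blast
    have cd: "card T = card P + card (T - P)"
      using P(1) finT finP by (simp add: card_Diff_subset card_mono)
    have "c * real (card (T - P)) \<le> card ((T - P) \<inter> W)"
      using less.hyps[of "T - P"] cd m P False less.prems(1) by auto
    moreover have "c * real (card P) \<le> card (P \<inter> W)"
      using pieces[of P] P less.prems(1) by auto
    moreover have "card (T \<inter> W) = card (P \<inter> W) + card ((T - P) \<inter> W)"
    proof -
      have "T \<inter> W = (P \<inter> W) \<union> ((T - P) \<inter> W)" using P(1) by auto
      then show ?thesis using finT finP by (simp add: card_Un_disjoint Int_Diff disjoint_iff)
    qed
    ultimately show ?thesis by (simp add: cd algebra_simps)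
  qed (use pieces less.prems in auto)
qed

section \<open>Exploration of a component, and first-moment bounds for connected sets\<close>

lemma expect_power_card:
  assumes "finite E"
  shows "expect E p (\<lambda>F. q ^ card F) = (1 - p + p * q) ^ card E"
  using assms
proof (induction E rule: finite_induct)
  case (insert e E)
  have "expect E p (\<lambda>F. q ^ card (insert e F)) = expect E p (\<lambda>F. q * q ^ card F)"
  proof (intro expect_cong)
    fix F assume "F \<subseteq> E"
    then have "finite F" "e \<notin> F" using insert.hyps finite_subset by auto
    then show "q ^ card (insert e F) = q * q ^ card F" by simp
  qed
  with insert show ?case by (simp add: expect_insert expect_cmult algebra_simps)
qed simp

text \<open>Exploring one active vertex at a time, \<open>q\<close> to the number of active vertices is a supermartingale.\<close>

lemma pr_reach_small:
  assumes p: "0 \<le> p" "p \<le> 1" and q: "0 \<le> q" "q \<le> 1" "(1 - p + p * q) ^ D \<le> q"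
    and E: "graph_on Y E" "A \<subseteq> Y" and deg: "\<And>v. v \<in> Y \<Longrightarrow> D + s \<le> card (nb E v)"
  shows "pr E p (\<lambda>F. card (reach F A) < s) \<le> q ^ card A"
  using E deg
proof (induction s arbitrary: Y E A)
  case 0
  then show ?case using q graph_on_finite[of Y E] by simp
next
  case (Suc s)
  note fin = graph_on_finite[OF Suc.prems(1)]
  have finA: "finite A" using Suc.prems(2) fin finite_subset by blast
  have reach_fin: "finite (reach F A)" if "F \<subseteq> E" for F
    using reach_subset[OF graph_on_subset[OF Suc.prems(1) that] Suc.prems(2)] fin finite_subset by blast
  show ?case
  proof (cases "A = {} \<or> Suc s \<le> card A")
    case True
    then show ?thesis
    proof
      assume "A = {}"
      then show ?thesis using fin p by (simp add: pr_le_1)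
    next
      assume A: "Suc s \<le> card A"
      have "pr E p (\<lambda>F. card (reach F A) < Suc s) = expect E p (\<lambda>F. 0)"
      proof (intro expect_cong)
        fix F assume "F \<subseteq> E"
        then have "card A \<le> card (reach F A)" using reach_fin by (intro card_mono reach_refl) auto
        then show "of_bool (card (reach F A) < Suc s) = (0 :: real)" using A by simp
      qed
      also have "\<dots> = 0" using fin by simp
      finally show ?thesis using q by simp
    qed
  next
    case False
    then obtain v where v: "v \<in> A" by auto
    \<comment> \<open>The edges at \<open>v\<close> are exposed and \<open>v\<close> is retired, so
      every remaining vertex may lose one neighbour. The reserve \<open>s\<close> in the degree
      hypothesis drops by one at the same time and pays for this.\<close>
    define Y' where "Y' = Y - {v}"
    define E' where "E' = inn E Y'"
    define S where "S = E - E'"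
    have E': "graph_on Y' E'" unfolding E'_def by (rule graph_on_inn[OF Suc.prems(1)]) (auto simp: Y'_def)
    have E'_sub: "E' \<subseteq> E" by (auto simp: E'_def inn_def)
    have finS: "finite S" "finite E'" using fin E'_sub finite_subset by (auto simp: S_def)
    have S_v: "v \<in> e" if "e \<in> S" for e
      using that Suc.prems(1) by (auto simp: S_def E'_def inn_def Y'_def graph_on_def)
    have S_in: "{v, u} \<in> S" if "{v, u} \<in> E" for u
      using that by (auto simp: S_def E'_def inn_def Y'_def)
    \<comment> \<open>Only edges that leave \<open>A\<close> produce new active vertices. At most
      \<open>s\<close> neighbours of \<open>v\<close> are active already, so the reserve
      \<open>Suc s\<close> leaves at least \<open>D\<close> such edges.\<close>
    define S0 where "S0 = {e \<in> S. \<not> e \<subseteq> A}"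
    define A' where "A' = (\<lambda>F. (A - {v}) \<union> nb F v)"
    have A'_sub: "A' F \<subseteq> Y'" if "F \<subseteq> S" for F
      using that Suc.prems(2) nb_subset[OF graph_on_subset[OF Suc.prems(1)], of F v]
      by (auto simp: A'_def Y'_def S_def)
    have step: "pr E' p (\<lambda>F2. card (reach (F1 \<union> F2) A) < Suc s) \<le> q ^ (card A - 1) * q ^ card (F1 \<inter> S0)"
      if F1: "F1 \<subseteq> S" for F1
    proof -
      have "pr E' p (\<lambda>F2. card (reach (F1 \<union> F2) A) < Suc s) \<le> pr E' p (\<lambda>F2. card (reach F2 (A' F1)) < s)"
      proof (intro pr_mono p)
        fix F2 assume F2: "F2 \<subseteq> E'" and less: "card (reach (F1 \<union> F2) A) < Suc s"
        have sub: "F1 \<union> F2 \<subseteq> E" using F1 F2 E'_sub by (auto simp: S_def)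
        have "reach F2 (A' F1) \<subseteq> Y'"
          using E' F2 F1 by (intro reach_subset[OF graph_on_subset] A'_sub)
        then have vn: "v \<notin> reach F2 (A' F1)" by (auto simp: Y'_def)
        have "reach F2 (A' F1) \<subseteq> reach (F1 \<union> F2) A"
        proof (rule reach_least)
          show "A' F1 \<subseteq> reach (F1 \<union> F2) A"
            using reach_refl[of A "F1 \<union> F2"] v reach_step[of v "F1 \<union> F2" A]
            by (auto simp: A'_def nb_def)
        qed (auto intro: reach_step)
        then have "insert v (reach F2 (A' F1)) \<subseteq> reach (F1 \<union> F2) A"
          using v reach_refl[of A "F1 \<union> F2"] by auto
        then have "card (insert v (reach F2 (A' F1))) \<le> card (reach (F1 \<union> F2) A)"
          using reach_fin[OF sub] by (intro card_mono)
        moreover have "finite (reach F2 (A' F1))"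
          using \<open>reach F2 (A' F1) \<subseteq> Y'\<close> fin by (auto simp: Y'_def intro: finite_subset)
        ultimately show "card (reach F2 (A' F1)) < s" using vn less by simp
      qed
      also have "\<dots> \<le> q ^ card (A' F1)"
      proof (rule Suc.IH[OF E' A'_sub[OF F1]])
        fix u assume u: "u \<in> Y'"
        have "nb E u - {v} \<subseteq> nb E' u"
          using u Suc.prems(1) by (auto simp: nb_def E'_def inn_def Y'_def graph_on_def)
        then have "card (nb E u - {v}) \<le> card (nb E' u)"
          using finite_nb[OF E'] by (intro card_mono) auto
        moreover have "card (nb E u) - 1 \<le> card (nb E u - {v})"
          using diff_card_le_card_Diff[of "{v}" "nb E u"] by simp
        moreover have "D + Suc s \<le> card (nb E u)" using u Suc.prems(3) by (auto simp: Y'_def)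
        ultimately show "D + s \<le> card (nb E' u)" by linarith
      qed
      also have "\<dots> \<le> q ^ ((card A - 1) + card (F1 \<inter> S0))"
      proof (intro power_decreasing q)
        have fn: "finite (nb F1 v)"
          using finite_nb[OF graph_on_subset[OF Suc.prems(1)], of F1 v] F1 by (auto simp: S_def)
        have "F1 \<inter> S0 \<subseteq> (\<lambda>u. {v, u}) ` (nb F1 v - A)"
        proof
          fix e assume e: "e \<in> F1 \<inter> S0"
          then have "e \<in> E" "v \<in> e" using F1 S_v by (auto simp: S_def)
          then obtain u where u: "e = {v, u}" using Suc.prems(1) by (auto elim!: edge_cases)
          then show "e \<in> (\<lambda>u. {v, u}) ` (nb F1 v - A)" using e v by (auto simp: S0_def nb_def)
        qed
        then have "card (F1 \<inter> S0) \<le> card (nb F1 v - A)"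
          using fn by (intro surj_card_le) auto
        also have "card (A - {v}) + \<dots> = card ((A - {v}) \<union> (nb F1 v - A))"
          using finA fn by (intro card_Un_disjoint[symmetric]) auto
        also have "\<dots> \<le> card (A' F1)"
          using finA fn by (intro card_mono) (auto simp: A'_def)
        finally show "card A - 1 + card (F1 \<inter> S0) \<le> card (A' F1)" using v finA by simp
      qed
      finally show ?thesis by (simp add: power_add)
    qed
    have S_eq: "E = S \<union> E'" using E'_sub by (auto simp: S_def)
    have "pr E p (\<lambda>F. card (reach F A) < Suc s) =
      expect S p (\<lambda>F1. pr E' p (\<lambda>F2. card (reach (F1 \<union> F2) A) < Suc s))"
      by (subst S_eq, rule expect_Un_disjoint) (use finS in \<open>auto simp: S_def\<close>)
    also have "\<dots> \<le> expect S p (\<lambda>F1. q ^ (card A - 1) * q ^ card (F1 \<inter> S0))"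
      using step by (intro expect_mono p)
    also have "\<dots> = q ^ (card A - 1) * expect (S \<inter> S0) p (\<lambda>F. q ^ card F)"
      by (simp add: expect_cmult expect_restrict[OF finS(1), where f = "\<lambda>F. q ^ card F"])
    also have "\<dots> = q ^ (card A - 1) * (1 - p + p * q) ^ card (S \<inter> S0)"
      using finS by (simp add: expect_power_card)
    also have "\<dots> \<le> q ^ (card A - 1) * (1 - p + p * q) ^ D"
    proof (intro mult_left_mono power_decreasing)
      have inj: "inj_on (\<lambda>u. {v, u}) X" for X by (auto simp: inj_on_def doubleton_eq_iff)
      have "card (nb E v) - card (A - {v}) \<le> card (nb E v - (A - {v}))"
        using finA by (intro diff_card_le_card_Diff) auto
      moreover have "card (nb E v - (A - {v})) = card ((\<lambda>u. {v, u}) ` (nb E v - (A - {v})))"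
        by (simp add: card_image inj)
      moreover have "\<dots> \<le> card (S \<inter> S0)"
      proof (intro card_mono)
        show "(\<lambda>u. {v, u}) ` (nb E v - (A - {v})) \<subseteq> S \<inter> S0"
          using nb_subset[OF Suc.prems(1), of v] S_in by (auto simp: S0_def nb_def)
      qed (use finS in auto)
      moreover have "D + Suc s \<le> card (nb E v)" using Suc.prems v by auto
      moreover have "card (A - {v}) \<le> s" using False v finA by auto
      ultimately show "D \<le> card (S \<inter> S0)" by linarith
      show "0 \<le> 1 - p + p * q" using p q by auto
      show "1 - p + p * q \<le> 1" using p q mult_left_le[of q p] by auto
    qed (use q in auto)
    also have "\<dots> \<le> q ^ (card A - 1) * q" using q by (intro mult_left_mono) auto
    also have "\<dots> = q ^ card A"
      using v finA by (metis One_nat_def Suc_pred card_gt_0_iff empty_iff power_Suc2)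
    finally show ?thesis .
  qed
qed

lemma card_star:
  assumes "graph_on V E"
  shows "card {e \<in> E. q \<in> e} = card (nb E q)"
proof -
  have "{e \<in> E. q \<in> e} = (\<lambda>u. {q, u}) ` nb E q"
  proof (intro equalityI subsetI)
    fix e assume e: "e \<in> {e \<in> E. q \<in> e}"
    then have "e \<in> E" by simp
    then obtain x y where "e = {x, y}" by (rule edge_cases[OF assms])
    then have "e = {q, x} \<or> e = {q, y}" using e by auto
    then show "e \<in> (\<lambda>u. {q, u}) ` nb E q" using e by (auto simp: nb_def)
  qed (auto simp: nb_def)
  moreover have "inj_on (\<lambda>u. {q, u}) (nb E q)" by (auto simp: inj_on_def doubleton_eq_iff)
  ultimately show ?thesis by (simp add: card_image)
qed

text \<open>If \<open>U\<close> is connected at density \<open>p\<close>, a spanning edge set of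
  size at most \<open>card U - 1\<close> survives the thinning to density \<open>p'\<close> with
  probability at least \<open>(p' / p) ^ (card U - 1)\<close>.\<close>

lemma pr_conn_thinning:
  assumes E: "graph_on V E" and U: "U \<subseteq> V" "U \<noteq> {}" and p: "0 \<le> p'" "p' \<le> p" "p \<le> 1"
  shows "p' ^ (card U - 1) * pr E p (\<lambda>F. conn F U) \<le> p ^ (card U - 1) * pr E p' (\<lambda>F. conn F U)"
proof (cases "p = 0")
  case False
  then have p0: "0 < p" using p by auto
  define b where "b = p' / p"
  have b: "0 \<le> b" "b \<le> 1" "p' = p * b" using p p0 by (auto simp: b_def)
  note fin = graph_on_finite[OF E]
  have finU: "finite U" using U fin finite_subset by blast
  have "b ^ (card U - 1) * pr E p (\<lambda>F. conn F U) = expect E p (\<lambda>F1. b ^ (card U - 1) * of_bool (conn F1 U))"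
    by (simp only: expect_cmult)
  also have "\<dots> \<le> expect E p (\<lambda>F1. pr F1 b (\<lambda>F. conn F U))"
  proof (intro expect_mono)
    fix F1 assume F1: "F1 \<subseteq> E"
    have finF1: "finite F1" using F1 fin finite_subset by blast
    show "b ^ (card U - 1) * of_bool (conn F1 U) \<le> pr F1 b (\<lambda>F. conn F U)"
    proof (cases "conn F1 U")
      case True
      obtain v where v: "v \<in> U" using U by auto
      have "1 \<le> card U" using v finU card_gt_0_iff[of U] by auto
      then obtain X T where T: "X \<subseteq> U" "card X = card U" "T \<subseteq> inn F1 X" "finite T" "Suc (card T) \<le> card U" "conn T X"
        using connected_subset_tree[OF True finU v, of "card U"] by auto
      have "X = U" using T finU by (intro card_subset_eq)
      have "b ^ (card U - 1) \<le> b ^ card T" using b T by (intro power_decreasing) auto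
      also have "\<dots> = pr F1 b (\<lambda>F. T \<subseteq> F)"
        using T finF1 by (intro pr_contains[symmetric]) (auto simp: inn_def)
      also have "\<dots> \<le> pr F1 b (\<lambda>F. conn F U)"
        using T(6) b \<open>X = U\<close> by (intro pr_mono) (auto intro: conn_mono)
      finally show ?thesis using True by simp
    qed (use b in \<open>simp add: pr_nonneg\<close>)
  qed (use p in auto)
  also have "\<dots> = pr E p' (\<lambda>F. conn F U)"
    using fin by (simp only: b(3) expect_thinning)
  finally have "p ^ (card U - 1) * (b ^ (card U - 1) * pr E p (\<lambda>F. conn F U)) \<le> p ^ (card U - 1) * pr E p' (\<lambda>F. conn F U)"
    using p by (intro mult_left_mono) auto
  then show ?thesis by (simp add: b(3) power_mult_distrib mult.assoc)
qed (use p in auto)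

text \<open>The summand is the probability that the component of \<open>v\<close> is exactly
  \<open>U\<close>, and these events are disjoint for different \<open>U\<close>.\<close>

lemma sum_pr_conn_le:
  assumes E: "graph_on V E" and p: "0 \<le> p" "p \<le> 1"
  shows "(\<Sum>U | U \<subseteq> V \<and> v \<in> U \<and> card U = m. pr E p (\<lambda>F. conn F U) * (1 - p) ^ card (bd E U)) \<le> 1"
proof -
  note fin = graph_on_finite[OF E]
  let ?\<U> = "{U. U \<subseteq> V \<and> v \<in> U \<and> card U = m}"
  have finU: "finite ?\<U>" using fin by auto
  have eq: "pr E p (\<lambda>F. conn F U) * (1 - p) ^ card (bd E U) = pr E p (\<lambda>F. reach F {v} = U)"
    if U: "U \<in> ?\<U>" for U
  proof -
    have disj: "inn E U \<inter> bd E U = {}" by (auto simp: inn_def bd_def)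
    have "pr E p (\<lambda>F. reach F {v} = U) =
       expect E p (\<lambda>F. of_bool (conn (F \<inter> inn E U) U) * of_bool (F \<inter> bd E U = {}))"
    proof (intro expect_cong)
      fix F assume F: "F \<subseteq> E"
      have "bd F U = F \<inter> bd E U" using F by (auto simp: bd_def)
      then show "of_bool (reach F {v} = U) = (of_bool (conn (F \<inter> inn E U) U) * of_bool (F \<inter> bd E U = {}) :: real)"
        using comp_eq_iff[OF graph_on_subset[OF E F], of v U] U conn_Int[OF subset_refl F, of U]
        by simp
    qed
    also have "\<dots> = pr E p (\<lambda>F. conn (F \<inter> inn E U) U) * pr E p (\<lambda>F. F \<inter> bd E U = {})"
      using fin by (intro expect_indep[where f = "\<lambda>F. of_bool (conn F U)" and g = "\<lambda>F. of_bool (F = {})", OF _ disj]) auto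
    also have "pr E p (\<lambda>F. conn (F \<inter> inn E U) U) = pr E p (\<lambda>F. conn F U)"
      using conn_Int[OF subset_refl, of _ E U] by (intro expect_cong) simp
    also have "pr E p (\<lambda>F. F \<inter> bd E U = {}) = (1 - p) ^ card (bd E U)"
    proof -
      have "E \<inter> bd E U = bd E U" by (auto simp: bd_def)
      then show ?thesis using fin pr_avoid[of E p "bd E U"] by simp
    qed
    finally show ?thesis by simp
  qed
  have "(\<Sum>U\<in>?\<U>. pr E p (\<lambda>F. conn F U) * (1 - p) ^ card (bd E U)) =
      expect E p (\<lambda>F. \<Sum>U\<in>?\<U>. of_bool (reach F {v} = U))"
    by (simp only: expect_sum eq cong: sum.cong)
  also have "\<dots> \<le> 1"
  proof (intro expect_le_const)
    fix F
    have "(\<Sum>U\<in>?\<U>. of_bool (reach F {v} = U)) = (\<Sum>U\<in>?\<U> \<inter> {reach F {v}}. 1 :: real)"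
      using finU by (intro sum.mono_neutral_cong_right) auto
    also have "\<dots> \<le> 1"
      using card_mono[of "{reach F {v}}" "?\<U> \<inter> {reach F {v}}"] by simp
    finally show "(\<Sum>U\<in>?\<U>. of_bool (reach F {v} = U)) \<le> (1 :: real)" .
  qed (use fin p in auto)
  finally show ?thesis .
qed

text \<open>Exponential tilting: a subset with at most \<open>r\<close> elements has weight
  \<open>x ^ card Q * x powr (- r)\<close> at least \<open>1\<close>, while the weights
  \<open>x ^ card Q\<close> of all subsets add up to \<open>(1 + x) ^ card U\<close>.\<close>

lemma card_small_subsets:
  fixes x r :: real
  assumes "finite U" "0 < x" "x \<le> 1"
  shows "real (card {Q. Q \<subseteq> U \<and> real (card Q) \<le> r}) \<le> (1 + x) ^ card U * x powr (- r)"
proof -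
  have tot: "(\<Sum>Q\<in>Pow U. x ^ card Q) = (1 + x) ^ card U"
    using assms(1)
  proof (induction U rule: finite_induct)
    case (insert a U)
    have "(\<Sum>Q\<in>Pow (insert a U). x ^ card Q) = (\<Sum>Q\<in>Pow U. x ^ card Q) + (\<Sum>Q\<in>insert a ` Pow U. x ^ card Q)"
      unfolding Pow_insert using insert.hyps by (intro sum.union_disjoint) auto
    also have "(\<Sum>Q\<in>insert a ` Pow U. x ^ card Q) = (\<Sum>Q\<in>Pow U. x * x ^ card Q)"
    proof (subst sum.reindex)
      show "inj_on (insert a) (Pow U)" using insert.hyps by (auto simp: inj_on_def)
      show "sum ((\<lambda>Q. x ^ card Q) \<circ> insert a) (Pow U) = (\<Sum>Q\<in>Pow U. x * x ^ card Q)"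
      proof (intro sum.cong refl)
        fix Q assume "Q \<in> Pow U"
        then have "finite Q" "a \<notin> Q" using insert.hyps finite_subset by auto
        then show "((\<lambda>Q. x ^ card Q) \<circ> insert a) Q = x * x ^ card Q" by simp
      qed
    qed
    finally show ?case using insert by (simp add: sum_distrib_left[symmetric] algebra_simps)
  qed simp
  have "real (card {Q. Q \<subseteq> U \<and> real (card Q) \<le> r}) = (\<Sum>Q | Q \<subseteq> U \<and> real (card Q) \<le> r. 1)"
    by simp
  also have "\<dots> \<le> (\<Sum>Q | Q \<subseteq> U \<and> real (card Q) \<le> r. x ^ card Q * x powr (- r))"
  proof (intro sum_mono)
    fix Q assume "Q \<in> {Q. Q \<subseteq> U \<and> real (card Q) \<le> r}"
    then have "x powr 0 \<le> x powr (real (card Q) - r)"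
      using assms by (intro powr_mono') auto
    then show "1 \<le> x ^ card Q * x powr (- r)"
      using assms by (simp add: powr_diff powr_realpow powr_minus divide_inverse)
  qed
  also have "\<dots> \<le> (\<Sum>Q\<in>Pow U. x ^ card Q * x powr (- r))"
    using assms by (intro sum_mono2) auto
  also have "\<dots> = (1 + x) ^ card U * x powr (- r)"
    by (simp add: sum_distrib_right[symmetric] tot)
  finally show ?thesis .
qed

text \<open>With \<open>p' = 1 / d\<close>, thinning replaces the count of spanning trees of \<open>U\<close>: connected sets become
  components, whose probabilities add up to at most \<open>1\<close>.\<close>

lemma sum_pr_conn_confined_boundary:
  fixes d :: nat and \<epsilon> \<epsilon>1 \<beta> c x p1 p2 :: real
  assumes E: "graph_on V E" and deg: "\<And>v. v \<in> V \<Longrightarrow> card (nb E v) \<le> d" and d: "2 \<le> d"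
    and iso: "\<And>U. U \<subseteq> V \<Longrightarrow> card U = m \<Longrightarrow> \<beta> * d * m \<le> card (bd E U)"
    and p1: "(1 + \<epsilon>1) / d \<le> p1" "p1 \<le> 1 / 2" "p1 * d \<le> 2" and \<epsilon>1: "0 \<le> \<epsilon>1"
    and p2: "0 \<le> p2" "p2 \<le> 1" and p: "1 - (1 - p1) * (1 - p2) \<le> (1 + \<epsilon>) / d"
    and c: "0 \<le> c" and x: "0 < x" "x \<le> 1" and m: "1 \<le> m"
  shows "(\<Sum>U | U \<subseteq> V \<and> v \<in> U \<and> card U = m. \<Sum>Q | Q \<subseteq> U \<and> real (card Q) \<le> c * m.
      expect E p1 (\<lambda>F1. pr E p2 (\<lambda>F2. conn (F1 \<union> F2) U \<and> (\<forall>e\<in>bd F1 U. e \<inter> Q \<noteq> {}))))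
    \<le> exp (m * (ln (1 + \<epsilon>) - \<epsilon>1 * \<beta> + 4 * c + x + c / x))"
    (is "(\<Sum>U\<in>?\<U>. \<Sum>Q\<in>?\<Q> U. ?t U Q) \<le> _")
proof -
  note fin = graph_on_finite[OF E]
  define p where "p = 1 - (1 - p1) * (1 - p2)"
  define p' where "p' = 1 / real d"
  have d0: "0 < real d" using d by simp
  have p'p1: "p' \<le> p1" using p1(1) \<epsilon>1 d0 by (simp add: p'_def field_simps)
  have p'0: "0 < p'" "p' \<le> 1" using d0 d by (auto simp: p'_def)
  have p1_01: "0 \<le> p1" "p1 \<le> 1" using p'p1 p'0 p1(2) by auto
  have p1p: "p1 \<le> p"
  proof -
    have "(1 - p1) * (1 - p2) \<le> (1 - p1) * 1" using p2 p1_01 by (intro mult_left_mono) auto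
    then show ?thesis by (simp add: p_def)
  qed
  have p_01: "0 \<le> p" "p \<le> 1" using p1p p1_01 p2 by (auto simp: p_def)
  have exp_p1: "exp (- (2 * p1)) \<le> 1 - p1"
  proof -
    have "exp (- (2 * p1)) \<le> 1 / (1 + 2 * p1)"
      using exp_ge_add_one_self[of "2 * p1"] p1_01 by (simp add: exp_minus field_simps)
    also have "\<dots> \<le> 1 - p1"
    proof -
      have "0 \<le> p1 * (1 - 2 * p1)" using p1_01 p1(2) by (intro mult_nonneg_nonneg) auto
      then show ?thesis using p1_01 by (simp add: field_simps)
    qed
    finally show ?thesis .
  qed
  \<comment> \<open>The excess of \<open>p1\<close> over \<open>1 / d\<close> makes every absent
    boundary edge less likely by the factor \<open>exp (- (\<epsilon>1 / d))\<close>. Over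
    \<open>\<beta> * d * m\<close> boundary edges this is the gain set against the factor
    \<open>(1 + \<epsilon>) ^ m\<close> of the density change.\<close>
  have ratio: "1 - p1 \<le> (1 - p') * exp (- (\<epsilon>1 / d))"
  proof -
    have "1 - p1 \<le> 1 - p' - \<epsilon>1 / d" using p1(1) by (simp add: p'_def add_divide_distrib)
    also have "\<dots> \<le> (1 - p') * (1 - \<epsilon>1 / d)"
    proof -
      have "1 - p' - t \<le> (1 - p') * (1 - t)" if "0 \<le> t" for t
        using mult_nonneg_nonneg[of p' t] that p'0 by (simp add: algebra_simps)
      then show ?thesis using \<epsilon>1 d0 by simp
    qed
    also have "\<dots> \<le> (1 - p') * exp (- (\<epsilon>1 / d))"
      using p'0 exp_ge_add_one_self[of "- (\<epsilon>1 / d)"] by (intro mult_left_mono) auto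
    finally show ?thesis .
  qed
  define K where "K = exp (m * (4 * c - \<epsilon>1 * \<beta>))"
  have term_le: "?t U Q \<le> pr E p (\<lambda>F. conn F U) * (1 - p') ^ card (bd E U) * K"
    if U: "U \<in> ?\<U>" and Q: "Q \<in> ?\<Q> U" for U Q
  proof -
    \<comment> \<open>Connectedness inspects only edges inside \<open>U\<close>, and the boundary
      condition says that \<open>F1\<close> misses \<open>?Z\<close>. The two parts are independent,
      and in the first one both rounds merge into density \<open>p\<close>.\<close>
    let ?I = "inn E U" and ?Z = "{e \<in> bd E U. e \<inter> Q = {}}" and ?b = "card (bd E U)"
    define h where "h = (\<lambda>G. pr E p2 (\<lambda>F2. conn (G \<union> F2) U))"
    have finU: "finite U" using U fin finite_subset by auto
    have "?t U Q = expect E p1 (\<lambda>F1. h (F1 \<inter> ?I) * of_bool (F1 \<inter> ?Z = {}))"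
    proof (intro expect_cong)
      fix F1 assume F1: "F1 \<subseteq> E"
      have B: "(\<forall>e\<in>bd F1 U. e \<inter> Q \<noteq> {}) \<longleftrightarrow> F1 \<inter> ?Z = {}" using F1 by (auto simp: bd_def)
      have C: "conn (F1 \<union> F2) U \<longleftrightarrow> conn ((F1 \<inter> ?I) \<union> F2) U" if "F2 \<subseteq> E" for F2
      proof -
        have "inn (F1 \<union> F2) U = inn ((F1 \<inter> ?I) \<union> F2) U" using F1 that by (auto simp: inn_def)
        then show ?thesis by (metis conn_inn)
      qed
      have "pr E p2 (\<lambda>F2. conn (F1 \<union> F2) U \<and> (\<forall>e\<in>bd F1 U. e \<inter> Q \<noteq> {})) =
         expect E p2 (\<lambda>F2. of_bool (conn ((F1 \<inter> ?I) \<union> F2) U) * of_bool (F1 \<inter> ?Z = {}))"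
        by (intro expect_cong) (simp only: B C of_bool_conj)
      then show "pr E p2 (\<lambda>F2. conn (F1 \<union> F2) U \<and> (\<forall>e\<in>bd F1 U. e \<inter> Q \<noteq> {})) =
         h (F1 \<inter> ?I) * of_bool (F1 \<inter> ?Z = {})"
        by (simp only: expect_multc h_def)
    qed
    also have "\<dots> = expect E p1 (\<lambda>F1. h (F1 \<inter> ?I)) * pr E p1 (\<lambda>F. F \<inter> ?Z = {})"
      using fin by (intro expect_indep[where f = h and g = "\<lambda>F. of_bool (F = {})"]) (auto simp: inn_def bd_def)
    also have "pr E p1 (\<lambda>F. F \<inter> ?Z = {}) = (1 - p1) ^ card ?Z"
    proof -
      have "E \<inter> ?Z = ?Z" by (auto simp: bd_def)
      then show ?thesis using fin pr_avoid[of E p1 ?Z] by simp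
    qed
    also have "expect E p1 (\<lambda>F1. h (F1 \<inter> ?I)) = pr E p (\<lambda>F. conn F U)"
    proof -
      have "expect E p1 (\<lambda>F1. h (F1 \<inter> ?I)) = expect E p1 (\<lambda>F1. pr E p2 (\<lambda>F2. conn (F1 \<union> F2) U))"
        unfolding h_def
      proof (intro expect_cong)
        fix F1 F2 assume "F1 \<subseteq> E" "F2 \<subseteq> E"
        then have "inn (F1 \<union> F2) U = inn ((F1 \<inter> ?I) \<union> F2) U" by (auto simp: inn_def)
        then have "conn (F1 \<inter> ?I \<union> F2) U \<longleftrightarrow> conn (F1 \<union> F2) U"
          by (metis conn_inn)
        then show "of_bool (conn (F1 \<inter> ?I \<union> F2) U) = (of_bool (conn (F1 \<union> F2) U) :: real)"
          by simp
      qed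
      also have "\<dots> = pr E p (\<lambda>F. conn F U)"
        using fin by (simp only: p_def expect_two_rounds)
      finally show ?thesis .
    qed
    finally have eq: "?t U Q = pr E p (\<lambda>F. conn F U) * (1 - p1) ^ card ?Z" .
    have finQ: "finite Q" using Q finU finite_subset by auto
    \<comment> \<open>Tolerating first-round edges at \<open>Q\<close> gives up at most
      \<open>d * card Q\<close> boundary edges, hence a factor of at most
      \<open>exp (4 * c * m)\<close> because \<open>p1 * d \<le> 2\<close>.\<close>
    have cardZ: "?b \<le> card ?Z + d * card Q"
    proof -
      have star: "card {e \<in> E. q \<in> e} \<le> d" if "q \<in> Q" for q
      proof -
        have "q \<in> V" using that Q U by auto
        then show ?thesis using deg[of q] card_star[OF E, of q] by simp
      qed
      have "bd E U \<subseteq> ?Z \<union> (\<Union>q\<in>Q. {e \<in> E. q \<in> e})" by (auto simp: bd_def)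
      then have "?b \<le> card (?Z \<union> (\<Union>q\<in>Q. {e \<in> E. q \<in> e}))"
        using fin finQ by (intro card_mono) (auto simp: bd_def)
      also have "\<dots> \<le> card ?Z + card (\<Union>q\<in>Q. {e \<in> E. q \<in> e})" by (rule card_Un_le)
      also have "card (\<Union>q\<in>Q. {e \<in> E. q \<in> e}) \<le> (\<Sum>q\<in>Q. card {e \<in> E. q \<in> e})"
        using finQ by (rule card_UN_le)
      also have "\<dots> \<le> (\<Sum>q\<in>Q. d)" using star by (intro sum_mono)
      finally show ?thesis by (simp add: mult.commute)
    qed
    have "(1 - p1) ^ card ?Z * exp (- (4 * c * m)) \<le> (1 - p1) ^ card ?Z * (1 - p1) ^ (d * card Q)"
    proof (intro mult_left_mono)
      have "p1 * d * card Q \<le> 2 * (c * m)" using Q p1 p1_01 by (intro mult_mono) auto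
      then have "exp (- (4 * c * m)) \<le> exp (- (2 * p1)) ^ (d * card Q)"
        by (simp add: exp_of_nat_mult[symmetric] algebra_simps)
      also have "\<dots> \<le> (1 - p1) ^ (d * card Q)" using exp_p1 by (intro power_mono) auto
      finally show "exp (- (4 * c * m)) \<le> (1 - p1) ^ (d * card Q)" .
    qed (use p1_01 in auto)
    also have "\<dots> \<le> (1 - p1) ^ ?b"
      unfolding power_add[symmetric] using cardZ p1_01 by (intro power_decreasing) auto
    also have "\<dots> \<le> ((1 - p') * exp (- (\<epsilon>1 / d))) ^ ?b"
      using ratio p1_01 by (intro power_mono) auto
    also have "\<dots> = (1 - p') ^ ?b * exp (- (\<epsilon>1 * (?b / d)))"
      by (simp add: power_mult_distrib exp_of_nat_mult[symmetric] mult.commute)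
    also have "\<dots> \<le> (1 - p') ^ ?b * exp (- (\<epsilon>1 * (\<beta> * m)))"
    proof -
      have "\<beta> * m \<le> ?b / d" using iso[of U] U d0 by (auto simp: field_simps)
      from mult_left_mono[OF this \<epsilon>1] show ?thesis
        using p'0 by (intro mult_left_mono) simp_all
    qed
    finally have "(1 - p1) ^ card ?Z \<le> (1 - p') ^ ?b * exp (- (\<epsilon>1 * (\<beta> * m))) * exp (4 * c * m)"
      by (simp add: exp_minus field_simps)
    also have "\<dots> = (1 - p') ^ ?b * K"
      by (simp add: K_def mult_exp_exp mult.assoc) (simp add: algebra_simps)
    finally show ?thesis unfolding eq mult.assoc using p_01 by (intro mult_left_mono pr_nonneg)
  qed
  have count: "real (card (?\<Q> U)) \<le> exp (m * (x + c / x))" if U: "U \<in> ?\<U>" for U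
  proof -
    have "real (card (?\<Q> U)) \<le> (1 + x) ^ m * x powr (- (c * m))"
      using card_small_subsets[of U x "c * m"] U fin x finite_subset by auto
    also have "\<dots> \<le> exp x ^ m * exp (m * (c / x))"
    proof (intro mult_mono power_mono)
      have "- ln x \<le> 1 / x" using ln_le_minus_one[of "1 / x"] x by (simp add: ln_div)
      then have "c * m * (- ln x) \<le> c * m * (1 / x)" using c by (intro mult_left_mono) auto
      then show "x powr - (c * m) \<le> exp (m * (c / x))"
        using x by (simp add: powr_def mult_ac)
    qed (use x exp_ge_add_one_self[of x] in auto)
    also have "\<dots> = exp (m * (x + c / x))"
      by (simp add: exp_of_nat_mult[symmetric] mult_exp_exp algebra_simps)
    finally show ?thesis .
  qed
  have pd: "1 \<le> p * d" "p * d \<le> 1 + \<epsilon>"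
  proof -
    have "p' \<le> p" using p'p1 p1p by simp
    then show "1 \<le> p * d" using d0 by (simp add: p'_def field_simps)
    have "p \<le> (1 + \<epsilon>) / d" using p by (simp only: p_def)
    then show "p * d \<le> 1 + \<epsilon>" using d0 by (simp add: field_simps)
  qed
  have "(\<Sum>U\<in>?\<U>. \<Sum>Q\<in>?\<Q> U. ?t U Q) \<le>
     (\<Sum>U\<in>?\<U>. \<Sum>Q\<in>?\<Q> U. pr E p (\<lambda>F. conn F U) * (1 - p') ^ card (bd E U) * K)"
    using term_le by (intro sum_mono) blast
  also have "\<dots> = (\<Sum>U\<in>?\<U>. real (card (?\<Q> U)) * (pr E p (\<lambda>F. conn F U) * (1 - p') ^ card (bd E U) * K))"
    by simp
  also have "\<dots> \<le> (\<Sum>U\<in>?\<U>. exp (m * (x + c / x)) * (((1 + \<epsilon>) ^ m * pr E p' (\<lambda>F. conn F U)) * (1 - p') ^ card (bd E U) * K))"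
  proof (rule sum_mono)
    fix U assume U: "U \<in> ?\<U>"
    have "p' ^ (m - 1) * pr E p (\<lambda>F. conn F U) \<le> p ^ (m - 1) * pr E p' (\<lambda>F. conn F U)"
      using pr_conn_thinning[OF E, of U p' p] U p'0 p'p1 p1p p_01 by auto
    then have "pr E p (\<lambda>F. conn F U) \<le> (p ^ (m - 1) * pr E p' (\<lambda>F. conn F U)) / p' ^ (m - 1)"
      using p'0 by (simp add: field_simps)
    also have "\<dots> = (p * d) ^ (m - 1) * pr E p' (\<lambda>F. conn F U)"
      using d0 by (simp add: p'_def power_divide power_mult_distrib)
    also have "\<dots> \<le> (1 + \<epsilon>) ^ m * pr E p' (\<lambda>F. conn F U)"
    proof (intro mult_right_mono pr_nonneg)
      have "(p * d) ^ (m - 1) \<le> (p * d) ^ m" using pd by (intro power_increasing) auto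
      also have "\<dots> \<le> (1 + \<epsilon>) ^ m" using pd by (intro power_mono) auto
      finally show "(p * d) ^ (m - 1) \<le> (1 + \<epsilon>) ^ m" .
    qed (use p'0 in auto)
    finally have "pr E p (\<lambda>F. conn F U) \<le> (1 + \<epsilon>) ^ m * pr E p' (\<lambda>F. conn F U)" .
    then have "pr E p (\<lambda>F. conn F U) * (1 - p') ^ card (bd E U) * K \<le>
        (1 + \<epsilon>) ^ m * pr E p' (\<lambda>F. conn F U) * (1 - p') ^ card (bd E U) * K"
      using p'0 by (intro mult_right_mono) (simp_all add: K_def)
    moreover have "0 \<le> pr E p (\<lambda>F. conn F U) * (1 - p') ^ card (bd E U) * K"
      using p'0 p_01 by (simp add: K_def pr_nonneg)
    ultimately show "real (card (?\<Q> U)) * (pr E p (\<lambda>F. conn F U) * (1 - p') ^ card (bd E U) * K) \<le>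
       exp (m * (x + c / x)) * ((1 + \<epsilon>) ^ m * pr E p' (\<lambda>F. conn F U) * (1 - p') ^ card (bd E U) * K)"
      using count[OF U] by (intro mult_mono[OF _ _ exp_ge_zero]) simp_all
  qed
  also have "\<dots> = exp (m * (x + c / x)) * (1 + \<epsilon>) ^ m * K *
      (\<Sum>U\<in>?\<U>. pr E p' (\<lambda>F. conn F U) * (1 - p') ^ card (bd E U))"
    unfolding sum_distrib_left by (intro sum.cong refl) (simp only: mult_ac)
  also have "\<dots> \<le> exp (m * (x + c / x)) * (1 + \<epsilon>) ^ m * K * 1"
    using sum_pr_conn_le[OF E, of p'] p'0 pd by (intro mult_left_mono) (auto simp: K_def)
  also have "\<dots> = exp (m * (ln (1 + \<epsilon>) - \<epsilon>1 * \<beta> + 4 * c + x + c / x))"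
  proof -
    have "0 < 1 + \<epsilon>" using pd by linarith
    then have "(1 + \<epsilon>) ^ m = exp (m * ln (1 + \<epsilon>))" by (simp add: exp_of_nat_mult)
    then show ?thesis by (simp add: K_def mult_exp_exp algebra_simps)
  qed
  finally show ?thesis .
qed

section \<open>Sprinkling: growing sets outside \<open>Q\<close> and joining them by short
  paths\<close>

definition spread :: "'v set \<Rightarrow> 'v set set \<Rightarrow> 'v set \<Rightarrow> 'v set" where
  "spread Q R L = L \<union> {x. x \<notin> Q \<and> (\<exists>y\<in>L. {x, y} \<in> R)}"

lemma spread_subset: "graph_on V R \<Longrightarrow> L \<subseteq> V - Q \<Longrightarrow> spread Q R L \<subseteq> V - Q"
  by (auto simp: spread_def graph_on_def)

lemma spread_reach:
  assumes "L \<subseteq> reach {e \<in> R. e \<inter> Q = {}} X" "L \<inter> Q = {}" "R' \<subseteq> R"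
  shows "spread Q R' L \<subseteq> reach {e \<in> R. e \<inter> Q = {}} X"
proof
  fix x assume "x \<in> spread Q R' L"
  then consider "x \<in> L" | y where "x \<notin> Q" "y \<in> L" "{x, y} \<in> R'" by (auto simp: spread_def)
  then show "x \<in> reach {e \<in> R. e \<inter> Q = {}} X"
  proof cases
    case 2
    then have "{y, x} \<in> {e \<in> R. e \<inter> Q = {}}" using assms by (auto simp: insert_commute)
    then show ?thesis using 2 assms(1) reach_step[of y _ X x] by blast
  qed (use assms in auto)
qed

lemma exp_minus_le:
  fixes y :: real
  assumes "0 \<le> y"
  shows "exp (- y) \<le> 1 / (1 + y)"
  using exp_ge_add_one_self[of y] assms by (simp add: exp_minus field_simps)

lemma one_minus_power_ge:
  fixes p :: real
  assumes "0 \<le> p" "p \<le> 1" "p * real k \<le> 1"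
  shows "p * real k / 2 \<le> 1 - (1 - p) ^ k"
proof -
  let ?y = "p * real k"
  have "(1 - p) ^ k \<le> exp (- p) ^ k"
    using assms exp_ge_add_one_self[of "- p"] by (intro power_mono) auto
  also have "\<dots> = exp (- ?y)" by (simp add: exp_of_nat_mult[symmetric] mult.commute)
  also have "\<dots> \<le> 1 / (1 + ?y)"
    using assms by (intro exp_minus_le) auto
  also have "\<dots> \<le> 1 - ?y / 2"
  proof -
    have "0 \<le> ?y * (1 - ?y)" using assms by (intro mult_nonneg_nonneg) auto
    then have "1 \<le> (1 - ?y / 2) * (1 + ?y)" by (simp add: field_simps)
    moreover have "0 < 1 + ?y" using assms by (simp add: add_pos_nonneg)
    ultimately show ?thesis by (simp only: pos_divide_le_eq)
  qed
  finally show ?thesis by simp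
qed

text \<open>For \<open>x\<close> outside \<open>L\<close>, membership in \<open>spread Q R L\<close>
  depends only on the edges from \<open>x\<close> into \<open>L\<close>, and these edge sets are
  disjoint for different \<open>x\<close>. Each \<open>x\<close> is caught with probability at least
  \<open>\<delta> / 2\<close> times \<open>card (nb E x \<inter> L) / d\<close>, so the weighted
  Chernoff bound applies.\<close>

lemma pr_spread:
  fixes w :: "'v \<Rightarrow> real" and \<delta> b M :: real
  assumes E: "graph_on V E" and deg: "\<And>v. v \<in> V \<Longrightarrow> card (nb E v) \<le> d" and d: "1 \<le> d"
    and L: "L \<subseteq> V - Q" and \<delta>: "0 < \<delta>" "\<delta> \<le> 1"
    and w: "\<And>x. x \<in> V - Q \<Longrightarrow> 0 \<le> w x" "\<And>x. x \<in> V - Q \<Longrightarrow> w x \<le> b" and b: "0 < b"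
    and M: "M \<le> (\<Sum>x\<in>V - Q. w x * (card (nb E x \<inter> L) / d))"
  shows "pr E (\<delta> / d) (\<lambda>R. (\<Sum>x\<in>spread Q R L. w x) < \<delta> * M / 4) \<le> exp (- (\<delta> * M / (24 * b)))"
proof -
  note fin = graph_on_finite[OF E]
  let ?p = "\<delta> / d"
  have d0: "0 < real d" using d by simp
  have p: "0 \<le> ?p" "?p \<le> 1" using \<delta> d d0 by (auto simp: field_simps)
  define X where "X = (\<lambda>x. if x \<in> L then {} else (\<lambda>y. {x, y}) ` (nb E x \<inter> L))"
  define P where "P = (\<lambda>x (G :: 'v set set). x \<in> L \<or> G \<noteq> {})"
  have prP: "\<delta> / 2 * (card (nb E x \<inter> L) / d) \<le> pr E ?p (\<lambda>F. P x (F \<inter> X x))" if x: "x \<in> V - Q" for x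
  proof -
    have c: "card (nb E x \<inter> L) \<le> d"
      using deg[of x] x card_mono[OF finite_nb[OF E], of "nb E x \<inter> L" x] by auto
    show ?thesis
    proof (cases "x \<in> L")
      case True
      have "\<delta> / 2 * (card (nb E x \<inter> L) / d) \<le> 1 * 1" using \<delta> c d0 by (intro mult_mono) auto
      then show ?thesis using True fin by (simp add: P_def)
    next
      case False
      let ?k = "card (nb E x \<inter> L)"
      have inj: "inj_on (\<lambda>y. {x, y}) (nb E x \<inter> L)" by (auto simp: inj_on_def doubleton_eq_iff)
      have XE: "E \<inter> X x = X x" using False by (auto simp: X_def nb_def)
      have "pr E ?p (\<lambda>F. P x (F \<inter> X x)) = pr E ?p (\<lambda>F. \<not> F \<inter> X x = {})"
        using False by (simp add: P_def)
      also have "\<dots> = 1 - (1 - ?p) ^ card (X x)"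
        using fin pr_not[of E ?p "\<lambda>F. F \<inter> X x = {}"] pr_avoid[of E ?p "X x"] by (simp add: XE)
      also have "card (X x) = ?k" using False inj by (simp add: X_def card_image)
      also have "1 - (1 - ?p) ^ ?k \<ge> ?p * ?k / 2"
      proof (intro one_minus_power_ge p)
        have "\<delta> * real ?k \<le> 1 * real d" using \<delta> c by (intro mult_mono) auto
        then show "?p * ?k \<le> 1" using d0 by (simp add: field_simps)
      qed
      finally show ?thesis by simp
    qed
  qed
  have sum_eq: "(\<Sum>x\<in>V - Q. w x * of_bool (P x (R \<inter> X x))) = (\<Sum>x\<in>spread Q R L. w x)" if R: "R \<subseteq> E" for R
  proof -
    have iff: "P x (R \<inter> X x) \<longleftrightarrow> x \<in> spread Q R L" if "x \<in> V - Q" for x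
      using that R by (auto simp: P_def X_def spread_def nb_def)
    have sub: "spread Q R L \<subseteq> V - Q" by (rule spread_subset[OF graph_on_subset[OF E R] L])
    have "(\<Sum>x\<in>V - Q. w x * of_bool (P x (R \<inter> X x))) = (\<Sum>x\<in>V - Q. if x \<in> spread Q R L then w x else 0)"
      using iff by (intro sum.cong) auto
    also have "\<dots> = (\<Sum>x\<in>spread Q R L. w x)"
      using fin sub by (simp add: sum.inter_restrict[symmetric] Int_absorb1)
    finally show ?thesis .
  qed
  have "pr E ?p (\<lambda>R. (\<Sum>x\<in>V - Q. w x * of_bool (P x (R \<inter> X x))) < (\<delta> / 2 * M) / 2)
      \<le> exp (- (\<delta> / 2 * M) / (12 * b))"
  proof (rule pr_weighted_lower_tail)
    show "X i \<inter> X j = {}" if "i \<noteq> j" for i j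
      using that by (auto simp: X_def doubleton_eq_iff)
    have "\<delta> / 2 * M \<le> \<delta> / 2 * (\<Sum>x\<in>V - Q. w x * (card (nb E x \<inter> L) / d))"
      using M \<delta> by (intro mult_left_mono) auto
    also have "\<dots> = (\<Sum>x\<in>V - Q. w x * (\<delta> / 2 * (card (nb E x \<inter> L) / d)))"
      unfolding sum_distrib_left by (intro sum.cong) (simp_all only: mult_ac)
    also have "\<dots> \<le> (\<Sum>x\<in>V - Q. w x * pr E ?p (\<lambda>F. P x (F \<inter> X x)))"
      using prP w by (intro sum_mono mult_left_mono) blast+
    finally show "\<delta> / 2 * M \<le> (\<Sum>x\<in>V - Q. w x * pr E ?p (\<lambda>F. P x (F \<inter> X x)))" .
  qed (use fin p w b in auto)
  moreover have "pr E ?p (\<lambda>R. (\<Sum>x\<in>V - Q. w x * of_bool (P x (R \<inter> X x))) < (\<delta> / 2 * M) / 2) =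
     pr E ?p (\<lambda>R. (\<Sum>x\<in>spread Q R L. w x) < \<delta> * M / 4)"
    by (intro expect_cong) (simp add: sum_eq)
  ultimately show ?thesis by (simp add: mult.commute)
qed

text \<open>Two rounds along the walks of length two from \<open>S\<close> to \<open>L\<close>.
  Middle vertices are weighted by what they could pass on to \<open>S\<close>; the first round
  catches a fraction of this weight and, after an exchange of summation, the second round catches a
  fraction of \<open>f\<close>.\<close>

lemma pr_two_spreads:
  fixes f :: "'v \<Rightarrow> real" and \<delta> r B :: real
  assumes E: "graph_on V E" and deg: "\<And>v. v \<in> V \<Longrightarrow> card (nb E v) \<le> d" and d: "1 \<le> d"
    and L: "L \<subseteq> V - Q" and \<delta>: "0 < \<delta>" "\<delta> \<le> 1" and r: "0 < r" "r \<le> 1"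
    and S: "S \<subseteq> V - Q" and f: "\<And>u. u \<in> S \<Longrightarrow> 0 \<le> f u" "\<And>u. u \<in> S \<Longrightarrow> f u \<le> d"
    and walks: "\<And>u. u \<in> S \<Longrightarrow> u \<notin> L \<Longrightarrow> r * d\<^sup>2 \<le> (\<Sum>x\<in>nb E u - Q. card (nb E x \<inter> L))"
    and B: "0 \<le> B" "B \<le> (\<Sum>u\<in>S. f u)"
  shows "expect E (\<delta> / d) (\<lambda>R1. pr E (\<delta> / d)
      (\<lambda>R2. (\<Sum>u\<in>S \<inter> spread Q R2 (spread Q R1 L). f u) < \<delta>\<^sup>2 * r / 32 * B))
    \<le> 2 * exp (- (\<delta>\<^sup>2 * r / 192 * B / d))"
proof -
  note fin = graph_on_finite[OF E]
  let ?p = "\<delta> / d"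
  have d0: "0 < real d" using d by simp
  have p: "0 \<le> ?p" "?p \<le> 1" using \<delta> d d0 by (auto simp: field_simps)
  have finS: "finite S" using S fin finite_subset by blast
  have k1: "\<delta>\<^sup>2 * r \<le> 1" using \<delta> r by (intro mult_le_one power_le_one) auto
  show ?thesis
  \<comment> \<open>If \<open>L\<close> itself carries half of \<open>f\<close>, nothing has to be
    caught, since spreading keeps \<open>L\<close>. Otherwise half of \<open>f\<close> lies on
    \<open>S - L\<close>, where the walk hypothesis is available.\<close>
  proof (cases "B / 2 \<le> (\<Sum>u\<in>S \<inter> L. f u)")
    case True
    have "\<not> (\<Sum>u\<in>S \<inter> spread Q R2 (spread Q R1 L). f u) < \<delta>\<^sup>2 * r / 32 * B" for R1 R2
    proof -
      have "\<delta>\<^sup>2 * r / 32 * B \<le> 1 / 2 * B" using k1 by (intro mult_right_mono B(1)) linarith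
      also have "\<dots> \<le> (\<Sum>u\<in>S \<inter> L. f u)" using True by simp
      also have "\<dots> \<le> (\<Sum>u\<in>S \<inter> spread Q R2 (spread Q R1 L). f u)"
        using finS f by (intro sum_mono2) (auto simp: spread_def)
      finally show ?thesis by simp
    qed
    then show ?thesis using fin by simp
  next
    case False
    define S2 where "S2 = S - L"
    have S2: "S2 \<subseteq> V - Q" "finite S2" "S2 \<subseteq> S" using S finS by (auto simp: S2_def)
    have "(\<Sum>u\<in>S. f u) = (\<Sum>u\<in>S \<inter> L. f u) + (\<Sum>u\<in>S2. f u)"
      unfolding S2_def using finS by (rule sum.Int_Diff)
    then have B2: "B / 2 \<le> (\<Sum>u\<in>S2. f u)" using False B by simp
    define w where "w = (\<lambda>x. (\<Sum>u\<in>nb E x \<inter> S2. f u) / d)"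
    have w0: "0 \<le> w x" for x using f S2 by (auto simp: w_def intro!: divide_nonneg_nonneg sum_nonneg)
    have wd: "w x \<le> d" if "x \<in> V" for x
    proof -
      have "(\<Sum>u\<in>nb E x \<inter> S2. f u) \<le> (\<Sum>u\<in>nb E x \<inter> S2. real d)"
        using f S2 by (intro sum_mono) auto
      also have "\<dots> = real (card (nb E x \<inter> S2)) * d" by simp
      also have "\<dots> \<le> real d * d"
      proof -
        have "card (nb E x \<inter> S2) \<le> card (nb E x)" using finite_nb[OF E] by (intro card_mono) auto
        then show ?thesis using deg[OF that] by (intro mult_right_mono) auto
      qed
      finally show ?thesis using d0 by (simp add: w_def field_simps)
    qed
    \<comment> \<open>The weight secured by the first round. The second round retains
      \<open>\<delta> * M2 / 4\<close>, which is exactly the threshold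
      \<open>\<delta>\<^sup>2 * r / 32 * B\<close>.\<close>
    define M2 where "M2 = \<delta> * r * B / 8"
    have b1: "pr E ?p (\<lambda>R. (\<Sum>x\<in>spread Q R L. w x) < \<delta> * (r * B / 2) / 4) \<le> exp (- (\<delta> * (r * B / 2) / (24 * real d)))"
    proof (rule pr_spread[OF E deg d L \<delta>])
      have "r * B / 2 = r * (B / 2)" by simp
      also have "\<dots> \<le> r * (\<Sum>u\<in>S2. f u)" using B2 r by (intro mult_left_mono) auto
      also have "\<dots> = (\<Sum>u\<in>S2. f u * (r * d\<^sup>2) / d\<^sup>2)"
        using d0 by (simp add: sum_distrib_left mult.commute)
      also have "\<dots> \<le> (\<Sum>u\<in>S2. f u * (\<Sum>x\<in>nb E u - Q. card (nb E x \<inter> L)) / d\<^sup>2)"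
        using walks f by (intro sum_mono divide_right_mono mult_left_mono) (auto simp: S2_def)
      also have "\<dots> = (\<Sum>u\<in>S2. f u * (\<Sum>x\<in>nb E u \<inter> (V - Q). real (card (nb E x \<inter> L)))) / d\<^sup>2"
      proof -
        have "nb E u - Q = nb E u \<inter> (V - Q)" for u using nb_subset[OF E] by blast
        then show ?thesis by (simp add: sum_divide_distrib)
      qed
      also have "\<dots> = (\<Sum>x\<in>V - Q. real (card (nb E x \<inter> L)) * (\<Sum>u\<in>nb E x \<inter> S2. f u)) / d\<^sup>2"
        using S2 fin by (subst sum_nb_swap) auto
      also have "\<dots> = (\<Sum>x\<in>V - Q. w x * (card (nb E x \<inter> L) / d))"
        unfolding sum_divide_distrib[of _ "V - Q"] w_def
        by (intro sum.cong refl) (simp add: power2_eq_square mult.commute)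
      finally show "r * B / 2 \<le> (\<Sum>x\<in>V - Q. w x * (card (nb E x \<inter> L) / d))" .
    qed (use w0 wd d0 in auto)
    have b2: "pr E ?p (\<lambda>R2. (\<Sum>u\<in>S \<inter> spread Q R2 L1. f u) < \<delta>\<^sup>2 * r / 32 * B)
        \<le> exp (- (\<delta> * M2 / (24 * real d)))"
      if L1: "L1 \<subseteq> V - Q" "M2 \<le> (\<Sum>x\<in>L1. w x)" for L1
    proof -
      define g where "g = (\<lambda>u. if u \<in> S2 then f u else 0)"
      have finL1: "finite L1" using L1 fin finite_subset by blast
      have "pr E ?p (\<lambda>R. (\<Sum>x\<in>spread Q R L1. g x) < \<delta> * M2 / 4) \<le> exp (- (\<delta> * M2 / (24 * real d)))"
      proof (rule pr_spread[OF E deg d L1(1) \<delta>])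
        have "M2 \<le> (\<Sum>x\<in>L1. 1 * (\<Sum>u\<in>nb E x \<inter> S2. f u)) / d"
          using L1(2) by (simp add: w_def sum_divide_distrib)
        also have "(\<Sum>x\<in>L1. 1 * (\<Sum>u\<in>nb E x \<inter> S2. f u)) = (\<Sum>u\<in>S2. f u * (\<Sum>x\<in>nb E u \<inter> L1. 1))"
          using finL1 S2(2) by (rule sum_nb_swap)
        also have "\<dots> / d = (\<Sum>u\<in>S2. f u * (card (nb E u \<inter> L1) / d))"
          by (simp add: sum_divide_distrib)
        also have "\<dots> = (\<Sum>u\<in>V - Q. g u * (card (nb E u \<inter> L1) / d))"
          using S2 fin by (intro sum.mono_neutral_cong_left) (auto simp: g_def)
        finally show "M2 \<le> (\<Sum>u\<in>V - Q. g u * (card (nb E u \<inter> L1) / d))" .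
      qed (use f S2 d0 in \<open>auto simp: g_def\<close>)
      moreover have "pr E ?p (\<lambda>R2. (\<Sum>u\<in>S \<inter> spread Q R2 L1. f u) < \<delta>\<^sup>2 * r / 32 * B) \<le>
         pr E ?p (\<lambda>R. (\<Sum>x\<in>spread Q R L1. g x) < \<delta> * M2 / 4)"
      proof (intro pr_mono p)
        fix R assume R: "R \<subseteq> E" and lt: "(\<Sum>u\<in>S \<inter> spread Q R L1. f u) < \<delta>\<^sup>2 * r / 32 * B"
        have "finite (spread Q R L1)"
          using spread_subset[OF graph_on_subset[OF E R] L1(1)] fin finite_subset by blast
        then have "(\<Sum>x\<in>spread Q R L1. g x) = (\<Sum>u\<in>S2 \<inter> spread Q R L1. f u)"
          by (intro sum.mono_neutral_cong_right) (auto simp: g_def)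
        also have "\<dots> \<le> (\<Sum>u\<in>S \<inter> spread Q R L1. f u)"
          using finS f S2 by (intro sum_mono2) auto
        also have "\<dots> < \<delta> * M2 / 4" using lt by (simp add: M2_def power2_eq_square algebra_simps)
        finally show "(\<Sum>x\<in>spread Q R L1. g x) < \<delta> * M2 / 4" .
      qed
      ultimately show ?thesis by linarith
    qed
    let ?c = "exp (- (\<delta> * M2 / (24 * real d)))"
    have "expect E ?p (\<lambda>R1. pr E ?p (\<lambda>R2. (\<Sum>u\<in>S \<inter> spread Q R2 (spread Q R1 L). f u) < \<delta>\<^sup>2 * r / 32 * B))
      \<le> expect E ?p (\<lambda>R1. of_bool ((\<Sum>x\<in>spread Q R1 L. w x) < \<delta> * (r * B / 2) / 4) + ?c)"
    proof (intro expect_mono p)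
      fix R1 assume R1: "R1 \<subseteq> E"
      have sub: "spread Q R1 L \<subseteq> V - Q" by (rule spread_subset[OF graph_on_subset[OF E R1] L])
      show "pr E ?p (\<lambda>R2. (\<Sum>u\<in>S \<inter> spread Q R2 (spread Q R1 L). f u) < \<delta>\<^sup>2 * r / 32 * B)
         \<le> of_bool ((\<Sum>x\<in>spread Q R1 L. w x) < \<delta> * (r * B / 2) / 4) + ?c"
      proof (cases "(\<Sum>x\<in>spread Q R1 L. w x) < \<delta> * (r * B / 2) / 4")
        case True
        have "pr E ?p (\<lambda>R2. (\<Sum>u\<in>S \<inter> spread Q R2 (spread Q R1 L). f u) < \<delta>\<^sup>2 * r / 32 * B) \<le> 1"
          using fin p by (intro pr_le_1) auto
        also have "\<dots> \<le> 1 + ?c" by simp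
        finally show ?thesis using True by simp
      next
        case False
        then have "M2 \<le> (\<Sum>x\<in>spread Q R1 L. w x)" by (simp add: M2_def algebra_simps)
        from b2[OF sub this] False show ?thesis by simp
      qed
    qed
    also have "\<dots> = pr E ?p (\<lambda>R1. (\<Sum>x\<in>spread Q R1 L. w x) < \<delta> * (r * B / 2) / 4) + ?c"
      using fin by (simp add: expect_add)
    also have "\<dots> \<le> exp (- (\<delta> * (r * B / 2) / (24 * real d))) + ?c" using b1 by simp
    also have "\<dots> \<le> exp (- (\<delta>\<^sup>2 * r / 192 * B / d)) + exp (- (\<delta>\<^sup>2 * r / 192 * B / d))"
    proof (intro add_mono)
      have "\<delta>\<^sup>2 * (r * B / (192 * real d)) \<le> 4 * \<delta> * (r * B / (192 * real d))"
      proof (intro mult_right_mono)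
        show "\<delta>\<^sup>2 \<le> 4 * \<delta>" using \<delta> mult_right_mono[of \<delta> 4 \<delta>] by (simp add: power2_eq_square)
      qed (use r B d0 in auto)
      then show "exp (- (\<delta> * (r * B / 2) / (24 * real d))) \<le> exp (- (\<delta>\<^sup>2 * r / 192 * B / d))"
        by (simp add: field_simps)
      show "?c \<le> exp (- (\<delta>\<^sup>2 * r / 192 * B / d))"
        by (simp add: M2_def power2_eq_square field_simps)
    qed
    finally show ?thesis by simp
  qed
qed

lemma reach_from:
  assumes "v \<in> reach F X"
  obtains z where "z \<in> X" "v \<in> reach F {z}"
  using assms unfolding reach_def by blast

text \<open>\<open>s * ln (n / s)\<close> is not monotone in \<open>s\<close>: it grows up to
  \<open>s = n / e\<close> and then falls to \<open>0\<close> at \<open>s = n\<close>. Before the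
  maximum it dominates its value at \<open>a\<close>; beyond it \<open>s\<close> exceeds
  \<open>n / 3\<close>, and \<open>s \<le> (1 - \<beta>) * n\<close> keeps the logarithm at least
  \<open>\<beta>\<close>.\<close>

lemma mult_ln_lower:
  fixes a s n \<beta> :: real
  assumes a: "0 < a" "a \<le> s" and s: "s \<le> (1 - \<beta>) * n" and n: "0 < n" and \<beta>: "0 \<le> \<beta>" "\<beta> \<le> 1"
  shows "\<beta> / 3 * (a * (1 + ln (n / a))) \<le> s * ln (n / s)"
proof (cases "1 \<le> ln (n / s)")
  case True
  have s0: "0 < s" using a by linarith
  have "ln (s / a) \<le> s / a - 1" using s0 a by (intro ln_le_minus_one) auto
  then have 1: "a * ln (s / a) \<le> s - a" using a by (simp add: field_simps)
  have split: "ln (n / a) = ln (n / s) + ln (s / a)"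
    using s0 a n by (simp add: ln_div)
  have "(s - a) * 1 \<le> (s - a) * ln (n / s)" using a True by (intro mult_left_mono) auto
  then have 2: "a * ln (n / a) \<le> s * ln (n / s)"
    using 1 by (simp add: split algebra_simps)
  have "0 \<le> ln (s / a)" using a s0 by simp
  then have L: "1 \<le> ln (n / a)" using True split by linarith
  have "a * (1 + ln (n / a)) \<le> a * (2 * ln (n / a))" using L a by (intro mult_left_mono) auto
  then have 3: "a * (1 + ln (n / a)) \<le> 2 * (a * ln (n / a))" by simp
  have "\<beta> / 3 * (a * (1 + ln (n / a))) \<le> 1 / 3 * (a * (1 + ln (n / a)))"
    using \<beta> a L by (intro mult_right_mono) auto
  also have "\<dots> \<le> a * ln (n / a)"
    using 3 mult_nonneg_nonneg[of a "ln (n / a)"] a L by linarith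
  finally show ?thesis using 2 by linarith
next
  case False
  have s0: "0 < s" using a by linarith
  have "n / s < exp 1"
    using False s0 n by (subst (asm) not_le) (metis divide_pos_pos exp_less_mono exp_ln)
  then have "n < s * exp 1" using s0 by (simp add: field_simps)
  moreover have "s * exp 1 \<le> s * 3" using exp_le s0 by (intro mult_left_mono) auto
  ultimately have "n < s * 3" by linarith
  have "ln (s / n) \<le> s / n - 1" using s0 n by (intro ln_le_minus_one) auto
  moreover have "s / n \<le> 1 - \<beta>" using s n by (simp add: field_simps)
  moreover have "ln (n / s) = - ln (s / n)" using s0 n by (simp add: ln_div)
  ultimately have "\<beta> \<le> ln (n / s)" by linarith
  have "1 + ln (n / a) \<le> n / a" using ln_le_minus_one[of "n / a"] n a by simp
  then have "a * (1 + ln (n / a)) \<le> n" using a by (simp add: field_simps)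
  then have "\<beta> / 3 * (a * (1 + ln (n / a))) \<le> \<beta> / 3 * n" using \<beta> by (intro mult_left_mono) auto
  also have "\<dots> \<le> \<beta> * s" using \<open>n < s * 3\<close> \<beta> mult_left_mono[of n "s * 3" \<beta>] by simp
  also have "\<dots> \<le> s * ln (n / s)" using \<open>\<beta> \<le> ln (n / s)\<close> s0 by (simp add: mult.commute)
  finally show ?thesis .
qed

lemma expect_five_rounds:
  assumes "finite E"
  shows "expect E (1 - (1 - a) ^ 5) f = expect E a (\<lambda>R1. expect E a (\<lambda>R2. expect E a (\<lambda>R3.
    expect E a (\<lambda>R4. expect E a (\<lambda>R5. f (R1 \<union> (R2 \<union> (R3 \<union> (R4 \<union> R5)))))))))"
proof -
  have eq: "1 - (1 - a) ^ 5 = 1 - (1 - a) * (1 - (1 - (1 - a) * (1 - (1 - (1 - a) * (1 - (1 - (1 - a) * (1 - a)))))))"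
    by (simp add: power_def numeral_eq_Suc)
  show ?thesis unfolding eq by (simp only: expect_two_rounds[OF assms])
qed

text \<open>The sprinkling step. Every vertex is assigned to the side \<open>A\<close> or \<open>W - A\<close> that it reaches by more
  walks of length two; the edge-isoperimetric inequality supplies many edges between the two sides,
  and each of them extends with probability of order \<open>1 / d\<close> to an open crossing path of length five.\<close>

lemma pr_no_crossing:
  fixes \<delta> \<rho> \<beta> Ci \<theta> :: real
  defines "\<kappa> \<equiv> \<delta> * (\<delta>\<^sup>2 * \<rho> / 128)\<^sup>2 / 6"
  assumes E: "graph_on V E" and deg: "\<And>v. v \<in> V \<Longrightarrow> card (nb E v) \<le> d" and d: "1 \<le> d"
    and W: "W \<subseteq> V" and \<rho>: "0 < \<rho>" "\<rho> \<le> 1"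
    and walks: "\<And>v. v \<in> V \<Longrightarrow> \<rho> * d\<^sup>2 \<le> (\<Sum>x\<in>nb E v. card (nb E x \<inter> W))"
    and Ci: "0 < Ci"
    and iso: "\<And>U. U \<subseteq> V \<Longrightarrow> U \<noteq> {} \<Longrightarrow> card U * ln (card V / card U) / Ci \<le> card (bd E U)"
    and A: "A \<subseteq> W" "A \<noteq> {}" and \<beta>: "0 < \<beta>" "\<beta> \<le> 1" "\<beta> * card V \<le> card (W - A)"
    and Q: "Q \<subseteq> V" "card Q \<le> \<theta> * card A / d" and \<theta>: "\<theta> \<le> \<beta> * \<rho> / (54 * Ci)"
    and \<delta>: "0 < \<delta>" "\<delta> \<le> 1"
  shows "pr E (1 - (1 - \<delta> / d) ^ 5) (\<lambda>R. reach {e \<in> R. e \<inter> Q = {}} (A - Q) \<inter> (W - A - Q) = {})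
    \<le> 5 * exp (- (\<kappa> * (\<beta> / (6 * Ci) * (card A * (1 + ln (card V / card A)))) / d))"
proof -
  note fin = graph_on_finite[OF E]
  let ?n = "real (card V)" and ?a = "real (card A)"
  define B where "B = W - A"
  have d0: "0 < real d" using d by simp
  have finA: "finite A" "finite B" "finite Q" "finite W"
  proof -
    show "finite W" "finite Q" using finite_subset W Q fin by blast+
    then show "finite A" "finite B" using finite_subset[OF A(1)] by (auto simp: B_def)
  qed
  have a0: "0 < ?a" using A finA by (simp add: card_gt_0_iff)
  have an: "?a \<le> ?n" using A W fin by (simp add: card_mono)
  define p where "p = \<delta> / d"
  have p: "0 \<le> p" "p \<le> 1" using \<delta> d d0 by (auto simp: p_def field_simps)
  define \<tau> where "\<tau> = (\<lambda>X u. \<Sum>x\<in>nb E u. real (card (nb E x \<inter> X)))"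
  define \<tau>Q where "\<tau>Q = (\<lambda>X u. \<Sum>x\<in>nb E u - Q. real (card (nb E x \<inter> (X - Q))))"
  \<comment> \<open>An upper bound for the walks of length two from \<open>u\<close> that are
    destroyed by removing \<open>Q\<close>: at most \<open>d\<close> for each middle vertex in
    \<open>Q\<close>, plus those that end in \<open>Q\<close>.\<close>
  define lo where "lo = (\<lambda>u. real d * card (nb E u \<inter> Q) + (\<Sum>x\<in>nb E u. real (card (nb E x \<inter> Q))))"
  have fnb: "finite (nb E x)" for x using finite_nb[OF E] .
  have nbV: "nb E u \<subseteq> V" for u using nb_subset[OF E, of u] by blast
  have cnb: "card (nb E x \<inter> X) \<le> d" if "x \<in> V" for x X
    using deg[OF that] card_mono[OF fnb, of "nb E x \<inter> X" x] by auto
  have loss: "\<tau> X u \<le> \<tau>Q X u + lo u" if "u \<in> V" for X u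
  proof -
    have "\<tau> X u = (\<Sum>x\<in>nb E u \<inter> Q. real (card (nb E x \<inter> X))) + (\<Sum>x\<in>nb E u - Q. real (card (nb E x \<inter> X)))"
      unfolding \<tau>_def using fnb by (rule sum.Int_Diff)
    also have "(\<Sum>x\<in>nb E u \<inter> Q. real (card (nb E x \<inter> X))) \<le> (\<Sum>x\<in>nb E u \<inter> Q. real d)"
      using cnb nbV by (intro sum_mono) auto
    also have "(\<Sum>x\<in>nb E u - Q. real (card (nb E x \<inter> X))) \<le>
        (\<Sum>x\<in>nb E u - Q. real (card (nb E x \<inter> (X - Q))) + real (card (nb E x \<inter> Q)))"
    proof (intro sum_mono)
      fix x
      have "card (nb E x \<inter> X) \<le> card ((nb E x \<inter> (X - Q)) \<union> (nb E x \<inter> Q))"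
        using fnb by (intro card_mono) auto
      also have "\<dots> \<le> card (nb E x \<inter> (X - Q)) + card (nb E x \<inter> Q)" by (rule card_Un_le)
      finally show "real (card (nb E x \<inter> X)) \<le> real (card (nb E x \<inter> (X - Q))) + real (card (nb E x \<inter> Q))"
        by simp
    qed
    also have "\<dots> = \<tau>Q X u + (\<Sum>x\<in>nb E u - Q. real (card (nb E x \<inter> Q)))"
      by (simp add: sum.distrib \<tau>Q_def)
    also have "(\<Sum>x\<in>nb E u - Q. real (card (nb E x \<inter> Q))) \<le> (\<Sum>x\<in>nb E u. real (card (nb E x \<inter> Q)))"
      using fnb by (intro sum_mono2) auto
    finally show ?thesis by (simp add: lo_def mult.commute)
  qed
  \<comment> \<open>Vertices that may lose more than a quarter of the
    \<open>\<rho> * d\<^sup>2\<close> walks. Double counting bounds their number by a multiple of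
    \<open>card Q\<close>, so discarding them costs few boundary edges.\<close>
  define Bad where "Bad = {u \<in> V. \<rho> * d\<^sup>2 / 4 < lo u}"
  have QV: "(\<Sum>u\<in>V. real (card (nb E u \<inter> Q))) \<le> real d * real (card Q)"
  proof -
    have "(\<Sum>u\<in>V. real (card (nb E u \<inter> Q))) = (\<Sum>u\<in>V. 1 * (\<Sum>v\<in>nb E u \<inter> Q. 1 :: real))" by simp
    also have "\<dots> = (\<Sum>v\<in>Q. 1 * (\<Sum>u\<in>nb E v \<inter> V. 1 :: real))" using fin finA by (intro sum_nb_swap) auto
    also have "\<dots> \<le> (\<Sum>v\<in>Q. real d)" using cnb Q by (intro sum_mono) auto
    finally show ?thesis by (simp add: mult.commute)
  qed
  have "(\<Sum>u\<in>V. lo u) \<le> 2 * (real d)\<^sup>2 * real (card Q)"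
  proof -
    have "(\<Sum>u\<in>V. \<Sum>x\<in>nb E u. real (card (nb E x \<inter> Q))) = (\<Sum>u\<in>V. 1 * (\<Sum>x\<in>nb E u \<inter> V. real (card (nb E x \<inter> Q))))"
      using nbV by (intro sum.cong) (auto simp: Int_absorb2)
    also have "\<dots> = (\<Sum>x\<in>V. real (card (nb E x \<inter> Q)) * (\<Sum>u\<in>nb E x \<inter> V. 1))"
      using fin by (intro sum_nb_swap) auto
    also have "\<dots> \<le> (\<Sum>x\<in>V. real (card (nb E x \<inter> Q)) * d)"
      using cnb by (intro sum_mono mult_left_mono) auto
    also have "\<dots> \<le> (real d * real (card Q)) * d" unfolding sum_distrib_right[symmetric] using QV by (intro mult_right_mono) auto
    finally have 1: "(\<Sum>u\<in>V. \<Sum>x\<in>nb E u. real (card (nb E x \<inter> Q))) \<le> real d * real (card Q) * d" by simp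
    have "(\<Sum>u\<in>V. real d * card (nb E u \<inter> Q)) \<le> real d * (real d * real (card Q))"
      unfolding sum_distrib_left[symmetric] using QV by (intro mult_left_mono) auto
    with 1 show ?thesis unfolding lo_def sum.distrib by (simp add: power2_eq_square algebra_simps)
  qed
  moreover have "real (card Bad) * (\<rho> * d\<^sup>2 / 4) \<le> (\<Sum>u\<in>V. lo u)"
  proof -
    have "real (card Bad) * (\<rho> * d\<^sup>2 / 4) = (\<Sum>u\<in>Bad. \<rho> * d\<^sup>2 / 4)" by simp
    also have "\<dots> \<le> (\<Sum>u\<in>Bad. lo u)" by (intro sum_mono) (auto simp: Bad_def)
    also have "\<dots> \<le> (\<Sum>u\<in>V. lo u)"
      using fin by (intro sum_mono2) (auto simp: Bad_def lo_def intro!: add_nonneg_nonneg sum_nonneg)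
    finally show ?thesis .
  qed
  ultimately have "real (card Bad) * (\<rho> * d\<^sup>2 / 4) \<le> 2 * (real d)\<^sup>2 * real (card Q)" by linarith
  then have bad: "real (card Bad) \<le> 8 * card Q / \<rho>" using d0 \<rho> by (simp add: field_simps power2_eq_square)
  \<comment> \<open>Vertices of \<open>A\<close> and of \<open>W - A\<close> stay on their own side.
    Any other vertex has at least \<open>\<rho> * d\<^sup>2 / 2\<close> walks into one of the two
    sets; outside \<open>Bad\<close> at least half of these avoid \<open>Q\<close>, which is the
    \<open>\<rho> / 4\<close> below.\<close>
  define Ap where "Ap = {u \<in> V. u \<in> A \<or> (u \<notin> B \<and> \<rho> * d\<^sup>2 / 2 \<le> \<tau> A u)}"
  define As where "As = Ap - (Bad \<union> Q)"
  define Bs where "Bs = V - Ap - (Bad \<union> Q)"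
  have AsBs: "As \<subseteq> V - Q" "Bs \<subseteq> V - Q" "As \<inter> Bs = {}" by (auto simp: As_def Bs_def Ap_def)
  have finAs: "finite As" "finite Bs" using AsBs fin finite_subset by blast+
  have walkA: "\<rho> / 4 * d\<^sup>2 \<le> \<tau>Q A u" if "u \<in> As" "u \<notin> A - Q" for u
  proof -
    have "u \<in> V" "\<rho> * d\<^sup>2 / 2 \<le> \<tau> A u" "lo u \<le> \<rho> * d\<^sup>2 / 4"
      using that by (auto simp: As_def Ap_def Bad_def)
    with loss[of u A] show ?thesis by simp
  qed
  have walkB: "\<rho> / 4 * d\<^sup>2 \<le> \<tau>Q B u" if "u \<in> Bs" "u \<notin> B - Q" for u
  proof -
    have u: "u \<in> V" "u \<notin> A" "\<tau> A u < \<rho> * d\<^sup>2 / 2" "lo u \<le> \<rho> * d\<^sup>2 / 4"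
      using that by (auto simp: Bs_def Ap_def Bad_def)
    have "\<tau> W u = \<tau> A u + \<tau> B u"
    proof -
      have "card (nb E x \<inter> W) = card (nb E x \<inter> A) + card (nb E x \<inter> B)" for x
      proof -
        have "nb E x \<inter> W = (nb E x \<inter> A) \<union> (nb E x \<inter> B)" using A by (auto simp: B_def)
        then show ?thesis using fnb[of x] by (simp add: card_Un_disjoint B_def disjoint_iff)
      qed
      then show ?thesis by (simp add: \<tau>_def sum.distrib)
    qed
    moreover have "\<rho> * d\<^sup>2 \<le> \<tau> W u" using walks[OF u(1)] by (simp add: \<tau>_def)
    ultimately show ?thesis using u loss[of u B] by simp
  qed
  define L where "L = ?a * (1 + ln (?n / ?a))"
  \<comment> \<open>\<open>Ap\<close> has at least \<open>2 * B0\<close> boundary edges by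
    isoperimetry, and the bound on \<open>\<theta>\<close> ensures that at most \<open>B0\<close> of
    them touch \<open>Bad \<union> Q\<close>.\<close>
  define B0 where "B0 = \<beta> / (6 * Ci) * L"
  have ln0: "0 \<le> ln (?n / ?a)" using an a0 by (simp add: field_simps)
  have aL: "?a \<le> L" using ln0 a0 by (simp add: L_def)
  have B0: "0 \<le> B0" using aL a0 \<beta> Ci by (simp add: B0_def)
  have edges: "B0 \<le> (\<Sum>u\<in>As. real (card (nb E u \<inter> Bs)))"
  proof -
    have Ap: "Ap \<subseteq> V" "Ap \<noteq> {}" using A W by (auto simp: Ap_def)
    have "card A \<le> card Ap" using A W fin Ap by (intro card_mono finite_subset[OF Ap(1)]) (auto simp: Ap_def)
    moreover have "card Ap \<le> (1 - \<beta>) * ?n"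
    proof -
      have "card Ap + card B = card (Ap \<union> B)"
        using finite_subset[OF Ap(1)] fin finA by (intro card_Un_disjoint[symmetric]) (auto simp: Ap_def B_def)
      also have "\<dots> \<le> card V" using fin Ap W by (intro card_mono) (auto simp: B_def)
      finally show ?thesis using \<beta>(3) by (simp add: B_def[symmetric] algebra_simps)
    qed
    ultimately have "\<beta> / 3 * L \<le> card Ap * ln (?n / card Ap)"
      unfolding L_def using a0 an \<beta> by (intro mult_ln_lower) auto
    then have "\<beta> / 3 * L / Ci \<le> card Ap * ln (?n / card Ap) / Ci"
      using Ci by (intro divide_right_mono) auto
    also have "\<dots> \<le> card (bd E Ap)" by (rule iso[OF Ap])
    finally have 1: "2 * B0 \<le> card (bd E Ap)" by (simp add: B0_def mult.commute)
    have star: "card {e \<in> E. q \<in> e} \<le> d" if "q \<in> V" for q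
      using card_star[OF E] deg[OF that] by simp
    have finBQ: "finite (Bad \<union> Q)" "Bad \<union> Q \<subseteq> V" using fin Q finA by (auto simp: Bad_def)
    have "bd E Ap \<subseteq> {e \<in> E. \<exists>x y. e = {x, y} \<and> x \<in> As \<and> y \<in> Bs} \<union> (\<Union>q\<in>Bad \<union> Q. {e \<in> E. q \<in> e})"
    proof
      fix e assume "e \<in> bd E Ap"
      then obtain x y where e: "e \<in> E" "e = {x, y}" "x \<in> Ap" "y \<notin> Ap"
        using bd_iff[OF E] by blast
      moreover have "y \<in> V" using e E by (auto simp: graph_on_def)
      ultimately show "e \<in> {e \<in> E. \<exists>x y. e = {x, y} \<and> x \<in> As \<and> y \<in> Bs} \<union> (\<Union>q\<in>Bad \<union> Q. {e \<in> E. q \<in> e})"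
        by (cases "x \<in> Bad \<union> Q \<or> y \<in> Bad \<union> Q") (auto simp: As_def Bs_def)
    qed
    then have "card (bd E Ap) \<le> card ({e \<in> E. \<exists>x y. e = {x, y} \<and> x \<in> As \<and> y \<in> Bs} \<union> (\<Union>q\<in>Bad \<union> Q. {e \<in> E. q \<in> e}))"
      using fin finBQ by (intro card_mono) auto
    also have "\<dots> \<le> card {e \<in> E. \<exists>x y. e = {x, y} \<and> x \<in> As \<and> y \<in> Bs} + card (\<Union>q\<in>Bad \<union> Q. {e \<in> E. q \<in> e})"
      by (rule card_Un_le)
    also have "card {e \<in> E. \<exists>x y. e = {x, y} \<and> x \<in> As \<and> y \<in> Bs} = (\<Sum>u\<in>As. card (nb E u \<inter> Bs))"
      by (rule card_edges_between[OF E finAs(1) AsBs(3)])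
    also have "card (\<Union>q\<in>Bad \<union> Q. {e \<in> E. q \<in> e}) \<le> (\<Sum>q\<in>Bad \<union> Q. card {e \<in> E. q \<in> e})"
      using finBQ by (intro card_UN_le) auto
    also have "\<dots> \<le> (\<Sum>q\<in>Bad \<union> Q. d)" using star finBQ by (intro sum_mono) auto
    also have "\<dots> = d * card (Bad \<union> Q)" by simp
    also have "\<dots> \<le> d * (card Bad + card Q)" using card_Un_le by (intro mult_left_mono) auto
    finally have 2: "real (card (bd E Ap)) \<le> (\<Sum>u\<in>As. real (card (nb E u \<inter> Bs))) + real d * (real (card Bad) + card Q)"
      by (simp flip: of_nat_sum of_nat_add of_nat_mult)
    have "real (card Bad) + card Q \<le> 9 * real (card Q) / \<rho>"
    proof -
      have "real (card Q) * \<rho> \<le> real (card Q) * 1" using \<rho> by (intro mult_left_mono) auto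
      then have "real (card Q) \<le> card Q / \<rho>" using \<rho> by (simp add: field_simps)
      then show ?thesis using bad by (simp add: add_divide_distrib[symmetric])
    qed
    then have "real d * (real (card Bad) + card Q) \<le> real d * (9 * real (card Q) / \<rho>)" by (intro mult_left_mono) auto
    also have "\<dots> = 9 / \<rho> * (real d * real (card Q))" by simp
    also have "\<dots> \<le> 9 / \<rho> * (\<theta> * ?a)"
      using Q(2) d0 \<rho> by (intro mult_left_mono) (auto simp: field_simps)
    also have "\<dots> \<le> 9 / \<rho> * (\<beta> * \<rho> / (54 * Ci) * L)"
      using \<theta> aL a0 \<rho> \<beta> Ci by (intro mult_left_mono mult_mono) auto
    also have "\<dots> = B0" using \<rho> by (simp add: B0_def)
    finally show ?thesis using 1 2 by linarith
  qed
  \<comment> \<open>The fraction \<open>\<delta>\<^sup>2 * r / 32\<close> kept by two spreads at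
    \<open>r = \<rho> / 4\<close>. It is paid once on each side: rounds one and two grow
    \<open>A\<close>, rounds three and four grow \<open>W - A\<close>, and the fifth must open one
    of the \<open>\<kappa>1 * (\<kappa>1 * B0)\<close> or more remaining edges.\<close>
  define \<kappa>1 where "\<kappa>1 = \<delta>\<^sup>2 * \<rho> / 128"
  have \<kappa>1: "0 < \<kappa>1" "\<kappa>1 \<le> 1"
  proof -
    have "\<delta>\<^sup>2 * \<rho> \<le> 1" using \<delta> \<rho> by (intro mult_le_one power_le_one) auto
    then show "\<kappa>1 \<le> 1" by (simp add: \<kappa>1_def)
  qed (use \<delta> \<rho> in \<open>simp add: \<kappa>1_def\<close>)
  define L2 where "L2 = (\<lambda>R1 R2. spread Q R2 (spread Q R1 (A - Q)))"
  define M2 where "M2 = (\<lambda>R3 R4. spread Q R4 (spread Q R3 (B - Q)))"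
  define f where "f = (\<lambda>u. real (card (nb E u \<inter> Bs)))"
  define g where "g = (\<lambda>L v. real (card (nb E v \<inter> (As \<inter> L))))"
  define c1 where "c1 = 2 * exp (- (\<kappa>1 / 6 * B0 / d))"
  define c2 where "c2 = 2 * exp (- (\<kappa>1 / 6 * (\<kappa>1 * B0) / d))"
  define c3 where "c3 = exp (- (\<delta> * (\<kappa>1 * (\<kappa>1 * B0)) / d))"
  define ev where "ev = (\<lambda>R. reach {e \<in> R. e \<inter> Q = {}} (A - Q) \<inter> (W - A - Q) = {})"
  have sA: "expect E p (\<lambda>R1. pr E p (\<lambda>R2. (\<Sum>u\<in>As \<inter> L2 R1 R2. f u) < \<kappa>1 * B0)) \<le> c1"
  proof -
    have "expect E p (\<lambda>R1. pr E p (\<lambda>R2. (\<Sum>u\<in>As \<inter> L2 R1 R2. f u) < \<delta>\<^sup>2 * (\<rho> / 4) / 32 * B0))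
      \<le> 2 * exp (- (\<delta>\<^sup>2 * (\<rho> / 4) / 192 * B0 / d))"
      unfolding p_def L2_def
    proof (rule pr_two_spreads[OF E deg d _ \<delta> _ _ AsBs(1)])
      show "A - Q \<subseteq> V - Q" using A W by auto
      show "f u \<le> d" if "u \<in> As" for u using that cnb AsBs by (auto simp: f_def)
      show "\<rho> / 4 * d\<^sup>2 \<le> (\<Sum>x\<in>nb E u - Q. card (nb E x \<inter> (A - Q)))" if "u \<in> As" "u \<notin> A - Q" for u
        using walkA[OF that] by (simp add: \<tau>Q_def)
      show "B0 \<le> (\<Sum>u\<in>As. f u)" using edges by (simp add: f_def)
    qed (use \<rho> B0 in \<open>auto simp: f_def\<close>)
    then show ?thesis by (simp add: \<kappa>1_def c1_def)
  qed
  have sB: "expect E p (\<lambda>R3. pr E p (\<lambda>R4. (\<Sum>v\<in>Bs \<inter> M2 R3 R4. g La v) < \<kappa>1 * (\<kappa>1 * B0))) \<le> c2"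
    if La: "\<kappa>1 * B0 \<le> (\<Sum>u\<in>As \<inter> La. f u)" for La
  proof -
    have "expect E p (\<lambda>R3. pr E p (\<lambda>R4. (\<Sum>v\<in>Bs \<inter> M2 R3 R4. g La v) < \<delta>\<^sup>2 * (\<rho> / 4) / 32 * (\<kappa>1 * B0)))
      \<le> 2 * exp (- (\<delta>\<^sup>2 * (\<rho> / 4) / 192 * (\<kappa>1 * B0) / d))"
      unfolding p_def M2_def
    proof (rule pr_two_spreads[OF E deg d _ \<delta> _ _ AsBs(2)])
      show "B - Q \<subseteq> V - Q" using W by (auto simp: B_def)
      show "g La u \<le> d" if "u \<in> Bs" for u using that cnb AsBs by (auto simp: g_def)
      show "\<rho> / 4 * d\<^sup>2 \<le> (\<Sum>x\<in>nb E u - Q. card (nb E x \<inter> (B - Q)))" if "u \<in> Bs" "u \<notin> B - Q" for u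
        using walkB[OF that] by (simp add: \<tau>Q_def)
      have "(\<Sum>u\<in>As \<inter> La. f u) = (\<Sum>u\<in>As \<inter> La. 1 * (\<Sum>v\<in>nb E u \<inter> Bs. 1))" by (simp add: f_def)
      also have "\<dots> = (\<Sum>v\<in>Bs. 1 * (\<Sum>u\<in>nb E v \<inter> (As \<inter> La). 1))"
        using finAs by (intro sum_nb_swap) auto
      also have "\<dots> = (\<Sum>v\<in>Bs. g La v)" by (simp add: g_def)
      finally show "\<kappa>1 * B0 \<le> (\<Sum>v\<in>Bs. g La v)" using La by simp
    qed (use \<rho> B0 \<kappa>1 in \<open>auto simp: g_def\<close>)
    then show ?thesis by (simp add: \<kappa>1_def c2_def)
  qed
  have sC: "pr E p (\<lambda>R5. ev (R1 \<union> (R2 \<union> (R3 \<union> (R4 \<union> R5))))) \<le> c3"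
    if many: "\<kappa>1 * (\<kappa>1 * B0) \<le> (\<Sum>v\<in>Bs \<inter> M2 R3 R4. g (L2 R1 R2) v)" for R1 R2 R3 R4
  proof -
    let ?S = "As \<inter> L2 R1 R2" and ?T = "Bs \<inter> M2 R3 R4"
    define Z where "Z = {e \<in> E. \<exists>x y. e = {x, y} \<and> x \<in> ?T \<and> y \<in> ?S}"
    have "card Z = (\<Sum>v\<in>?T. card (nb E v \<inter> ?S))"
      unfolding Z_def using finAs AsBs by (intro card_edges_between[OF E]) auto
    then have cZ: "\<kappa>1 * (\<kappa>1 * B0) \<le> card Z" using many by (simp add: g_def)
    have "pr E p (\<lambda>R5. ev (R1 \<union> (R2 \<union> (R3 \<union> (R4 \<union> R5))))) \<le> pr E p (\<lambda>R5. R5 \<inter> Z = {})"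
    proof (intro pr_mono p, rule ccontr)
      fix R5
      let ?R = "R1 \<union> (R2 \<union> (R3 \<union> (R4 \<union> R5)))"
      let ?F = "{e \<in> ?R. e \<inter> Q = {}}"
      assume ev: "ev ?R" and "R5 \<inter> Z \<noteq> {}"
      then obtain e where e: "e \<in> R5" "e \<in> Z" by blast
      from e(2) obtain v u where "e = {v, u}" "v \<in> ?T" "u \<in> ?S" unfolding Z_def by blast
      then have uv: "{v, u} \<in> R5" "u \<in> As" "u \<in> L2 R1 R2" "v \<in> Bs" "v \<in> M2 R3 R4"
        using e(1) by auto
      have spQ: "spread Q R X \<inter> Q = {}" if "X \<inter> Q = {}" for R X using that by (auto simp: spread_def)
      have spR: "spread Q R' (spread Q R (X - Q)) \<subseteq> reach ?F (X - Q)" if "R \<subseteq> ?R" "R' \<subseteq> ?R" for R R' X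
        by (intro spread_reach that spQ reach_refl) auto
      have "L2 R1 R2 \<subseteq> reach ?F (A - Q)" unfolding L2_def by (rule spR) auto
      then have u: "u \<in> reach ?F (A - Q)" using uv by auto
      have "M2 R3 R4 \<subseteq> reach ?F (B - Q)" unfolding M2_def by (rule spR) auto
      then have "v \<in> reach ?F (B - Q)" using uv by auto
      then obtain z where z: "z \<in> B - Q" "v \<in> reach ?F {z}" by (rule reach_from)
      from comp_sym[OF z(2)] have zv: "z \<in> reach ?F {v}" .
      have "u \<notin> Q" "v \<notin> Q" using uv AsBs by auto
      moreover have "{u, v} \<in> ?R" using uv(1) by (simp add: insert_commute)
      ultimately have "{u, v} \<in> ?F" by simp
      then have "v \<in> reach ?F (A - Q)" using u by (rule reach_step[rotated])
      then have "z \<in> reach ?F (A - Q)" using zv reach_trans[of "{v}" ?F "A - Q"] by auto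
      then show False using ev z by (auto simp: ev_def B_def)
    qed
    also have "\<dots> = (1 - p) ^ card (E \<inter> Z)" using fin by (intro pr_avoid) auto
    also have "E \<inter> Z = Z" by (auto simp: Z_def)
    also have "(1 - p) ^ card Z \<le> exp (- p) ^ card Z"
      using p exp_ge_add_one_self[of "- p"] by (intro power_mono) auto
    also have "\<dots> = exp (- (p * card Z))" by (simp add: exp_of_nat_mult[symmetric] mult.commute)
    also have "\<dots> \<le> exp (- (p * (\<kappa>1 * (\<kappa>1 * B0))))" using cZ p by (simp add: mult_left_mono)
    finally show ?thesis by (simp add: c3_def p_def)
  qed
  have pos: "0 \<le> c2" "0 \<le> c3" by (auto simp: c2_def c3_def)
  have le1: "pr E p P \<le> 1" for P using fin p by (intro pr_le_1) auto
  have ex1: "expect E p h \<le> 1" if "\<And>R. R \<subseteq> E \<Longrightarrow> h R \<le> 1" for h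
    using fin p that by (intro expect_le_const) auto
  have s34: "expect E p (\<lambda>R3. expect E p (\<lambda>R4. pr E p (\<lambda>R5. ev (R1 \<union> (R2 \<union> (R3 \<union> (R4 \<union> R5))))))) \<le> c2 + c3"
    if many: "\<kappa>1 * B0 \<le> (\<Sum>u\<in>As \<inter> L2 R1 R2. f u)" for R1 R2
  proof -
    have "expect E p (\<lambda>R3. expect E p (\<lambda>R4. pr E p (\<lambda>R5. ev (R1 \<union> (R2 \<union> (R3 \<union> (R4 \<union> R5))))))) \<le>
      expect E p (\<lambda>R3. expect E p (\<lambda>R4. of_bool ((\<Sum>v\<in>Bs \<inter> M2 R3 R4. g (L2 R1 R2) v) < \<kappa>1 * (\<kappa>1 * B0)) + c3))"
    proof (intro expect_mono p)
      fix R3 R4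
      show "pr E p (\<lambda>R5. ev (R1 \<union> (R2 \<union> (R3 \<union> (R4 \<union> R5))))) \<le>
         of_bool ((\<Sum>v\<in>Bs \<inter> M2 R3 R4. g (L2 R1 R2) v) < \<kappa>1 * (\<kappa>1 * B0)) + c3"
        using sC[of R1 R2 R3 R4] le1[of "\<lambda>R5. ev (R1 \<union> (R2 \<union> (R3 \<union> (R4 \<union> R5))))"] pos
        by (cases "(\<Sum>v\<in>Bs \<inter> M2 R3 R4. g (L2 R1 R2) v) < \<kappa>1 * (\<kappa>1 * B0)") auto
    qed
    also have "\<dots> = expect E p (\<lambda>R3. pr E p (\<lambda>R4. (\<Sum>v\<in>Bs \<inter> M2 R3 R4. g (L2 R1 R2) v) < \<kappa>1 * (\<kappa>1 * B0))) + c3"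
      using fin by (simp add: expect_add)
    also have "\<dots> \<le> c2 + c3" using sB[OF many] by simp
    finally show ?thesis .
  qed
  have "pr E (1 - (1 - p) ^ 5) ev = expect E p (\<lambda>R1. expect E p (\<lambda>R2.
     expect E p (\<lambda>R3. expect E p (\<lambda>R4. pr E p (\<lambda>R5. ev (R1 \<union> (R2 \<union> (R3 \<union> (R4 \<union> R5)))))))))"
    using fin by (intro expect_five_rounds) auto
  also have "\<dots> \<le> expect E p (\<lambda>R1. expect E p (\<lambda>R2. of_bool ((\<Sum>u\<in>As \<inter> L2 R1 R2. f u) < \<kappa>1 * B0) + (c2 + c3)))"
  proof (intro expect_mono p)
    fix R1 R2
    have "expect E p (\<lambda>R3. expect E p (\<lambda>R4. pr E p (\<lambda>R5. ev (R1 \<union> (R2 \<union> (R3 \<union> (R4 \<union> R5))))))) \<le> 1"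
      by (intro ex1 le1)
    then show "expect E p (\<lambda>R3. expect E p (\<lambda>R4. pr E p (\<lambda>R5. ev (R1 \<union> (R2 \<union> (R3 \<union> (R4 \<union> R5))))))) \<le>
       of_bool ((\<Sum>u\<in>As \<inter> L2 R1 R2. f u) < \<kappa>1 * B0) + (c2 + c3)"
      using s34[of R1 R2] pos
      by (cases "(\<Sum>u\<in>As \<inter> L2 R1 R2. f u) < \<kappa>1 * B0") auto
  qed
  also have "\<dots> = expect E p (\<lambda>R1. pr E p (\<lambda>R2. (\<Sum>u\<in>As \<inter> L2 R1 R2. f u) < \<kappa>1 * B0)) + (c2 + c3)"
    using fin by (simp add: expect_add)
  also have "\<dots> \<le> c1 + (c2 + c3)" using sA by simp
  also have "\<dots> \<le> 5 * exp (- (\<kappa> * B0 / d))"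
  proof -
    have \<kappa>: "\<kappa> = \<delta> * \<kappa>1\<^sup>2 / 6" by (simp add: \<kappa>_def \<kappa>1_def)
    have mono: "exp (- (x * B0 / d)) \<le> exp (- (\<kappa> * B0 / d))" if "\<kappa> \<le> x" for x
      using mult_right_mono[OF that B0] d0 by (simp add: divide_right_mono)
    have k2: "\<delta> * \<kappa>1\<^sup>2 \<le> \<kappa>1\<^sup>2" using \<delta> mult_right_mono[of \<delta> 1 "\<kappa>1\<^sup>2"] by simp
    have k3: "\<kappa>1\<^sup>2 \<le> \<kappa>1" using \<kappa>1 mult_left_mono[of \<kappa>1 1 \<kappa>1] by (simp add: power2_eq_square)
    have "c1 \<le> 2 * exp (- (\<kappa> * B0 / d))"
      unfolding c1_def using k2 k3 by (intro mult_left_mono mono) (auto simp: \<kappa>)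
    moreover have "c2 \<le> 2 * exp (- (\<kappa> * B0 / d))"
      using k2 mono[of "\<kappa>1\<^sup>2 / 6"] by (simp add: c2_def \<kappa> power2_eq_square)
    moreover have "c3 \<le> exp (- (\<kappa> * B0 / d))"
      using mono[of "\<delta> * \<kappa>1\<^sup>2"] \<delta> by (simp add: c3_def \<kappa> power2_eq_square mult.assoc)
    ultimately show ?thesis by linarith
  qed
  finally show ?thesis by (simp add: ev_def p_def B0_def L_def)
qed

lemma finite_max_witness:
  fixes f :: "'b \<Rightarrow> real"
  assumes "finite A" "A \<noteq> {}"
  obtains a where "a \<in> A" "\<And>b. b \<in> A \<Longrightarrow> f b \<le> f a"
proof -
  have "Max (f ` A) \<in> f ` A" using assms by (intro Max_in) auto
  then obtain a where a: "a \<in> A" "f a = Max (f ` A)" by auto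
  have "f b \<le> f a" if "b \<in> A" for b unfolding a(2) using assms that by (intro Max_ge) auto
  with a(1) show ?thesis by (rule that)
qed

section \<open>Isoperimetry in Cartesian products\<close>

definition base_ok :: "nat \<Rightarrow> 'a ugraph \<Rightarrow> bool" where
  "base_ok C G \<longleftrightarrow> graph_on (verts G) (edges G) \<and> connected_graph G \<and> 1 < card (verts G) \<and> card (verts G) \<le> C"

text \<open>The size of the edge boundary of \<open>U\<close> in the product over \<open>J\<close>,
  written with coordinate changes so that the induction over \<open>J\<close> handles no edge sets.
  In the same way \<open>in_moves\<close> is twice the number of edges inside
  \<open>U\<close>.\<close>

definition out_moves :: "(nat \<Rightarrow> 'a ugraph) \<Rightarrow> nat set \<Rightarrow> (nat \<Rightarrow> 'a) set \<Rightarrow> real" where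
  "out_moves B J U = (\<Sum>u\<in>U. \<Sum>j\<in>J. real (card {a \<in> nb (edges (B j)) (u j). u(j := a) \<notin> U}))"

definition in_moves :: "(nat \<Rightarrow> 'a ugraph) \<Rightarrow> nat set \<Rightarrow> (nat \<Rightarrow> 'a) set \<Rightarrow> real" where
  "in_moves B J U = (\<Sum>u\<in>U. \<Sum>j\<in>J. real (card {a \<in> nb (edges (B j)) (u j). u(j := a) \<in> U}))"

definition slice :: "(nat \<Rightarrow> 'a ugraph) \<Rightarrow> nat set \<Rightarrow> nat \<Rightarrow> (nat \<Rightarrow> 'a) set \<Rightarrow> 'a \<Rightarrow> (nat \<Rightarrow> 'a) set" where
  "slice B J j U a = {f \<in> PiE J (\<lambda>i. verts (B i)). f(j := a) \<in> U}"

context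
  fixes B :: "nat \<Rightarrow> 'a ugraph" and J :: "nat set" and j :: nat and U :: "(nat \<Rightarrow> 'a) set" and C :: nat
  assumes J: "finite J" "j \<notin> J" and ok: "\<And>i. i \<in> insert j J \<Longrightarrow> base_ok C (B i)"
    and U: "U \<subseteq> PiE (insert j J) (\<lambda>i. verts (B i))"
begin

lemma finite_verts: "i \<in> insert j J \<Longrightarrow> finite (verts (B i))"
  using ok by (auto simp: base_ok_def graph_on_def)

lemma nb_verts: "i \<in> insert j J \<Longrightarrow> nb (edges (B i)) a \<subseteq> verts (B i) - {a}"
  using ok nb_subset by (fastforce simp: base_ok_def)

lemma finite_base_nb: "i \<in> insert j J \<Longrightarrow> finite (nb (edges (B i)) a)"
  using nb_verts finite_verts by (meson finite_Diff finite_subset)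

lemma finite_slice: "finite (slice B J j U a)"
  unfolding slice_def using J finite_verts by (intro finite_subset[OF Collect_restrict] finite_PiE) auto

lemma sum_slices:
  "(\<Sum>u\<in>U. h u) = (\<Sum>a\<in>verts (B j). \<Sum>f\<in>slice B J j U a. (h (f(j := a)) :: real))"
proof -
  have "(\<Sum>a\<in>verts (B j). \<Sum>f\<in>slice B J j U a. h (f(j := a))) =
     (\<Sum>(a, f)\<in>(SIGMA a:verts (B j). slice B J j U a). h (f(j := a)))"
    using finite_verts finite_slice by (intro sum.Sigma) auto
  also have "\<dots> = (\<Sum>u\<in>U. h u)"
  proof -
    have inj: "inj_on (\<lambda>(a, f). f(j := a)) (SIGMA a:verts (B j). slice B J j U a)"
      using J(2) by (intro inj_on_subset[OF inj_combinator[of j J "\<lambda>i. verts (B i)"]]) (auto simp: slice_def)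
    have "(\<lambda>(a, f). f(j := a)) ` (SIGMA a:verts (B j). slice B J j U a) = U"
    proof (intro equalityI subsetI)
      fix u assume u: "u \<in> U"
      then have "u \<in> (\<lambda>(y, g). g(j := y)) ` (verts (B j) \<times> PiE J (\<lambda>i. verts (B i)))"
        using U by (auto simp: PiE_insert_eq)
      then show "u \<in> (\<lambda>(a, f). f(j := a)) ` (SIGMA a:verts (B j). slice B J j U a)"
        using u by (auto simp: slice_def image_iff)
    qed (auto simp: slice_def)
    then have "(\<Sum>u\<in>U. h u) = (\<Sum>u\<in>(\<lambda>(a, f). f(j := a)) ` (SIGMA a:verts (B j). slice B J j U a). h u)"
      by simp
    also have "\<dots> = (\<Sum>(a, f)\<in>(SIGMA a:verts (B j). slice B J j U a). h (f(j := a)))"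
      using inj by (simp add: sum.reindex o_def case_prod_unfold)
    finally show ?thesis ..
  qed
  finally show ?thesis ..
qed

lemma card_slices: "real (card U) = (\<Sum>a\<in>verts (B j). real (card (slice B J j U a)))"
  using sum_slices[of "\<lambda>_. 1"] by simp

text \<open>A move in a coordinate of \<open>J\<close> stays within the fibre over \<open>a\<close>,
  a move in coordinate \<open>j\<close> compares two fibres. The Boolean \<open>t\<close> treats
  moves out of \<open>U\<close> and moves within \<open>U\<close> at once.\<close>

lemma moves_slices:
  "(\<Sum>u\<in>U. \<Sum>i\<in>insert j J. real (card {b \<in> nb (edges (B i)) (u i). (u(i := b) \<in> U) = t})) =
    (\<Sum>a\<in>verts (B j). \<Sum>f\<in>slice B J j U a. \<Sum>i\<in>J. real (card {b \<in> nb (edges (B i)) (f i). (f(i := b) \<in> slice B J j U a) = t})) +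
    (\<Sum>a\<in>verts (B j). \<Sum>b\<in>nb (edges (B j)) a. real (card {f \<in> slice B J j U a. (f \<in> slice B J j U b) = t}))"
proof -
  have "(\<Sum>u\<in>U. \<Sum>i\<in>insert j J. real (card {b \<in> nb (edges (B i)) (u i). (u(i := b) \<in> U) = t})) =
     (\<Sum>a\<in>verts (B j). \<Sum>f\<in>slice B J j U a.
        (\<Sum>i\<in>J. real (card {b \<in> nb (edges (B i)) (f i). (f(i := b) \<in> slice B J j U a) = t})) +
        real (card {b \<in> nb (edges (B j)) a. (f \<in> slice B J j U b) = t}))"
  proof (subst sum_slices, intro sum.cong refl)
    fix a f assume a: "a \<in> verts (B j)" and f: "f \<in> slice B J j U a"
    have fP: "f \<in> PiE J (\<lambda>i. verts (B i))" using f by (simp add: slice_def)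
    have eqJ: "{b \<in> nb (edges (B i)) ((f(j := a)) i). ((f(j := a))(i := b) \<in> U) = t} =
       {b \<in> nb (edges (B i)) (f i). (f(i := b) \<in> slice B J j U a) = t}" if i: "i \<in> J" for i
    proof -
      have ij: "i \<noteq> j" using i J by auto
      have "f(i := b) \<in> PiE J (\<lambda>i. verts (B i))" if "b \<in> nb (edges (B i)) (f i)" for b
        using fP that nb_verts[of i "f i"] i by (auto simp: PiE_iff extensional_def)
      then show ?thesis using ij by (auto simp: slice_def fun_upd_twist)
    qed
    have eqj: "{b \<in> nb (edges (B j)) ((f(j := a)) j). ((f(j := a))(j := b) \<in> U) = t} =
       {b \<in> nb (edges (B j)) a. (f \<in> slice B J j U b) = t}"
      using fP by (auto simp: slice_def)
    have "(\<Sum>i\<in>insert j J. real (card {b \<in> nb (edges (B i)) ((f(j := a)) i). ((f(j := a))(i := b) \<in> U) = t})) =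
      real (card {b \<in> nb (edges (B j)) ((f(j := a)) j). ((f(j := a))(j := b) \<in> U) = t}) +
      (\<Sum>i\<in>J. real (card {b \<in> nb (edges (B i)) ((f(j := a)) i). ((f(j := a))(i := b) \<in> U) = t}))"
      using J by (rule sum.insert)
    also have "(\<Sum>i\<in>J. real (card {b \<in> nb (edges (B i)) ((f(j := a)) i). ((f(j := a))(i := b) \<in> U) = t})) =
       (\<Sum>i\<in>J. real (card {b \<in> nb (edges (B i)) (f i). (f(i := b) \<in> slice B J j U a) = t}))"
      by (intro sum.cong refl arg_cong[of _ _ "\<lambda>X. real (card X)"] eqJ)
    finally show "(\<Sum>i\<in>insert j J. real (card {b \<in> nb (edges (B i)) ((f(j := a)) i). ((f(j := a))(i := b) \<in> U) = t})) =
       (\<Sum>i\<in>J. real (card {b \<in> nb (edges (B i)) (f i). (f(i := b) \<in> slice B J j U a) = t})) +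
        real (card {b \<in> nb (edges (B j)) a. (f \<in> slice B J j U b) = t})"
      unfolding eqj by (simp only: add.commute)
  qed
  also have "\<dots> = (\<Sum>a\<in>verts (B j). \<Sum>f\<in>slice B J j U a. \<Sum>i\<in>J. real (card {b \<in> nb (edges (B i)) (f i). (f(i := b) \<in> slice B J j U a) = t})) +
     (\<Sum>a\<in>verts (B j). \<Sum>f\<in>slice B J j U a. real (card {b \<in> nb (edges (B j)) a. (f \<in> slice B J j U b) = t}))"
    by (simp only: sum.distrib)
  also have "(\<Sum>a\<in>verts (B j). \<Sum>f\<in>slice B J j U a. real (card {b \<in> nb (edges (B j)) a. (f \<in> slice B J j U b) = t})) =
     (\<Sum>a\<in>verts (B j). \<Sum>b\<in>nb (edges (B j)) a. real (card {f \<in> slice B J j U a. (f \<in> slice B J j U b) = t}))"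
  proof (intro sum.cong refl)
    fix a
    have c: "real (card {x \<in> X. P x}) = (\<Sum>x\<in>X. of_bool (P x))" if "finite X" for X :: "'x set" and P
      using that by (simp add: Int_def)
    show "(\<Sum>f\<in>slice B J j U a. real (card {b \<in> nb (edges (B j)) a. (f \<in> slice B J j U b) = t})) =
     (\<Sum>b\<in>nb (edges (B j)) a. real (card {f \<in> slice B J j U a. (f \<in> slice B J j U b) = t}))"
      by (simp only: c[OF finite_base_nb[OF insertI1]] c[OF finite_slice]) (rule sum.swap)
  qed
  finally show ?thesis .
qed

lemma out_moves_slices:
  "out_moves B (insert j J) U = (\<Sum>a\<in>verts (B j). out_moves B J (slice B J j U a)) +
    (\<Sum>a\<in>verts (B j). \<Sum>b\<in>nb (edges (B j)) a. real (card (slice B J j U a - slice B J j U b)))"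
  using moves_slices[of False] by (simp add: out_moves_def set_diff_eq)

lemma in_moves_slices:
  "in_moves B (insert j J) U = (\<Sum>a\<in>verts (B j). in_moves B J (slice B J j U a)) +
    (\<Sum>a\<in>verts (B j). \<Sum>b\<in>nb (edges (B j)) a. real (card (slice B J j U a \<inter> slice B J j U b)))"
  using moves_slices[of True] by (simp add: in_moves_def Int_def)

text \<open>Along a walk in \<open>B j\<close> from \<open>a\<close> to \<open>a'\<close>, an
  element of the first slice that is missing from the last one drops out at some edge of the walk
  and is counted there on the right-hand side.\<close>

lemma slice_diff_le:
  assumes "a \<in> verts (B j)" "a' \<in> verts (B j)"
  shows "real (card (slice B J j U a)) - card (slice B J j U a') \<le>
    (\<Sum>a\<in>verts (B j). \<Sum>b\<in>nb (edges (B j)) a. real (card (slice B J j U a - slice B J j U b)))"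
proof -
  let ?s = "slice B J j U" and ?N = "nb (edges (B j))"
  have sub: "?s a - ?s a' \<subseteq> (\<Union>x\<in>verts (B j). \<Union>b\<in>?N x. ?s x - ?s b)"
  proof
    fix f assume f: "f \<in> ?s a - ?s a'"
    have "(adj (B j))\<^sup>*\<^sup>* a a'"
      using assms ok[of j] by (auto simp: base_ok_def connected_graph_def)
    then have "f \<in> ?s a' \<or> f \<in> (\<Union>x\<in>verts (B j). \<Union>b\<in>?N x. ?s x - ?s b)"
    proof (induction rule: rtranclp_induct)
      case (step y z)
      then have z: "z \<in> ?N y" "y \<in> verts (B j)"
        using ok[of j] by (auto simp: adj_def nb_def base_ok_def graph_on_def)
      with step.IH show ?case by blast
    qed (use f in auto)
    then show "f \<in> (\<Union>x\<in>verts (B j). \<Union>b\<in>?N x. ?s x - ?s b)" using f by auto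
  qed
  have "card (?s a) - card (?s a') \<le> card (?s a - ?s a')"
    using finite_slice by (rule diff_card_le_card_Diff)
  also have "\<dots> \<le> card (\<Union>x\<in>verts (B j). \<Union>b\<in>?N x. ?s x - ?s b)"
    using sub finite_verts finite_slice finite_base_nb by (intro card_mono) auto
  also have "\<dots> \<le> (\<Sum>x\<in>verts (B j). card (\<Union>b\<in>?N x. ?s x - ?s b))"
    using finite_verts by (intro card_UN_le) auto
  also have "\<dots> \<le> (\<Sum>x\<in>verts (B j). \<Sum>b\<in>?N x. card (?s x - ?s b))"
    using finite_base_nb by (intro sum_mono card_UN_le) auto
  finally have "real (card (?s a) - card (?s a')) \<le> (\<Sum>x\<in>verts (B j). \<Sum>b\<in>?N x. real (card (?s x - ?s b)))"
    by (simp flip: of_nat_sum)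
  then show ?thesis by linarith
qed

end

text \<open>Induction with the chain rule for entropy. The slices contribute
  \<open>s a * ln (N / s a)\<close>; the remainder, the sum of
  \<open>s a * ln (k * s a / card U)\<close>, measures how far slice sizes deviate from their mean.
  It is at most \<open>C\<close> times the difference between the largest and the smallest slice,
  and the moves in coordinate \<open>j\<close> pay for that.\<close>

lemma out_moves_ge:
  assumes "finite J" "\<And>i. i \<in> J \<Longrightarrow> base_ok C (B i)" "U \<subseteq> PiE J (\<lambda>i. verts (B i))"
  shows "card U * ln ((\<Prod>i\<in>J. real (card (verts (B i)))) / card U) \<le> C * out_moves B J U"
  using assms
proof (induction J arbitrary: U rule: finite_induct)
  case empty
  then have "U = {} \<or> U = {\<lambda>_. undefined}" by auto
  then show ?case by (auto simp: out_moves_def)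
next
  case (insert j J)
  note ctx = insert.hyps insert.prems
  let ?s = "slice B J j U" and ?Vj = "verts (B j)"
  let ?D = "\<Sum>a\<in>?Vj. \<Sum>b\<in>nb (edges (B j)) a. real (card (?s a - ?s b))"
  define N where "N = (\<Prod>i\<in>J. real (card (verts (B i))))"
  define k where "k = real (card ?Vj)"
  define s where "s = (\<lambda>a. real (card (?s a)))"
  have finV: "finite ?Vj" "?Vj \<noteq> {}"
    using insert.prems(1)[of j] by (auto simp: base_ok_def graph_on_def)
  have k: "1 < k" "k \<le> C" using insert.prems(1)[of j] by (auto simp: base_ok_def k_def)
  have N: "0 < N" unfolding N_def
    using insert.prems(1) by (intro prod_pos) (force simp: base_ok_def)
  have tot: "real (card U) = (\<Sum>a\<in>?Vj. s a)" unfolding s_def by (rule card_slices[OF ctx])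
  show ?case
  proof (cases "U = {}")
    case False
    have "finite U"
      using insert.prems(2) by (rule finite_subset) (use insert.hyps insert.prems(1) in \<open>auto simp: base_ok_def graph_on_def intro!: finite_PiE\<close>)
    then have S0: "0 < real (card U)" using False by (simp add: card_gt_0_iff)
    have IH: "s a * ln (N / s a) \<le> C * out_moves B J (?s a)" for a
      unfolding s_def N_def by (intro insert.IH insert.prems) (auto simp: slice_def)
    obtain a1 where a1: "a1 \<in> ?Vj" "\<And>a. a \<in> ?Vj \<Longrightarrow> s a \<le> s a1"
      by (rule finite_max_witness[OF finV, of s]) blast
    obtain a0 where a0: "a0 \<in> ?Vj" "\<And>a. a \<in> ?Vj \<Longrightarrow> s a0 \<le> s a"
      by (rule finite_max_witness[OF finV, of "\<lambda>a. - s a"]) force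
    have a0_le: "k * s a0 \<le> card U"
      unfolding tot k_def using a0 sum_mono[of ?Vj "\<lambda>_. s a0" s] by simp
    have "(\<Sum>a\<in>?Vj. s a * ln (k * s a / card U)) \<le> (\<Sum>a\<in>?Vj. s a * (k / card U * (s a1 - s a0)))"
    proof (intro sum_mono)
      fix a assume a: "a \<in> ?Vj"
      show "s a * ln (k * s a / card U) \<le> s a * (k / card U * (s a1 - s a0))"
      proof (cases "s a = 0")
        case False
        then have sa: "0 < s a" by (auto simp: s_def)
        have "ln (k * s a / card U) \<le> k * s a / card U - 1"
          using sa k S0 by (intro ln_le_minus_one) auto
        also have "\<dots> \<le> k / card U * (s a1 - s a0)"
        proof -
          have "k * s a \<le> k * s a1" using a1(2)[OF a] k by simp
          then have "k * s a - card U \<le> k * (s a1 - s a0)" using a0_le by (simp add: algebra_simps)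
          from divide_right_mono[OF this, of "card U"] show ?thesis
            using S0 by (simp add: diff_divide_distrib)
        qed
        finally show ?thesis using sa by (intro mult_left_mono) auto
      qed simp
    qed
    also have "\<dots> = k * (s a1 - s a0)"
      unfolding sum_distrib_right[symmetric] tot[symmetric] using S0 by simp
    also have "\<dots> \<le> C * (s a1 - s a0)"
      using k a1(2)[OF a0(1)] by (intro mult_right_mono) auto
    also have "\<dots> \<le> C * ?D"
      using slice_diff_le[OF ctx a1(1) a0(1)] by (intro mult_left_mono) (auto simp: s_def)
    finally have 1: "(\<Sum>a\<in>?Vj. s a * ln (k * s a / card U)) \<le> C * ?D" .
    have "(\<Sum>a\<in>?Vj. s a * ln (N * k / card U)) = (\<Sum>a\<in>?Vj. s a * ln (N / s a) + s a * ln (k * s a / card U))"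
    proof (intro sum.cong refl)
      fix a
      show "s a * ln (N * k / card U) = s a * ln (N / s a) + s a * ln (k * s a / card U)"
      proof (cases "s a = 0")
        case False
        then have sa: "0 < s a" by (auto simp: s_def)
        have "ln (N * k / card U) = ln (N / s a) + ln (k * s a / card U)"
          using sa N k S0 by (simp add: ln_div ln_mult)
        then show ?thesis by (simp add: distrib_left)
      qed simp
    qed
    also have "\<dots> \<le> (\<Sum>a\<in>?Vj. C * out_moves B J (?s a)) + C * ?D"
      unfolding sum.distrib using 1 IH by (intro add_mono sum_mono) auto
    also have "\<dots> = C * out_moves B (insert j J) U"
      by (subst out_moves_slices[OF ctx]) (simp_all only: sum_distrib_left distrib_left)
    finally show ?thesis
      using insert.hyps by (simp add: sum_distrib_right[symmetric] tot[symmetric] N_def k_def mult.commute)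
  qed (simp add: out_moves_def)
qed

text \<open>With \<open>M\<close> the largest slice and \<open>S = card U\<close>, a new coordinate
  adds at most \<open>(1 + C) * (S - M)\<close> inner moves, while the entropy increment, the sum of
  \<open>s a * ln (S / s a)\<close>, is at least \<open>(S - M) / C\<close>. In a regular product,
  sets of size polynomial in \<open>d\<close> therefore have edge boundary close to \<open>d\<close>
  times their size.\<close>

lemma in_moves_le:
  assumes "finite J" "\<And>i. i \<in> J \<Longrightarrow> base_ok C (B i)" "U \<subseteq> PiE J (\<lambda>i. verts (B i))"
  shows "in_moves B J U \<le> 2 * (real C)\<^sup>2 * (card U * ln (card U))"
  using assms
proof (induction J arbitrary: U rule: finite_induct)
  case empty
  then have "U = {} \<or> U = {\<lambda>_. undefined}" by auto
  then show ?case by (auto simp: in_moves_def)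
next
  case (insert j J)
  note ctx = insert.hyps insert.prems
  let ?s = "slice B J j U" and ?Vj = "verts (B j)" and ?N = "nb (edges (B j))"
  define s where "s = (\<lambda>a. real (card (?s a)))"
  have finV: "finite ?Vj" "?Vj \<noteq> {}"
    using insert.prems(1)[of j] by (auto simp: base_ok_def graph_on_def)
  have k: "1 < card ?Vj" "card ?Vj \<le> C" using insert.prems(1)[of j] by (auto simp: base_ok_def)
  have tot: "real (card U) = (\<Sum>a\<in>?Vj. s a)" unfolding s_def by (rule card_slices[OF ctx])
  have s0: "0 \<le> s a" for a by (simp add: s_def)
  show ?case
  proof (cases "U = {}")
    case False
    have "finite U"
      using insert.prems(2) by (rule finite_subset) (use insert.hyps insert.prems(1) in \<open>auto simp: base_ok_def graph_on_def intro!: finite_PiE\<close>)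
    define S where "S = real (card U)"
    have S0: "0 < S" using False \<open>finite U\<close> by (simp add: card_gt_0_iff S_def)
    have IH: "in_moves B J (?s a) \<le> 2 * (real C)\<^sup>2 * (s a * ln (s a))" for a
      unfolding s_def by (intro insert.IH insert.prems) (auto simp: slice_def)
    obtain a1 where a1: "a1 \<in> ?Vj" "\<And>a. a \<in> ?Vj \<Longrightarrow> s a \<le> s a1"
      by (rule finite_max_witness[OF finV, of s]) blast
    define M where "M = s a1"
    have rest: "(\<Sum>a\<in>?Vj - {a1}. s a) = S - M"
      using finV a1 by (simp add: S_def tot M_def sum_diff1)
    have SM: "S \<le> C * M"
    proof -
      have "S \<le> (\<Sum>a\<in>?Vj. M)" unfolding S_def tot M_def using a1 by (intro sum_mono) auto
      also have "\<dots> \<le> C * M" using k s0[of a1] by (auto simp: M_def intro!: mult_right_mono)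
      finally show ?thesis .
    qed
    have MS: "M \<le> S" using rest sum_nonneg[of "?Vj - {a1}" s] s0 by simp
    have deg: "card (?N a) \<le> C" for a
    proof -
      have "card (?N a) \<le> card ?Vj" using nb_verts[OF ctx insertI1, of a] finV by (intro card_mono) auto
      then show ?thesis using k by simp
    qed
    \<comment> \<open>Intersections with the largest slice are charged to the other slice, so the
      whole bound is in terms of \<open>S - M\<close> and vanishes when \<open>U\<close> lies in a
      single slice.\<close>
    have "(\<Sum>a\<in>?Vj. \<Sum>b\<in>?N a. real (card (?s a \<inter> ?s b))) =
       (\<Sum>b\<in>?N a1. real (card (?s a1 \<inter> ?s b))) + (\<Sum>a\<in>?Vj - {a1}. \<Sum>b\<in>?N a. real (card (?s a \<inter> ?s b)))"
      using finV a1 by (simp add: sum.remove)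
    also have "(\<Sum>b\<in>?N a1. real (card (?s a1 \<inter> ?s b))) \<le> (\<Sum>b\<in>?N a1. s b)"
      unfolding s_def using finite_slice[OF ctx] by (intro sum_mono) (auto intro!: card_mono)
    also have "\<dots> \<le> (\<Sum>b\<in>?Vj - {a1}. s b)"
      using nb_verts[OF ctx insertI1, of a1] finV s0 by (intro sum_mono2) auto
    also have "(\<Sum>a\<in>?Vj - {a1}. \<Sum>b\<in>?N a. real (card (?s a \<inter> ?s b))) \<le> (\<Sum>a\<in>?Vj - {a1}. real C * s a)"
    proof (intro sum_mono)
      fix a
      have "(\<Sum>b\<in>?N a. real (card (?s a \<inter> ?s b))) \<le> (\<Sum>b\<in>?N a. s a)"
        unfolding s_def using finite_slice[OF ctx] by (intro sum_mono) (auto intro!: card_mono)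
      also have "\<dots> \<le> C * s a" using deg[of a] s0[of a] by (auto intro!: mult_right_mono)
      finally show "(\<Sum>b\<in>?N a. real (card (?s a \<inter> ?s b))) \<le> C * s a" .
    qed
    finally have 1: "(\<Sum>a\<in>?Vj. \<Sum>b\<in>?N a. real (card (?s a \<inter> ?s b))) \<le> (S - M) + C * (S - M)"
      by (simp add: sum_distrib_left[symmetric] rest)
    \<comment> \<open>A slice other than the largest has at most \<open>S - M\<close> elements, and
      \<open>M \<ge> S / C\<close> since there are at most \<open>C\<close> slices; hence
      \<open>ln (S / s a) \<ge> 1 / C\<close>.\<close>
    have 2: "(S - M) / C \<le> (\<Sum>a\<in>?Vj. s a * ln (S / s a))"
    proof -
      have C0: "0 < real C" using k by simp
      have "(S - M) / C = (\<Sum>a\<in>?Vj - {a1}. s a * (1 / C))"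
        unfolding sum_distrib_right[symmetric] rest by simp
      also have "\<dots> \<le> (\<Sum>a\<in>?Vj - {a1}. s a * ln (S / s a))"
      proof (intro sum_mono)
        fix a assume a: "a \<in> ?Vj - {a1}"
        show "s a * (1 / C) \<le> s a * ln (S / s a)"
        proof (cases "s a = 0")
          case False
          then have sa: "0 < s a" using s0[of a] by simp
          have "s a \<le> S - M" unfolding rest[symmetric] using a finV s0 by (intro member_le_sum) auto
          then have "s a / S \<le> 1 - M / S" using S0 by (simp add: field_simps)
          moreover have "1 / C \<le> M / S" using SM S0 C0 by (simp add: field_simps)
          moreover have "ln (s a / S) \<le> s a / S - 1" using sa S0 by (intro ln_le_minus_one) auto
          moreover have "ln (S / s a) = - ln (s a / S)" using sa S0 by (simp add: ln_div)
          ultimately have "1 / C \<le> ln (S / s a)" by linarith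
          then show ?thesis using sa by (intro mult_left_mono) auto
        qed simp
      qed
      also have "\<dots> \<le> (\<Sum>a\<in>?Vj. s a * ln (S / s a))"
      proof (intro sum_mono2)
        fix a assume a: "a \<in> ?Vj - (?Vj - {a1})"
        have "0 < C * M" using SM S0 by linarith
        then have "0 < M" using C0 by (simp add: zero_less_mult_iff)
        then show "0 \<le> s a * ln (S / s a)" using a MS by (auto simp: M_def)
      qed (use finV in auto)
      finally show ?thesis .
    qed
    have 3: "(S - M) + C * (S - M) \<le> 2 * (real C)\<^sup>2 * ((S - M) / C)"
    proof -
      have "(S - M) * (1 + C) \<le> (S - M) * (2 * C)" using MS k by (intro mult_left_mono) auto
      also have "\<dots> = 2 * (real C)\<^sup>2 * ((S - M) / C)" using k by (simp add: power2_eq_square)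
      finally show ?thesis by (simp add: algebra_simps)
    qed
    have "in_moves B (insert j J) U \<le> (\<Sum>a\<in>?Vj. 2 * (real C)\<^sup>2 * (s a * ln (s a))) + 2 * (real C)\<^sup>2 * (\<Sum>a\<in>?Vj. s a * ln (S / s a))"
    proof (subst in_moves_slices[OF ctx], assumption, intro add_mono sum_mono IH)
      have "2 * (real C)\<^sup>2 * ((S - M) / C) \<le> 2 * (real C)\<^sup>2 * (\<Sum>a\<in>?Vj. s a * ln (S / s a))"
        using 2 by (intro mult_left_mono) auto
      then show "(\<Sum>a\<in>?Vj. \<Sum>b\<in>?N a. real (card (?s a \<inter> ?s b))) \<le> 2 * (real C)\<^sup>2 * (\<Sum>a\<in>?Vj. s a * ln (S / s a))"
        using 1 3 by linarith
    qed
    also have "\<dots> = (\<Sum>a\<in>?Vj. 2 * (real C)\<^sup>2 * (s a * ln S))"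
      unfolding sum_distrib_left sum.distrib[symmetric]
    proof (intro sum.cong refl)
      fix a
      show "2 * (real C)\<^sup>2 * (s a * ln (s a)) + 2 * (real C)\<^sup>2 * (s a * ln (S / s a)) = 2 * (real C)\<^sup>2 * (s a * ln S)"
      proof (cases "s a = 0")
        case False
        then have sa: "0 < s a" using s0[of a] by simp
        then show ?thesis using S0 by (simp add: ln_div algebra_simps)
      qed simp
    qed
    also have "\<dots> = 2 * (real C)\<^sup>2 * (S * ln S)"
      by (simp add: sum_distrib_left[symmetric] sum_distrib_right[symmetric] tot[symmetric] S_def)
    finally show ?thesis by (simp add: S_def)
  qed (simp add: in_moves_def)
qed

text \<open>In \<open>split\<close> the sets \<open>H y\<close> are disjoint pieces of the host
  graph, one for each of many vertices \<open>y\<close> at distance two from \<open>v\<close>, that inherit almost all degrees.\<close>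

locale host_graph =
  fixes V :: "'v set" and E :: "'v set set" and d :: nat and C \<delta> \<sigma> :: real
  assumes graph: "graph_on V E"
    and regular: "v \<in> V \<Longrightarrow> card (nb E v) = d"
    and C: "1 \<le> C"
    and iso_log: "U \<subseteq> V \<Longrightarrow> card U * ln (card V / card U) / C \<le> card (bd E U)"
    and iso_small: "U \<subseteq> V \<Longrightarrow> card U * (real d - 2 * C\<^sup>2 * ln (card U)) \<le> card (bd E U)"
    and split: "v \<in> V \<Longrightarrow> \<exists>Y H. Y \<subseteq> V \<and> \<sigma> * (real d)\<^sup>2 \<le> card Y \<and>
        (\<forall>y\<in>Y. y \<in> H y \<and> H y \<subseteq> V \<and> (\<exists>x. x \<in> nb E v \<and> y \<in> nb E x) \<and>
          (\<forall>u\<in>H y. card (nb E u - H y) \<le> \<delta> * d)) \<and>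
        (\<forall>y\<in>Y. \<forall>z\<in>Y. y \<noteq> z \<longrightarrow> H y \<inter> H z = {})"
    and size_lower: "exp (d / (2 * C)) \<le> card V"
    and size_upper: "card V \<le> exp (C * d)"

section \<open>The Cartesian product as a host graph\<close>

context
  fixes B :: "nat \<Rightarrow> 'a ugraph" and t C :: nat and deg :: "nat \<Rightarrow> nat"
  assumes ok: "\<And>i. i \<in> {1..t} \<Longrightarrow> base_ok C (B i)"
    and reg: "\<And>i v. i \<in> {1..t} \<Longrightarrow> v \<in> verts (B i) \<Longrightarrow> card (nb (edges (B i)) v) = deg i"
begin

abbreviation (input) "PV \<equiv> verts (cartesian_product t B)"
abbreviation (input) "PE \<equiv> edges (cartesian_product t B)"
abbreviation (input) "bnb i \<equiv> nb (edges (B i))"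

lemma PV: "PV = PiE {1..t} (\<lambda>i. verts (B i))"
  by (simp add: cartesian_product_def)

lemma bnb_verts: "i \<in> {1..t} \<Longrightarrow> bnb i a \<subseteq> verts (B i) - {a}"
  using ok nb_subset by (fastforce simp: base_ok_def)

lemma finite_bverts: "i \<in> {1..t} \<Longrightarrow> finite (verts (B i))"
  using ok by (auto simp: base_ok_def graph_on_def)

lemma finite_bnb: "i \<in> {1..t} \<Longrightarrow> finite (bnb i a)"
  using bnb_verts finite_bverts by (meson finite_Diff finite_subset)

lemma upd_PV: "u \<in> PV \<Longrightarrow> i \<in> {1..t} \<Longrightarrow> a \<in> verts (B i) \<Longrightarrow> u(i := a) \<in> PV"
  by (auto simp: PV PiE_iff extensional_def)

lemma nb_product:
  assumes u: "u \<in> PV"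
  shows "v \<in> nb PE u \<longleftrightarrow> (\<exists>i\<in>{1..t}. \<exists>a\<in>bnb i (u i). v = u(i := a))"
proof
  assume "v \<in> nb PE u"
  then obtain u' v' i where uv: "{u, v} = {u', v'}" "u' \<in> PV" "v' \<in> PV" "i \<in> {1..t}"
    "{u' i, v' i} \<in> edges (B i)" "\<forall>m\<in>{1..t} - {i}. u' m = v' m"
    by (auto simp: nb_def cartesian_product_def)
  then have v: "v \<in> PV" "{u i, v i} \<in> edges (B i)" "\<forall>m\<in>{1..t} - {i}. u m = v m"
  proof -
    have "u = u' \<and> v = v' \<or> u = v' \<and> v = u'" using uv(1) by (auto simp: doubleton_eq_iff)
    note h = this
    from h show "v \<in> PV" "{u i, v i} \<in> edges (B i)"
      using uv(2-5) by (auto simp: insert_commute)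
    show "\<forall>m\<in>{1..t} - {i}. u m = v m"
    proof
      fix m assume "m \<in> {1..t} - {i}"
      then have "u' m = v' m" using uv(6) by blast
      then show "u m = v m" using h by auto
    qed
  qed
  have "v = u(i := v i)"
  proof
    fix m
    show "v m = (u(i := v i)) m"
      using u v PiE_arb[of u "{1..t}" "\<lambda>i. verts (B i)" m] PiE_arb[of v "{1..t}" "\<lambda>i. verts (B i)" m]
      unfolding PV by (cases "m \<in> {1..t} - {i}") auto
  qed
  moreover have "v i \<in> bnb i (u i)" using v(2) by (simp add: nb_def)
  ultimately show "\<exists>i\<in>{1..t}. \<exists>a\<in>bnb i (u i). v = u(i := a)" using uv(4) by blast
next
  assume "\<exists>i\<in>{1..t}. \<exists>a\<in>bnb i (u i). v = u(i := a)"
  then obtain i a where i: "i \<in> {1..t}" "a \<in> bnb i (u i)" "v = u(i := a)" by blast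
  have "v \<in> PV" unfolding i(3) using bnb_verts[OF i(1)] i by (intro upd_PV u) auto
  moreover have "{u i, v i} \<in> edges (B i)" "\<forall>m\<in>{1..t} - {i}. u m = v m"
    using i by (simp_all add: nb_def)
  ultimately have "{u, v} \<in> PE" using u i(1) unfolding cartesian_product_def
    by (simp, intro exI[of _ u] exI[of _ v]) auto
  then show "v \<in> nb PE u" by (simp add: nb_def)
qed

lemma graph_product: "graph_on PV PE"
  unfolding graph_on_def
proof (intro conjI ballI)
  show "finite PV" unfolding PV using finite_bverts by (intro finite_PiE) auto
  fix e assume "e \<in> PE"
  then obtain u v i where uv: "e = {u, v}" "u \<in> PV" "v \<in> PV" "i \<in> {1..t}" "{u i, v i} \<in> edges (B i)"
    by (auto simp: cartesian_product_def)
  have "v i \<in> bnb i (u i)" using uv(5) by (simp add: nb_def)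
  then have "u i \<noteq> v i" using bnb_verts[OF uv(4), of "u i"] by auto
  then have "u \<noteq> v" by auto
  then show "e \<subseteq> PV" "card e = 2" using uv by auto
qed

lemma card_nb_product:
  assumes u: "u \<in> PV"
  shows "card (nb PE u \<inter> X) = (\<Sum>i\<in>{1..t}. card {a \<in> bnb i (u i). u(i := a) \<in> X})"
proof -
  have "bij_betw (\<lambda>(i, a). u(i := a)) (SIGMA i:{1..t}. {a \<in> bnb i (u i). u(i := a) \<in> X}) (nb PE u \<inter> X)"
    unfolding bij_betw_def
  proof
    show "inj_on (\<lambda>(i, a). u(i := a)) (SIGMA i:{1..t}. {a \<in> bnb i (u i). u(i := a) \<in> X})"
    proof (intro inj_onI, clarify)
      fix i a j b assume ab: "i \<in> {1..t}" "a \<in> bnb i (u i)" "j \<in> {1..t}" "b \<in> bnb j (u j)"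
        and eq: "u(i := a) = u(j := b)"
      have "a \<noteq> u i" using bnb_verts[OF ab(1), of "u i"] ab(2) by auto
      moreover have "a = (u(j := b)) i" using fun_cong[OF eq, of i] by simp
      ultimately have "i = j" by (auto split: if_splits)
      then show "i = j \<and> a = b" using fun_cong[OF eq, of i] by simp
    qed
    show "(\<lambda>(i, a). u(i := a)) ` (SIGMA i:{1..t}. {a \<in> bnb i (u i). u(i := a) \<in> X}) = nb PE u \<inter> X"
    proof (intro equalityI subsetI)
      fix v assume "v \<in> nb PE u \<inter> X"
      then obtain i a where "i \<in> {1..t}" "a \<in> bnb i (u i)" "v = u(i := a)" "v \<in> X"
        using nb_product[OF u] by auto
      then show "v \<in> (\<lambda>(i, a). u(i := a)) ` (SIGMA i:{1..t}. {a \<in> bnb i (u i). u(i := a) \<in> X})"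
        by (intro image_eqI[of _ _ "(i, a)"]) auto
    qed (use nb_product[OF u] in auto)
  qed
  then have "card (nb PE u \<inter> X) = card (SIGMA i:{1..t}. {a \<in> bnb i (u i). u(i := a) \<in> X})"
    by (simp add: bij_betw_same_card)
  also have "\<dots> = (\<Sum>i\<in>{1..t}. card {a \<in> bnb i (u i). u(i := a) \<in> X})"
    using finite_bnb by (intro card_SigmaI) auto
  finally show ?thesis .
qed

text \<open>A connected graph with at least two vertices has no isolated vertex. Hence
  \<open>d\<close> lies between \<open>t\<close> and \<open>C * t\<close>, and the two are
  interchangeable up to constants.\<close>

lemma deg_bounds: "i \<in> {1..t} \<Longrightarrow> 1 \<le> deg i \<and> deg i \<le> C"
proof
  assume i: "i \<in> {1..t}"
  have Bi: "graph_on (verts (B i)) (edges (B i))" "connected_graph (B i)" "1 < card (verts (B i))" "card (verts (B i)) \<le> C"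
    using ok[OF i] by (auto simp: base_ok_def)
  then obtain x where x: "x \<in> verts (B i)" by (auto simp: connected_graph_def)
  have "card (bnb i x) \<le> card (verts (B i))"
    using bnb_verts[OF i, of x] finite_bverts[OF i] by (intro card_mono) auto
  then show "deg i \<le> C" using reg[OF i x] Bi by simp
  obtain y where y: "y \<in> verts (B i)" "y \<noteq> x"
  proof -
    have "\<not> verts (B i) \<subseteq> {x}" using card_mono[of "{x}" "verts (B i)"] Bi(3) by auto
    then show ?thesis using that by blast
  qed
  have "(adj (B i))\<^sup>*\<^sup>* x y" using Bi(2) x y by (auto simp: connected_graph_def)
  then have "x = y \<or> (\<exists>z. adj (B i) x z)" by (induction rule: converse_rtranclp_induct) auto
  then obtain z where "adj (B i) x z" using y(2) by auto
  then have "z \<in> bnb i x" by (simp add: nb_def adj_def)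
  then have "0 < card (bnb i x)" using finite_bnb[OF i] by (auto simp: card_gt_0_iff)
  then show "1 \<le> deg i" using reg[OF i x] by simp
qed

lemma deg_product:
  assumes u: "u \<in> PV"
  shows "card (nb PE u) = (\<Sum>i\<in>{1..t}. deg i)"
proof -
  have "card (nb PE u) = (\<Sum>i\<in>{1..t}. card {a \<in> bnb i (u i). u(i := a) \<in> UNIV})"
    using card_nb_product[OF u, of UNIV] by simp
  also have "\<dots> = (\<Sum>i\<in>{1..t}. deg i)"
  proof (intro sum.cong refl)
    fix i assume i: "i \<in> {1..t}"
    then have "u i \<in> verts (B i)" using u unfolding PV by (rule PiE_mem[rotated])
    then show "card {a \<in> bnb i (u i). u(i := a) \<in> UNIV} = deg i" using reg[OF i] by simp
  qed
  finally show ?thesis .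
qed

text \<open>For \<open>split\<close>, two disjoint blocks of \<open>r\<close> coordinates are used:
  \<open>y\<close> differs from \<open>v\<close> in one coordinate of each block, and
  \<open>H y\<close> fixes all \<open>2 * r\<close> block coordinates to those of \<open>y\<close>.
  Freezing them costs a vertex at most \<open>2 * r * C \<le> \<delta> * d\<close> neighbours, and
  there are \<open>r * r\<close> choices of \<open>y\<close>.\<close>

lemma product_host_graph:
  fixes \<delta> :: real
  assumes \<delta>: "0 < \<delta>" "\<delta> \<le> 1" and t: "0 < t" "4 * C / \<delta> \<le> t"
  shows "host_graph PV PE (\<Sum>i\<in>{1..t}. deg i) C \<delta> (\<delta>\<^sup>2 / (16 * real C ^ 4))"
proof
  define d where "d = (\<Sum>i\<in>{1..t}. deg i)"
  have C2: "2 \<le> C" using ok[of 1] t(1) by (auto simp: base_ok_def)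
  have td: "t \<le> d" unfolding d_def using sum_mono[of "{1..t}" "\<lambda>_. 1" deg] deg_bounds by simp
  have dCt: "d \<le> C * t" unfolding d_def using sum_mono[of "{1..t}" deg "\<lambda>_. C"] deg_bounds by (simp add: mult.commute)
  show "graph_on PV PE" by (rule graph_product)
  show "card (nb PE v) = d" if "v \<in> PV" for v using deg_product[OF that] by (simp add: d_def)
  show "1 \<le> real C" using C2 by simp
  have cardV: "real (card PV) = (\<Prod>i\<in>{1..t}. real (card (verts (B i))))"
    unfolding PV by (simp add: card_PiE)
  have bd_out: "real (card (bd PE U)) = out_moves B {1..t} U" if U: "U \<subseteq> PV" for U
  proof -
    have "card (bd PE U) = (\<Sum>u\<in>U. card (nb PE u \<inter> (- U)))"
      by (simp add: card_bd[OF graph_product U] Diff_eq)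
    also have "\<dots> = (\<Sum>u\<in>U. \<Sum>i\<in>{1..t}. card {a \<in> bnb i (u i). u(i := a) \<notin> U})"
      using U by (intro sum.cong refl) (simp add: card_nb_product subset_iff)
    finally show ?thesis by (simp add: out_moves_def)
  qed
  show "card U * ln (card PV / card U) / C \<le> card (bd PE U)" if U: "U \<subseteq> PV" for U
    using out_moves_ge[of "{1..t}" C B U] U ok C2 unfolding bd_out[OF U] cardV
    by (simp add: PV divide_le_eq mult.commute)
  show "card U * (real d - 2 * (real C)\<^sup>2 * ln (card U)) \<le> card (bd PE U)" if U: "U \<subseteq> PV" for U
  proof -
    have "real (card (bd PE U)) + in_moves B {1..t} U = (\<Sum>u\<in>U. real d)"
    proof -
      have "card (nb PE u) = card (nb PE u - U) + card (nb PE u \<inter> U)" for u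
        using card_Int_Diff[OF finite_nb[OF graph_product], of u U] by simp
      moreover have "in_moves B {1..t} U = (\<Sum>u\<in>U. real (card (nb PE u \<inter> U)))"
        unfolding in_moves_def using U by (intro sum.cong refl) (simp add: card_nb_product subset_iff)
      ultimately show ?thesis
        using U deg_product unfolding card_bd[OF graph_product U] d_def
        by (simp add: sum.distrib[symmetric] subset_iff flip: of_nat_add)
    qed
    moreover have "in_moves B {1..t} U \<le> 2 * (real C)\<^sup>2 * (card U * ln (card U))"
      using in_moves_le[of "{1..t}" C B U] U ok by (simp add: PV)
    ultimately show ?thesis by (simp add: algebra_simps)
  qed
  show "exp (real d / (2 * real C)) \<le> card PV"
  proof -
    have "real d / (2 * real C) \<le> t * (1 / 2)" using dCt C2 by (simp add: field_simps flip: of_nat_mult)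
    then have "exp (real d / (2 * real C)) \<le> exp (1 / 2) ^ t" by (simp add: exp_of_nat_mult[symmetric])
    also have "exp (1 / 2 :: real) \<le> 2" 
    proof -
      have "exp (1 / 2 :: real) ^ 2 \<le> 2 ^ 2" using exp_le by (simp add: exp_of_nat_mult[symmetric])
      then show ?thesis by (rule power2_le_imp_le) simp
    qed
    then have "exp (1 / 2 :: real) ^ t \<le> 2 ^ t" by (intro power_mono) auto
    also have "(2 :: real) ^ t = (\<Prod>i\<in>{1..t}. 2)" by simp
    also have "\<dots> \<le> card PV" unfolding cardV using ok by (intro prod_mono) (force simp: base_ok_def)
    finally show ?thesis .
  qed
  show "card PV \<le> exp (C * real d)"
  proof -
    have "real (card PV) \<le> (\<Prod>i\<in>{1..t}. real C)"
      unfolding cardV using ok by (intro prod_mono) (auto simp: base_ok_def)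
    also have "\<dots> = real C ^ t" by simp
    also have "\<dots> \<le> exp C ^ t" using exp_ge_add_one_self[of "real C"] by (intro power_mono) linarith+
    also have "\<dots> = exp (real t * C)" by (rule exp_of_nat_mult[symmetric])
    also have "\<dots> \<le> exp (C * real d)"
      using mult_left_mono[of "real t" "real d" "real C"] td by (simp add: mult.commute)
    finally show ?thesis .
  qed
  show "\<exists>Y H. Y \<subseteq> PV \<and> \<delta>\<^sup>2 / (16 * real C ^ 4) * (real d)\<^sup>2 \<le> card Y \<and>
        (\<forall>y\<in>Y. y \<in> H y \<and> H y \<subseteq> PV \<and> (\<exists>x. x \<in> nb PE v \<and> y \<in> nb PE x) \<and>
          (\<forall>u\<in>H y. card (nb PE u - H y) \<le> \<delta> * d)) \<and>
        (\<forall>y\<in>Y. \<forall>z\<in>Y. y \<noteq> z \<longrightarrow> H y \<inter> H z = {})" if v: "v \<in> PV" for v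
  proof -
    \<comment> \<open>\<open>r \<ge> \<delta> * t / (4 * C)\<close> and \<open>d \<le> C * t\<close>
      give \<open>r\<^sup>2 \<ge> \<delta>\<^sup>2 / (16 * C ^ 4) * d\<^sup>2\<close>, which is the
      origin of the value of \<open>\<sigma>\<close>.\<close>
    define r where "r = nat \<lfloor>\<delta> * t / (2 * C)\<rfloor>"
    have r_le: "real r \<le> \<delta> * t / (2 * C)" using \<delta> by (simp add: r_def)
    have r_ge: "\<delta> * t / (4 * C) \<le> r"
    proof -
      have "2 \<le> \<delta> * t / (2 * C)" using t \<delta> C2 by (simp add: field_simps)
      then show ?thesis unfolding r_def by linarith
    qed
    have Cr: "2 * real r * C \<le> \<delta> * t" using r_le C2 by (simp add: field_simps)
    have "2 * r \<le> t"
    proof -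
      have "2 * real r * 1 \<le> 2 * real r * C" using C2 by (intro mult_left_mono) auto
      also have "\<dots> \<le> 1 * real t" using Cr \<delta> mult_right_mono[of \<delta> 1 "real t"] by linarith
      finally show ?thesis by linarith
    qed
    define I1 where "I1 = {1..r}"
    define I2 where "I2 = {r + 1..2 * r}"
    have I: "I1 \<union> I2 \<subseteq> {1..t}" "I1 \<inter> I2 = {}" "card I1 = r" "card I2 = r" "finite I1" "finite I2"
      using \<open>2 * r \<le> t\<close> by (auto simp: I1_def I2_def)
    have cI: "card (I1 \<union> I2) = 2 * r" using I by (simp add: card_Un_disjoint)
    define a where "a = (\<lambda>i. SOME x. x \<in> bnb i (v i))"
    have a: "a i \<in> bnb i (v i)" if "i \<in> {1..t}" for i
    proof -
      have "card (bnb i (v i)) \<noteq> 0" using deg_bounds[OF that] reg[OF that, of "v i"] v that by (simp add: PV PiE_iff)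
      then have "bnb i (v i) \<noteq> {}" by auto
      then show ?thesis unfolding a_def by (simp add: some_in_eq)
    qed
    have av: "a i \<noteq> v i" if "i \<in> {1..t}" for i using a[OF that] bnb_verts[OF that] by blast
    define y where "y = (\<lambda>(i, j). v(i := a i, j := a j))"
    define Y where "Y = y ` (I1 \<times> I2)"
    define H where "H = (\<lambda>z. {u \<in> PV. \<forall>m\<in>I1 \<union> I2. u m = z m})"
    \<comment> \<open>Agreement on the two blocks already identifies the changed coordinates. This
      yields both the distinctness of the vertices \<open>y\<close> and the disjointness of the
      pieces.\<close>
    have y_diff: "i = k \<and> j = l"
      if "i \<in> I1" "j \<in> I2" "k \<in> I1" "l \<in> I2" "\<forall>m\<in>I1 \<union> I2. y (i, j) m = y (k, l) m" for i j k l
    proof -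
      have ne: "i \<noteq> j" "k \<noteq> l" "i \<noteq> l" "k \<noteq> j" using that I(2) by auto
      have "y (i, j) i = a i" "y (i, j) j = a j" using ne by (auto simp: y_def)
      then have "y (k, l) i = a i" "y (k, l) j = a j" using that by (metis UnI1 UnI2)+
      then have "a m \<noteq> v m \<Longrightarrow> m \<in> {i, j} \<Longrightarrow> m = k \<or> m = l" for m by (cases "m = k \<or> m = l") (auto simp: y_def)
      then have "i = k \<or> i = l" "j = k \<or> j = l" using av[of i] av[of j] I(1) that(1,2) by blast+
      then show ?thesis using ne by auto
    qed
    have inj: "inj_on y (I1 \<times> I2)"
    proof (intro inj_onI, clarify)
      fix i j k l assume "i \<in> I1" "j \<in> I2" "k \<in> I1" "l \<in> I2" "y (i, j) = y (k, l)"
      then show "i = k \<and> j = l" by (intro y_diff) auto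
    qed
    have "card Y = r * r" unfolding Y_def using inj I by (simp add: card_image card_cartesian_product)
    have x_PV: "v(i := a i) \<in> PV" "v(i := a i) \<in> nb PE v" if "i \<in> {1..t}" for i
    proof -
      show "v(i := a i) \<in> PV" using a[OF that] bnb_verts[OF that] by (intro upd_PV v that) auto
      show "v(i := a i) \<in> nb PE v" using a[OF that] that nb_product[OF v] by auto
    qed
    have y_PV: "y (i, j) \<in> PV" "y (i, j) \<in> nb PE (v(i := a i))" if "i \<in> I1" "j \<in> I2" for i j
    proof -
      have ij: "i \<in> {1..t}" "j \<in> {1..t}" "i \<noteq> j" using that I by auto
      then have "y (i, j) = (v(i := a i))(j := a j)" "a j \<in> bnb j ((v(i := a i)) j)" using a by (auto simp: y_def)
      then show "y (i, j) \<in> nb PE (v(i := a i))"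
        using ij(2) by (intro nb_product[OF x_PV(1)[OF ij(1)], THEN iffD2] bexI[of _ j] bexI[of _ "a j"])
      then show "y (i, j) \<in> PV" using nb_subset[OF graph_product] by blast
    qed
    have out: "card (nb PE u - H z) \<le> \<delta> * d" if u: "u \<in> H z" for u z
    proof -
      have uP: "u \<in> PV" using u by (simp add: H_def)
      have "nb PE u - H z \<subseteq> (\<Union>i\<in>I1 \<union> I2. (\<lambda>a. u(i := a)) ` bnb i (u i))"
      proof
        fix w assume w: "w \<in> nb PE u - H z"
        then obtain i a where ia: "i \<in> {1..t}" "a \<in> bnb i (u i)" "w = u(i := a)"
          using nb_product[OF uP] by auto
        have "i \<in> I1 \<union> I2"
        proof (rule ccontr)
          assume "i \<notin> I1 \<union> I2"
          then have "w \<in> H z" using u ia upd_PV[OF uP ia(1)] bnb_verts[OF ia(1)] by (auto simp: H_def)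
          then show False using w by auto
        qed
        then show "w \<in> (\<Union>i\<in>I1 \<union> I2. (\<lambda>a. u(i := a)) ` bnb i (u i))" using ia by auto
      qed
      then have "card (nb PE u - H z) \<le> card (\<Union>i\<in>I1 \<union> I2. (\<lambda>a. u(i := a)) ` bnb i (u i))"
        using I finite_bnb by (intro card_mono finite_UN_I finite_imageI) auto
      also have "\<dots> \<le> (\<Sum>i\<in>I1 \<union> I2. card ((\<lambda>a. u(i := a)) ` bnb i (u i)))"
        using I by (intro card_UN_le) auto
      also have "\<dots> \<le> (\<Sum>i\<in>I1 \<union> I2. C)"
      proof (intro sum_mono)
        fix i assume "i \<in> I1 \<union> I2"
        then have i: "i \<in> {1..t}" using I by auto
        have "card ((\<lambda>a. u(i := a)) ` bnb i (u i)) \<le> card (bnb i (u i))" by (rule card_image_le[OF finite_bnb[OF i]])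
        also have "\<dots> \<le> C" using deg_bounds[OF i] reg[OF i, of "u i"] uP i by (simp add: PV PiE_iff)
        finally show "card ((\<lambda>a. u(i := a)) ` bnb i (u i)) \<le> C" .
      qed
      also have "\<dots> = 2 * r * C" using cI by simp
      finally have "card (nb PE u - H z) \<le> 2 * r * C" .
      from of_nat_mono[OF this, where 'a = real] have "real (card (nb PE u - H z)) \<le> 2 * real r * C" by simp
      also have "\<dots> \<le> \<delta> * t" by (rule Cr)
      also have "\<dots> \<le> \<delta> * d" using td \<delta> by simp
      finally show ?thesis .
    qed
    have "\<delta>\<^sup>2 / (16 * real C ^ 4) * (real d)\<^sup>2 \<le> card Y"
    proof -
      have "\<delta>\<^sup>2 / (16 * real C ^ 4) * (real d)\<^sup>2 \<le> \<delta>\<^sup>2 / (16 * real C ^ 4) * (real C * t)\<^sup>2"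
        using dCt by (intro mult_left_mono power_mono) (simp_all flip: of_nat_mult)
      also have "\<dots> = (\<delta> * t / (4 * C))\<^sup>2" using C2 by (simp add: field_simps power2_eq_square power4_eq_xxxx)
      also have "\<dots> \<le> (real r)\<^sup>2" using r_ge \<delta> by (intro power_mono) auto
      finally show ?thesis using \<open>card Y = r * r\<close> by (simp add: power2_eq_square)
    qed
    moreover have "Y \<subseteq> PV" using y_PV by (auto simp: Y_def)
    moreover have "\<forall>z\<in>Y. z \<in> H z \<and> H z \<subseteq> PV \<and> (\<exists>x. x \<in> nb PE v \<and> z \<in> nb PE x) \<and> (\<forall>u\<in>H z. card (nb PE u - H z) \<le> \<delta> * d)"
    proof
      fix z assume "z \<in> Y"
      then obtain i j where ij: "i \<in> I1" "j \<in> I2" "z = y (i, j)" by (auto simp: Y_def)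
      then have "i \<in> {1..t}" using I by auto
      then have "\<exists>x. x \<in> nb PE v \<and> z \<in> nb PE x" using x_PV(2) y_PV(2) ij by blast
      moreover have "z \<in> H z" "H z \<subseteq> PV" using y_PV(1) ij by (auto simp: H_def)
      ultimately show "z \<in> H z \<and> H z \<subseteq> PV \<and> (\<exists>x. x \<in> nb PE v \<and> z \<in> nb PE x) \<and> (\<forall>u\<in>H z. card (nb PE u - H z) \<le> \<delta> * d)"
        using out by blast
    qed
    moreover have "\<forall>z\<in>Y. \<forall>w\<in>Y. z \<noteq> w \<longrightarrow> H z \<inter> H w = {}"
    proof (intro ballI impI, rule ccontr)
      fix z w assume zw: "z \<in> Y" "w \<in> Y" "z \<noteq> w" "H z \<inter> H w \<noteq> {}"
      obtain i j k l where "i \<in> I1" "j \<in> I2" "z = y (i, j)" "k \<in> I1" "l \<in> I2" "w = y (k, l)"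
        using zw by (auto simp: Y_def)
      moreover have "\<forall>m\<in>I1 \<union> I2. z m = w m"
      proof -
        obtain u where "u \<in> H z" "u \<in> H w" using zw(4) by auto
        then show ?thesis by (auto simp: H_def)
      qed
      ultimately show False using y_diff zw(3) by blast
    qed
    ultimately show ?thesis by blast
  qed
qed

end

section \<open>Typical properties of the two rounds\<close>

lemma sum_exp_tail_le:
  fixes y :: real
  assumes "0 < y" "y \<le> 1"
  shows "(\<Sum>m=K..M. exp (- (y * real m))) \<le> 2 / y * exp (- (y * real K))"
proof -
  define r where "r = exp (- y)"
  have r: "0 < r" "r < 1" using assms by (auto simp: r_def)
  have "r \<le> 1 / (1 + y)" unfolding r_def using assms by (intro exp_minus_le) auto
  also have "\<dots> \<le> 1 - y / 2"
  proof -
    have "0 \<le> y * (1 - y)" using assms by (intro mult_nonneg_nonneg) auto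
    then show ?thesis using assms by (simp add: field_simps)
  qed
  finally have ry: "y / 2 \<le> 1 - r" by simp
  have pow: "exp (- (y * real m)) = r ^ m" for m by (simp add: r_def exp_of_nat_mult[symmetric] mult.commute)
  have "(\<Sum>m=K..M. r ^ m) * (1 - r) \<le> r ^ K"
  proof (cases "K \<le> M")
    case True
    have "(\<Sum>m=K..M. r ^ m) * (1 - r) = r ^ K - r ^ Suc M"
      using sum_gp_multiplied[OF True, of r] by (simp add: mult.commute)
    then show ?thesis using r by simp
  qed (use r in auto)
  then have "(\<Sum>m=K..M. r ^ m) \<le> r ^ K / (1 - r)" using r by (simp add: field_simps)
  also have "\<dots> \<le> r ^ K / (y / 2)" using r ry assms by (intro divide_left_mono) auto
  finally show ?thesis by (simp add: pow field_simps)
qed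

text \<open>The gain is of second order: \<open>ln (1 + \<epsilon>) \<le> \<epsilon> -
  \<epsilon>\<^sup>2 / 3\<close>. The multiples of \<open>\<epsilon>\<^sup>2\<close> in
  \<open>\<delta>\<close> and \<open>x\<close> are small enough that all losses together stay below
  \<open>\<epsilon>\<^sup>2 / 3 - \<epsilon>\<^sup>2 / 4\<close>.\<close>

lemma first_moment_exponent:
  fixes \<epsilon> :: real
  assumes \<epsilon>: "0 < \<epsilon>" "\<epsilon> \<le> 1 / 100"
  defines "\<delta> \<equiv> \<epsilon>\<^sup>2 / 1000" and "x \<equiv> \<epsilon>\<^sup>2 / 50"
  shows "ln (1 + \<epsilon>) - (\<epsilon> - 5 * \<delta>) * (1 - 2 * \<delta>) + 4 * x\<^sup>2 + x + x\<^sup>2 / x \<le> - (\<epsilon>\<^sup>2 / 4)"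
proof -
  have e2: "\<epsilon>\<^sup>2 \<le> 1 / 100 * \<epsilon>" "0 < \<epsilon>\<^sup>2"
    using \<epsilon> mult_right_mono[of \<epsilon> "1 / 100" \<epsilon>] by (auto simp: power2_eq_square)
  define y where "y = \<epsilon> - \<epsilon>\<^sup>2 / 3"
  have y: "9 / 10 * \<epsilon> \<le> y" using e2 \<epsilon> by (simp add: y_def)
  have "(9 / 10 * \<epsilon>)\<^sup>2 \<le> y\<^sup>2" using y \<epsilon> by (intro power_mono) auto
  then have "1 + \<epsilon> \<le> 1 + y + y\<^sup>2 / 2" using e2 by (simp add: y_def power_mult_distrib power2_eq_square)
  also have "\<dots> \<le> exp y" using y \<epsilon> by (intro exp_lower_Taylor_quadratic) auto
  finally have "1 + \<epsilon> \<le> exp y" .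
  then have "ln (1 + \<epsilon>) \<le> ln (exp y)" using \<epsilon> by (subst ln_le_cancel_iff) auto
  then have "ln (1 + \<epsilon>) \<le> y" by simp
  moreover have "4 * x\<^sup>2 \<le> x / 10"
  proof -
    have "x \<le> 1 / 40" using e2 \<epsilon> by (simp add: x_def)
    then show ?thesis using mult_right_mono[of x "1 / 40" x] by (simp add: x_def power2_eq_square)
  qed
  moreover have "x\<^sup>2 / x = x" using \<epsilon> by (simp add: x_def power2_eq_square)
  moreover have "\<epsilon> - 6 * \<delta> \<le> (\<epsilon> - 5 * \<delta>) * (1 - 2 * \<delta>)"
  proof -
    have "\<delta> * (2 * \<epsilon>) \<le> \<delta> * 1" using \<epsilon> by (intro mult_left_mono) (auto simp: \<delta>_def)
    moreover have "0 \<le> \<delta> * \<delta>" by simp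
    moreover have "(\<epsilon> - 5 * \<delta>) * (1 - 2 * \<delta>) = \<epsilon> - 5 * \<delta> - \<delta> * (2 * \<epsilon>) + 10 * (\<delta> * \<delta>)"
      by (simp add: algebra_simps)
    ultimately show ?thesis by linarith
  qed
  ultimately have "ln (1 + \<epsilon>) - (\<epsilon> - 5 * \<delta>) * (1 - 2 * \<delta>) + 4 * x\<^sup>2 + x + x\<^sup>2 / x \<le>
      y - (\<epsilon> - 6 * \<delta>) + x / 10 + x + x"
    by linarith
  also have "\<dots> \<le> - (\<epsilon>\<^sup>2 / 4)" using e2(2) by (simp add: y_def x_def \<delta>_def)
  finally show ?thesis .
qed

text \<open>The assumptions from \<open>d4\<close> to \<open>K_small\<close> hold for all large
  \<open>d\<close>; they are collected here and discharged by
  \<open>large_degree_conditions\<close>.\<close>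

locale sprinkled = host_graph V E d C \<delta> \<sigma>
  for V :: "'v set" and E d C \<delta> \<sigma> +
  fixes \<epsilon> :: real
  assumes \<epsilon>: "0 < \<epsilon>" "\<epsilon> \<le> 1 / 100" and \<delta>: "\<delta> = \<epsilon>\<^sup>2 / 1000" and \<sigma>: "0 < \<sigma>"
    and d4: "4 \<le> d" and \<delta>d: "1 \<le> \<delta> * d" and small_sets: "14 * C\<^sup>2 * ln d \<le> \<delta> * d"
    and \<tau>_small: "8 / \<epsilon>\<^sup>2 * exp (- (\<epsilon>\<^sup>2 / 4 * (\<delta> * d - 1))) \<le> \<epsilon> / 2"
    and K_small: "8 * C * d / \<epsilon>\<^sup>2 + 1 \<le> (real d)\<^sup>2"
begin

text \<open>The edges of probability \<open>p\<close> are exposed in a first round of probability \<open>p1\<close> and five sprinkling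
  rounds of probability \<open>\<delta> / d\<close> each, together \<open>p2\<close>. A first-round component is explored up to
  size \<open>s\<close>, after which it is unlikely to stop below size \<open>d ^ 3\<close>; connected sets of size at least \<open>K\<close>
  will be seen to meet the union \<open>W\<close> of the components that do not.\<close>

definition "p = (1 + \<epsilon>) / d"
definition "p2 = 1 - (1 - \<delta> / d) ^ 5"
definition "p1 = 1 - (1 - p) / (1 - p2)"
definition "n = card V"
text \<open>The square of the tilting parameter \<open>x = \<epsilon>\<^sup>2 / 50\<close> from the
  count of small subsets, so that the term \<open>c0 / x\<close> of the exponent is again
  \<open>x\<close>.\<close>

definition "c0 = (\<epsilon>\<^sup>2 / 50)\<^sup>2"
definition "s = nat \<lfloor>\<delta> * d\<rfloor>"
definition "K = nat \<lceil>8 * C * d / \<epsilon>\<^sup>2\<rceil>"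
definition "\<tau> = 8 / \<epsilon>\<^sup>2 * exp (- (\<epsilon>\<^sup>2 / 4 * (\<delta> * d - 1)))"
definition "W F = {v \<in> V. d ^ 3 \<le> card (reach F {v})}"

section \<open>Parameters of the rounds and component sizes in the first round\<close>

lemma fin: "finite V" "finite E"
  using graph_on_finite[OF graph] by auto

lemma d0: "0 < real d" using d4 by simp

lemma \<delta>_bounds: "0 < \<delta>" "\<delta> \<le> 1 / 10000000" "\<delta> \<le> \<epsilon> / 100000"
proof -
  have "\<epsilon>\<^sup>2 \<le> 1 / 100 * \<epsilon>" using \<epsilon> mult_right_mono[of \<epsilon> "1 / 100" \<epsilon>] by (simp add: power2_eq_square)
  then show "0 < \<delta>" "\<delta> \<le> 1 / 10000000" "\<delta> \<le> \<epsilon> / 100000" using \<epsilon> by (auto simp: \<delta>)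
qed

lemma p_bounds: "0 \<le> p" "p \<le> 1 / 2" "p * d \<le> 2" "p \<le> 1"
proof -
  have "p \<le> 2 / 4" unfolding p_def using \<epsilon> d4 by (intro frac_le) auto
  then show "p \<le> 1 / 2" "p \<le> 1" by auto
  show "0 \<le> p" "p * d \<le> 2" using \<epsilon> d0 by (auto simp: p_def)
qed

lemma p2_bounds: "0 \<le> p2" "p2 < 1" "p2 \<le> 1" "p2 \<le> 5 * \<delta> / d"
proof -
  have x: "0 < \<delta> / d" "\<delta> / d < 1" using \<delta>_bounds d0 d4 by (auto simp: field_simps)
  have "1 + real 5 * (- (\<delta> / d)) \<le> (1 + - (\<delta> / d)) ^ 5"
    using x by (intro Bernoulli_inequality) auto
  then show "p2 \<le> 5 * \<delta> / d" by (simp add: p2_def)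
  show "0 \<le> p2" using x power_le_one[of "1 - \<delta> / d" 5] by (simp add: p2_def)
  show "p2 < 1" "p2 \<le> 1" using x zero_less_power[of "1 - \<delta> / d" 5] by (auto simp: p2_def)
qed

lemma p_split: "1 - (1 - p1) * (1 - p2) = p"
  using p2_bounds by (simp add: p1_def)

lemma p1_bounds: "(1 + (\<epsilon> - 5 * \<delta>)) / d \<le> p1" "p1 \<le> p" "0 \<le> p1" "p1 \<le> 1" "p1 \<le> 1 / 2" "p1 * d \<le> 2"
proof -
  show p1p: "p1 \<le> p"
  proof -
    have "(1 - p) * (1 - p2) \<le> (1 - p) * 1" using p_bounds p2_bounds by (intro mult_left_mono) auto
    then have "1 - p \<le> (1 - p) / (1 - p2)" using p2_bounds by (simp add: field_simps)
    then show ?thesis by (simp add: p1_def)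
  qed
  then show "p1 \<le> 1" "p1 \<le> 1 / 2" using p_bounds by auto
  have "p1 * d \<le> p * d" using p1p d0 by (intro mult_right_mono) auto
  then show "p1 * d \<le> 2" using p_bounds by linarith
  have ge: "p - p2 \<le> p1"
  proof -
    have "p - p2 = p1 * (1 - p2)" using p_split by (simp add: algebra_simps)
    moreover have "0 \<le> p - p2"
    proof -
      have "5 * \<delta> / d \<le> (1 + \<epsilon>) / d" using \<delta>_bounds \<epsilon> d0 by (intro divide_right_mono) auto
      then show ?thesis using p2_bounds by (simp add: p_def)
    qed
    ultimately have "0 \<le> p1" using p2_bounds by (simp add: zero_le_mult_iff)
    then have "p1 * (1 - p2) \<le> p1 * 1" using p2_bounds by (intro mult_left_mono) auto
    then show ?thesis using \<open>p - p2 = p1 * (1 - p2)\<close> by simp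
  qed
  have "(1 + (\<epsilon> - 5 * \<delta>)) / d = p - 5 * \<delta> / d" by (simp add: p_def add_divide_distrib diff_divide_distrib)
  then show lower: "(1 + (\<epsilon> - 5 * \<delta>)) / d \<le> p1" using ge p2_bounds by linarith
  have "0 \<le> (1 + (\<epsilon> - 5 * \<delta>)) / d" using \<delta>_bounds \<epsilon> d0 by simp
  then show "0 \<le> p1" using lower by linarith
qed

lemma n_pos: "0 < n" "0 < real n"
proof -
  have "0 < exp (d / (2 * C))" by simp
  then have "0 < real n" using size_lower unfolding n_def by linarith
  then show "0 < n" "0 < real n" by auto
qed

lemma deg_le: "v \<in> V \<Longrightarrow> card (nb E v) \<le> d"
  using regular by simp

text \<open>Covers both the whole host graph and the pieces from \<open>split\<close>, so each
  estimate on components is proved once and then applied inside every piece.\<close>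

definition "nearly_closed Y \<longleftrightarrow> Y \<subseteq> V \<and> (\<forall>u\<in>Y. card (nb E u - Y) \<le> \<delta> * d)"

lemma nearly_closed_V: "nearly_closed V"
proof -
  have "card (nb E u - V) = 0" for u
  proof -
    have "nb E u - V = {}" using nb_subset[OF graph] by blast
    then show ?thesis by (simp only: card.empty)
  qed
  then show ?thesis using \<delta>_bounds by (simp add: nearly_closed_def)
qed

lemma nb_inn: "u \<in> Y \<Longrightarrow> nb (inn E Y) u = nb E u \<inter> Y"
  by (auto simp: nb_def inn_def)

text \<open>For \<open>m \<le> d ^ 7\<close> the loss \<open>2 * C\<^sup>2 * ln m\<close> is at most
  \<open>14 * C\<^sup>2 * ln d\<close>, which \<open>small_sets\<close> bounds by
  \<open>\<delta> * d\<close>; neighbours outside \<open>Y\<close> cost another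
  \<open>\<delta> * d\<close> per vertex.\<close>

lemma iso_nearly_closed:
  assumes Y: "nearly_closed Y" and U: "U \<subseteq> Y" "card U = m" "1 \<le> m" "m \<le> d ^ 7"
  shows "(1 - 2 * \<delta>) * d * m \<le> card (bd (inn E Y) U)"
proof -
  have YV: "Y \<subseteq> V" "U \<subseteq> V" using Y U by (auto simp: nearly_closed_def)
  have "real (card (nb E u - U)) \<le> real (card (nb (inn E Y) u - U)) + \<delta> * d" if u: "u \<in> U" for u
  proof -
    have "nb E u - U \<subseteq> (nb (inn E Y) u - U) \<union> (nb E u - Y)" using u U by (auto simp: nb_inn subset_iff)
    then have "card (nb E u - U) \<le> card ((nb (inn E Y) u - U) \<union> (nb E u - Y))"
      using finite_nb[OF graph] finite_nb[OF graph_on_inn[OF graph YV(1)]] by (intro card_mono) auto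
    also have "\<dots> \<le> card (nb (inn E Y) u - U) + card (nb E u - Y)" by (rule card_Un_le)
    finally have "real (card (nb E u - U)) \<le> real (card (nb (inn E Y) u - U)) + real (card (nb E u - Y))"
      by linarith
    moreover have "card (nb E u - Y) \<le> \<delta> * d" using Y u U by (auto simp: nearly_closed_def)
    ultimately show ?thesis by linarith
  qed
  then have "(\<Sum>u\<in>U. real (card (nb E u - U))) \<le> (\<Sum>u\<in>U. real (card (nb (inn E Y) u - U)) + \<delta> * d)"
    by (intro sum_mono)
  then have "real (card (bd E U)) \<le> card (bd (inn E Y) U) + m * (\<delta> * d)"
    using card_bd[OF graph YV(2)] card_bd[OF graph_on_inn[OF graph YV(1)] U(1)] U by (simp add: sum.distrib)
  moreover have "m * (d - \<delta> * d) \<le> card (bd E U)"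
  proof -
    have "ln (real m) \<le> ln (real d ^ 7)" using U(3,4) d0 by (simp flip: of_nat_power)
    then have "ln (real m) \<le> 7 * ln d" using d0 by (simp add: ln_realpow)
    then have "2 * C\<^sup>2 * ln (real m) \<le> 2 * C\<^sup>2 * (7 * ln d)" by (intro mult_left_mono) auto
    also have "\<dots> \<le> \<delta> * d" using small_sets by simp
    finally have "m * (d - \<delta> * d) \<le> m * (d - 2 * C\<^sup>2 * ln m)"
      by (intro mult_left_mono) auto
    also have "\<dots> \<le> card (bd E U)" using iso_small[OF YV(2)] U by simp
    finally show ?thesis .
  qed
  ultimately show ?thesis by (simp add: algebra_simps)
qed

text \<open>The sprinkling probability is a parameter because two values occur: \<open>q = 0\<close>
  for first-round components and \<open>q = p2\<close> for connected sets of the whole random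
  graph.\<close>

lemma confined_sum_le:
  assumes Y: "nearly_closed Y" and m: "1 \<le> m" "m \<le> d ^ 7" and q: "0 \<le> q" "q \<le> p2"
  shows "(\<Sum>U | U \<subseteq> Y \<and> v \<in> U \<and> card U = m. \<Sum>Q | Q \<subseteq> U \<and> real (card Q) \<le> c0 * m.
      expect (inn E Y) p1 (\<lambda>F1. pr (inn E Y) q (\<lambda>F2. conn (F1 \<union> F2) U \<and> (\<forall>e\<in>bd F1 U. e \<inter> Q \<noteq> {}))))
    \<le> exp (- (\<epsilon>\<^sup>2 / 4 * real m))"
proof -
  have YV: "Y \<subseteq> V" using Y by (simp add: nearly_closed_def)
  have "(\<Sum>U | U \<subseteq> Y \<and> v \<in> U \<and> card U = m. \<Sum>Q | Q \<subseteq> U \<and> real (card Q) \<le> c0 * m.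
      expect (inn E Y) p1 (\<lambda>F1. pr (inn E Y) q (\<lambda>F2. conn (F1 \<union> F2) U \<and> (\<forall>e\<in>bd F1 U. e \<inter> Q \<noteq> {}))))
    \<le> exp (m * (ln (1 + \<epsilon>) - (\<epsilon> - 5 * \<delta>) * (1 - 2 * \<delta>) + 4 * c0 + \<epsilon>\<^sup>2 / 50 + c0 / (\<epsilon>\<^sup>2 / 50)))"
  proof (rule sum_pr_conn_confined_boundary[OF graph_on_inn[OF graph YV]])
    show "card (nb (inn E Y) u) \<le> d" if "u \<in> Y" for u
      using card_mono[OF finite_nb[OF graph], of "nb (inn E Y) u" u] regular[of u] that YV
      by (auto simp: nb_inn)
    show "(1 - 2 * \<delta>) * real d * real m \<le> card (bd (inn E Y) U)" if "U \<subseteq> Y" "card U = m" for U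
      using iso_nearly_closed[OF Y that m] by simp
    have "1 - (1 - p1) * (1 - q) \<le> 1 - (1 - p1) * (1 - p2)"
      using q p1_bounds by (simp add: mult_left_mono)
    then show "1 - (1 - p1) * (1 - q) \<le> (1 + \<epsilon>) / d" using p_split by (simp add: p_def)
    show "\<epsilon>\<^sup>2 / 50 \<le> 1" using \<epsilon> power_le_one[of \<epsilon> 2] by simp
    show "0 \<le> \<epsilon> - 5 * \<delta>" using \<delta>_bounds \<epsilon> by simp
  qed (use d4 p1_bounds q p2_bounds \<epsilon> m in \<open>auto simp: c0_def\<close>)
  also have "\<dots> \<le> exp (m * (- (\<epsilon>\<^sup>2 / 4)))"
  proof -
    have "ln (1 + \<epsilon>) - (\<epsilon> - 5 * \<delta>) * (1 - 2 * \<delta>) + 4 * c0 + \<epsilon>\<^sup>2 / 50 + c0 / (\<epsilon>\<^sup>2 / 50) \<le> - (\<epsilon>\<^sup>2 / 4)"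
      unfolding c0_def \<delta> by (rule first_moment_exponent[OF \<epsilon>])
    then show ?thesis by (simp only: exp_le_cancel_iff) (intro mult_left_mono, auto)
  qed
  finally show ?thesis by (simp add: mult.commute)
qed

text \<open>A first-round component is a connected set without open boundary edges, which is the
  case \<open>Q = {}\<close> of the first-moment bound with an empty second round.\<close>

lemma pr_medium_component:
  assumes Y: "nearly_closed Y" and v: "v \<in> Y"
  shows "pr (inn E Y) p1 (\<lambda>F. s \<le> card (reach F {v}) \<and> card (reach F {v}) < d ^ 3) \<le> \<tau>"
proof -
  have YV: "Y \<subseteq> V" using Y by (simp add: nearly_closed_def)
  have gY: "graph_on Y (inn E Y)" by (rule graph_on_inn[OF graph YV])
  note finY = graph_on_finite[OF gY]
  have s1: "1 \<le> s" using \<delta>d by (simp add: s_def le_nat_floor)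
  have d37: "d ^ 3 \<le> d ^ 7" using d4 by (intro power_increasing) auto
  let ?t = "\<lambda>m. pr (inn E Y) p1 (\<lambda>F. card (reach F {v}) = m)"
  have "pr (inn E Y) p1 (\<lambda>F. s \<le> card (reach F {v}) \<and> card (reach F {v}) < d ^ 3)
    \<le> (\<Sum>m=s..d ^ 3. ?t m)"
    using p1_bounds by (intro pr_union_bound) auto
  also have "\<dots> \<le> (\<Sum>m=s..d ^ 3. exp (- (\<epsilon>\<^sup>2 / 4 * real m)))"
  proof (intro sum_mono)
    fix m assume m: "m \<in> {s..d ^ 3}"
    let ?\<U> = "{U. U \<subseteq> Y \<and> v \<in> U \<and> card U = m}"
    let ?g = "\<lambda>U Q. expect (inn E Y) p1 (\<lambda>F1. pr (inn E Y) 0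
      (\<lambda>F2. conn (F1 \<union> F2) U \<and> (\<forall>e\<in>bd F1 U. e \<inter> Q \<noteq> {})))"
    have "?t m \<le> (\<Sum>U\<in>?\<U>. pr (inn E Y) p1 (\<lambda>F1. conn (F1 \<union> {}) U \<and> (\<forall>e\<in>bd F1 U. e \<inter> {} \<noteq> {})))"
    proof (intro pr_union_bound)
      fix F assume F: "F \<subseteq> inn E Y" "card (reach F {v}) = m"
      have "reach F {v} \<subseteq> Y" using v by (intro reach_subset[OF graph_on_subset[OF gY F(1)]]) auto
      then show "\<exists>U\<in>?\<U>. conn (F \<union> {}) U \<and> (\<forall>e\<in>bd F U. e \<inter> {} \<noteq> {})"
        using F(2) conn_comp[of F v] bd_comp[OF graph_on_subset[OF gY F(1)], of "{v}"]
        by (intro bexI[of _ "reach F {v}"]) simp_all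
    qed (use p1_bounds finY in auto)
    also have "\<dots> = (\<Sum>U\<in>?\<U>. ?g U {})"
    proof -
      have "expect A 0 f = f {}" if "finite A" for A :: "'v set set" and f
        using that by (induction A arbitrary: f rule: finite_induct) (simp_all add: expect_insert)
      then show ?thesis using finY by simp
    qed
    also have "\<dots> \<le> (\<Sum>U\<in>?\<U>. \<Sum>Q | Q \<subseteq> U \<and> real (card Q) \<le> c0 * m. ?g U Q)"
    proof (intro sum_mono)
      fix U assume U: "U \<in> ?\<U>"
      have "finite U" using U finY finite_subset by auto
      moreover have "{} \<in> {Q. Q \<subseteq> U \<and> real (card Q) \<le> c0 * m}" by (simp add: c0_def)
      ultimately show "?g U {} \<le> (\<Sum>Q | Q \<subseteq> U \<and> real (card Q) \<le> c0 * m. ?g U Q)"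
        using p1_bounds by (intro member_le_sum[where f = "?g U"] expect_nonneg) auto
    qed
    also have "\<dots> \<le> exp (- (\<epsilon>\<^sup>2 / 4 * real m))"
      using m s1 d37 p2_bounds by (intro confined_sum_le[OF Y]) auto
    finally show "?t m \<le> exp (- (\<epsilon>\<^sup>2 / 4 * real m))" .
  qed
  also have "\<dots> \<le> 2 / (\<epsilon>\<^sup>2 / 4) * exp (- (\<epsilon>\<^sup>2 / 4 * real s))"
    using \<epsilon> power_le_one[of \<epsilon> 2] by (intro sum_exp_tail_le) auto
  also have "\<dots> \<le> \<tau>"
  proof -
    have "\<delta> * d - 1 \<le> real s" unfolding s_def by linarith
    then have "\<epsilon>\<^sup>2 / 4 * (\<delta> * d - 1) \<le> \<epsilon>\<^sup>2 / 4 * real s" by (intro mult_left_mono) auto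
    then show ?thesis unfolding \<tau>_def by (intro mult_mono) auto
  qed
  finally show ?thesis .
qed

text \<open>The extinction inequality of a branching process with mean at least
  \<open>1 + 99 / 100 * \<epsilon>\<close>. Its survival probability is close to
  \<open>2 * \<epsilon>\<close>; the smaller value \<open>19 / 10 * \<epsilon>\<close> leaves a
  slack of order \<open>\<epsilon>\<^sup>2\<close>, which for
  \<open>\<epsilon> \<le> 1 / 100\<close> outweighs the third-order term.\<close>

lemma survival_equation:
  assumes "(1 - 3 * \<delta>) * d \<le> D"
  shows "(1 - p1 + p1 * (1 - 19 / 10 * \<epsilon>)) ^ D \<le> 1 - 19 / 10 * \<epsilon>"
proof -
  let ?x = "19 / 10 * \<epsilon>"
  have x: "0 \<le> ?x" "?x \<le> 1" using \<epsilon> by auto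
  have "1 + 99 / 100 * \<epsilon> \<le> p1 * D"
  proof -
    have "1 + 99 / 100 * \<epsilon> \<le> (1 + (\<epsilon> - 5 * \<delta>)) * (1 - 3 * \<delta>)"
    proof -
      have "\<delta> * \<epsilon> \<le> \<delta> * 1" using \<delta>_bounds \<epsilon> by (intro mult_left_mono) auto
      moreover have "0 \<le> \<delta> * \<delta>" by simp
      moreover have "(1 + (\<epsilon> - 5 * \<delta>)) * (1 - 3 * \<delta>) = 1 + \<epsilon> - 8 * \<delta> - 3 * (\<delta> * \<epsilon>) + 15 * (\<delta> * \<delta>)"
        by (simp add: algebra_simps)
      ultimately show ?thesis using \<delta>_bounds by linarith
    qed
    also have "\<dots> = (1 + (\<epsilon> - 5 * \<delta>)) / d * ((1 - 3 * \<delta>) * d)" using d0 by simp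
    also have "\<dots> \<le> p1 * D"
      using p1_bounds assms \<delta>_bounds by (intro mult_mono) auto
    finally show ?thesis .
  qed
  then have pDx: "(1 + 99 / 100 * \<epsilon>) * ?x \<le> p1 * D * ?x" using x by (intro mult_right_mono) auto
  have "(1 - p1 + p1 * (1 - ?x)) ^ D = (1 - p1 * ?x) ^ D" by (simp add: algebra_simps)
  also have "\<dots> \<le> exp (- (p1 * ?x)) ^ D"
  proof (intro power_mono)
    show "0 \<le> 1 - p1 * ?x" using x p1_bounds mult_le_one[of p1 ?x] by auto
  qed (use exp_ge_add_one_self[of "- (p1 * ?x)"] in simp)
  also have "\<dots> = exp (- (p1 * D * ?x))" by (simp add: exp_of_nat_mult[symmetric] mult_ac)
  also have "\<dots> \<le> exp (- ((1 + 99 / 100 * \<epsilon>) * ?x))" using pDx by simp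
  also have "\<dots> \<le> 1 - ?x"
  proof -
    define y where "y = (1 + 99 / 100 * \<epsilon>) * ?x"
    have y0: "0 \<le> y" unfolding y_def using x \<epsilon> by simp
    have "1 \<le> (1 - ?x) * exp y"
    proof -
      have "1 \<le> (1 - ?x) * (1 + y + y\<^sup>2 / 2)"
      proof -
        have y: "y = ?x + 1881 / 1000 * \<epsilon>\<^sup>2" by (simp add: y_def algebra_simps power2_eq_square)
        have x2: "?x\<^sup>2 = 361 / 100 * \<epsilon>\<^sup>2" by (simp add: power2_eq_square)
        have "?x\<^sup>2 \<le> y\<^sup>2" using y0 x \<epsilon> by (intro power_mono) (auto simp: y)
        then have "1 + ?x + 1881 / 1000 * \<epsilon>\<^sup>2 + 361 / 200 * \<epsilon>\<^sup>2 \<le> 1 + y + y\<^sup>2 / 2"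
          using y x2 by linarith
        then have "(1 - ?x) * (1 + ?x + 3686 / 1000 * \<epsilon>\<^sup>2) \<le> (1 - ?x) * (1 + y + y\<^sup>2 / 2)"
          using x by (intro mult_left_mono) auto
        moreover have "1 \<le> (1 - ?x) * (1 + ?x + 3686 / 1000 * \<epsilon>\<^sup>2)"
        proof -
          have "(1 - ?x) * (1 + ?x + 3686 / 1000 * \<epsilon>\<^sup>2) = 1 + \<epsilon>\<^sup>2 * (76 / 1000 - ?x * (3686 / 1000))"
          proof -
            have "(1 - X) * (1 + X + k * e) = 1 - X\<^sup>2 + e * (k - X * k)" for X k e :: real
              by (simp add: algebra_simps power2_eq_square)
            from this[of ?x "3686 / 1000" "\<epsilon>\<^sup>2"] x2 show ?thesis by (simp add: algebra_simps)
          qed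
          moreover have "0 \<le> \<epsilon>\<^sup>2 * (76 / 1000 - ?x * (3686 / 1000))"
            using \<epsilon> by (intro mult_nonneg_nonneg) auto
          ultimately show ?thesis by linarith
        qed
        ultimately show ?thesis by linarith
      qed
      also have "\<dots> \<le> (1 - ?x) * exp y"
        using exp_lower_Taylor_quadratic[OF y0] x by (intro mult_left_mono) auto
      finally show ?thesis .
    qed
    then show ?thesis unfolding y_def[symmetric] by (simp add: exp_minus field_simps)
  qed
  finally show ?thesis .
qed

lemma pr_small_component:
  assumes Y: "nearly_closed Y" and v: "v \<in> Y"
  shows "pr (inn E Y) p1 (\<lambda>F. card (reach F {v}) < s) \<le> 1 - 19 / 10 * \<epsilon>"
proof -
  have YV: "Y \<subseteq> V" using Y by (simp add: nearly_closed_def)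
  have gY: "graph_on Y (inn E Y)" by (rule graph_on_inn[OF graph YV])
  \<comment> \<open>At least \<open>(1 - \<delta>) * d\<close> neighbours lie in \<open>Y\<close>;
    the reserve \<open>s \<le> \<delta> * d\<close> and rounding up, at most
    \<open>1 \<le> \<delta> * d\<close>, leave \<open>(1 - 3 * \<delta>) * d\<close>.\<close>
  define D where "D = nat \<lceil>(1 - 3 * \<delta>) * d\<rceil>"
  have "pr (inn E Y) p1 (\<lambda>F. card (reach F {v}) < s) \<le> (1 - 19 / 10 * \<epsilon>) ^ card {v}"
  proof (rule pr_reach_small[OF _ _ _ _ survival_equation gY])
    show "(1 - 3 * \<delta>) * d \<le> D" unfolding D_def by linarith
    fix u assume u: "u \<in> Y"
    have "real D \<le> (1 - 3 * \<delta>) * d + 1"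
      unfolding D_def using \<delta>_bounds d0 by (simp add: of_nat_ceiling)
    moreover have "real s \<le> \<delta> * d" unfolding s_def using \<delta>_bounds by (simp add: of_nat_floor)
    moreover have "card (nb (inn E Y) u) = card (nb E u \<inter> Y)" using u by (simp add: nb_inn)
    moreover have "card (nb E u) = card (nb E u \<inter> Y) + card (nb E u - Y)"
      using card_Int_Diff[OF finite_nb[OF graph]] by blast
    moreover have "card (nb E u) = d" using regular u YV by auto
    moreover have "card (nb E u - Y) \<le> \<delta> * d" using Y u by (auto simp: nearly_closed_def)
    ultimately have "real (D + s) \<le> card (nb (inn E Y) u)" using \<delta>d by (simp add: algebra_simps)
    then show "D + s \<le> card (nb (inn E Y) u)" by simp
  qed (use p1_bounds \<epsilon> v in auto)
  then show ?thesis by simp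
qed

lemma pr_big_component:
  assumes Y: "nearly_closed Y" and v: "v \<in> Y"
  shows "\<epsilon> \<le> pr (inn E Y) p1 (\<lambda>F. d ^ 3 \<le> card (reach F {v}))"
proof -
  have finY: "finite (inn E Y)" using fin by (auto simp: inn_def)
  have "pr (inn E Y) p1 (\<lambda>F. \<not> d ^ 3 \<le> card (reach F {v})) \<le>
    pr (inn E Y) p1 (\<lambda>F. card (reach F {v}) < s) +
    pr (inn E Y) p1 (\<lambda>F. s \<le> card (reach F {v}) \<and> card (reach F {v}) < d ^ 3)"
    using p1_bounds by (intro pr_disj_le) auto
  also have "\<dots> \<le> 1 - 19 / 10 * \<epsilon> + \<epsilon> / 2"
    using pr_small_component[OF Y v] pr_medium_component[OF Y v] \<tau>_small unfolding \<tau>_def by linarith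
  finally show ?thesis using pr_not[OF finY, of p1 "\<lambda>F. d ^ 3 \<le> card (reach F {v})"] \<epsilon> by simp
qed

end

text \<open>A new edge affects only the components of its two ends. If such a component was small,
  at most \<open>s\<close> of its vertices change status. This is the bounded difference for the
  Chebyshev estimate.\<close>

lemma small_components_insert:
  fixes s :: nat
  assumes E: "graph_on V E" and F: "F \<subseteq> E" "e \<in> E"
  shows "\<bar>real (card {v \<in> V. card (reach (insert e F) {v}) < s}) - card {v \<in> V. card (reach F {v}) < s}\<bar> \<le> 2 * s"
proof -
  let ?F = "insert e F"
  let ?small = "\<lambda>F. {v \<in> V. card (reach F {v}) < s}"
  have finV: "finite V" using graph_on_finite[OF E] by simp
  obtain x y where e: "e = {x, y}" "x \<in> V" "y \<in> V" using edge_cases[OF E F(2)] by metis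
  have finr: "finite (reach G {v})" if "G \<subseteq> E" "v \<in> V" for G v
    using reach_subset[OF graph_on_subset[OF E that(1)], of "{v}"] that finV finite_subset by blast
  have "?small ?F \<subseteq> ?small F"
  proof
    fix v assume v: "v \<in> ?small ?F"
    then have "card (reach F {v}) \<le> card (reach ?F {v})"
      using finr[of ?F v] F by (intro card_mono reach_mono) auto
    then show "v \<in> ?small F" using v by auto
  qed
  then have 1: "card (?small ?F) \<le> card (?small F)" using finV by (intro card_mono) auto
  define S where "S = (\<lambda>x. if card (reach F {x}) < s then reach F {x} else {})"
  have S: "card (S z) \<le> s" "finite (S z)" if "z \<in> V" for z
    using finr[OF F(1) that] by (auto simp: S_def)
  have "?small F \<subseteq> ?small ?F \<union> (S x \<union> S y)"
  proof
    fix v assume v: "v \<in> ?small F"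
    show "v \<in> ?small ?F \<union> (S x \<union> S y)"
    proof (cases "v \<in> reach F {x} \<or> v \<in> reach F {y}")
      case True
      then show ?thesis using v comp_eq[of v F x] comp_eq[of v F y] by (auto simp: S_def)
    next
      case False
      then have nxy: "x \<notin> reach F {v}" "y \<notin> reach F {v}" using comp_sym by fast+
      have "reach ?F {v} \<subseteq> reach F {v}"
      proof (rule reach_least)
        fix a b assume ab: "a \<in> reach F {v}" "{a, b} \<in> ?F"
        then have "{a, b} \<in> F" using nxy e(1) by (auto simp: doubleton_eq_iff)
        then show "b \<in> reach F {v}" using ab(1) by (rule reach_step[rotated])
      qed simp
      then have "card (reach ?F {v}) \<le> card (reach F {v})"
        using v finr[OF F(1)] by (intro card_mono) auto
      then show ?thesis using v by auto
    qed
  qed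
  then have "card (?small F) \<le> card (?small ?F \<union> (S x \<union> S y))"
    using finV S e by (intro card_mono) auto
  also have "\<dots> \<le> card (?small ?F) + (card (S x) + card (S y))"
    by (meson add_left_mono card_Un_le le_trans)
  finally show ?thesis using 1 S(1)[OF e(2)] S(1)[OF e(3)] by simp
qed

context sprinkled
begin

lemma card_E_le: "real (card E) \<le> real n * d"
proof -
  have "E \<subseteq> (\<Union>v\<in>V. {e \<in> E. v \<in> e})"
  proof
    fix e assume e: "e \<in> E"
    then obtain x y where "e = {x, y}" "x \<in> V" using edge_cases[OF graph] by metis
    then show "e \<in> (\<Union>v\<in>V. {e \<in> E. v \<in> e})" using e by auto
  qed
  then have "card E \<le> card (\<Union>v\<in>V. {e \<in> E. v \<in> e})" using fin by (intro card_mono) auto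
  also have "\<dots> \<le> (\<Sum>v\<in>V. card {e \<in> E. v \<in> e})" using fin by (intro card_UN_le)
  also have "\<dots> = n * d" using regular by (simp add: card_star[OF graph] n_def)
  finally show ?thesis by (simp flip: of_nat_mult)
qed

text \<open>Vertices outside \<open>W\<close> lie in components below \<open>s\<close>, whose number
  concentrates by Chebyshev, or in components between \<open>s\<close> and \<open>d ^ 3\<close>,
  which are so rare that Markov's inequality suffices. Two deviations of
  \<open>\<epsilon> * n / 50\<close> lower \<open>19 / 10\<close> to
  \<open>186 / 100\<close>.\<close>

lemma pr_few_big:
  "pr E p1 (\<lambda>F. real (card (W F)) < 185 / 100 * \<epsilon> * n) \<le> 20000 * (real d)\<^sup>2 / (\<epsilon>\<^sup>2 * n) + 50 * \<tau> / \<epsilon>"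
proof -
  have innV: "inn E V = E" using graph by (auto simp: inn_def graph_on_def)
  define Z where "Z = (\<lambda>F. real (card {v \<in> V. card (reach F {v}) < s}))"
  define M where "M = (\<lambda>F. real (card {v \<in> V. s \<le> card (reach F {v}) \<and> card (reach F {v}) < d ^ 3}))"
  define a where "a = \<epsilon> * n / 50"
  have a0: "0 < a" using \<epsilon> n_pos by (simp add: a_def)
  have card_sum: "real (card {v \<in> V. P v}) = (\<Sum>v\<in>V. of_bool (P v))" for P
    using fin by (simp add: Int_def)
  have EZ: "expect E p1 Z \<le> (1 - 19 / 10 * \<epsilon>) * n"
  proof -
    have "expect E p1 Z = (\<Sum>v\<in>V. pr E p1 (\<lambda>F. card (reach F {v}) < s))"
      unfolding Z_def card_sum by (rule expect_sum)
    also have "\<dots> \<le> (\<Sum>v\<in>V. 1 - 19 / 10 * \<epsilon>)"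
      using pr_small_component[OF nearly_closed_V] innV by (intro sum_mono) simp
    finally show ?thesis by (simp add: n_def mult.commute)
  qed
  have EM: "expect E p1 M \<le> \<tau> * n"
  proof -
    have "expect E p1 M = (\<Sum>v\<in>V. pr E p1 (\<lambda>F. s \<le> card (reach F {v}) \<and> card (reach F {v}) < d ^ 3))"
      unfolding M_def card_sum by (rule expect_sum)
    also have "\<dots> \<le> (\<Sum>v\<in>V. \<tau>)"
      using pr_medium_component[OF nearly_closed_V] innV by (intro sum_mono) simp
    finally show ?thesis by (simp add: n_def mult.commute)
  qed
  have "pr E p1 (\<lambda>F. real (card (W F)) < 185 / 100 * \<epsilon> * n) \<le>
     pr E p1 (\<lambda>F. expect E p1 Z + a \<le> Z F) + pr E p1 (\<lambda>F. a \<le> M F)"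
  proof (rule pr_disj_le)
    fix F assume W: "real (card (W F)) < 185 / 100 * \<epsilon> * n"
    have "real (card V) \<le> Z F + M F + card (W F)"
    proof -
      have "V = {v \<in> V. card (reach F {v}) < s} \<union> {v \<in> V. s \<le> card (reach F {v}) \<and> card (reach F {v}) < d ^ 3} \<union> W F"
        by (auto simp: W_def)
      then have "card V \<le> card {v \<in> V. card (reach F {v}) < s} +
         card {v \<in> V. s \<le> card (reach F {v}) \<and> card (reach F {v}) < d ^ 3} + card (W F)"
        by (metis (no_types, lifting) card_Un_le add_le_mono1 le_trans)
      then show ?thesis by (simp add: Z_def M_def)
    qed
    then have "real n \<le> Z F + M F + card (W F)" by (simp add: n_def)
    then have "(1 - 19 / 10 * \<epsilon>) * n + 2 * a \<le> Z F + M F"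
      using W by (simp add: a_def algebra_simps)
    then show "expect E p1 Z + a \<le> Z F \<or> a \<le> M F" using EZ by linarith
  qed (use p1_bounds in auto)
  also have "pr E p1 (\<lambda>F. expect E p1 Z + a \<le> Z F) \<le> real (card E) * p1 * (2 * real s)\<^sup>2 / a\<^sup>2"
    unfolding Z_def using small_components_insert[OF graph] p1_bounds fin a0
    by (intro pr_chebyshev) auto
  also have "\<dots> \<le> 20000 * (real d)\<^sup>2 / (\<epsilon>\<^sup>2 * n)"
  proof -
    have "real (card E) * p1 \<le> (real n * d) * p1" using card_E_le p1_bounds by (intro mult_right_mono) auto
    also have "\<dots> = real n * (p1 * d)" by simp
    also have "\<dots> \<le> real n * 2" using p1_bounds by (intro mult_left_mono) auto
    finally have 1: "real (card E) * p1 \<le> 2 * real n" by simp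
    have "real s \<le> \<delta> * d" unfolding s_def using \<delta>_bounds by (simp add: of_nat_floor)
    also have "\<dots> \<le> 1 * real d" using \<delta>_bounds by (intro mult_right_mono) auto
    finally have "real s \<le> d" by simp
    then have "(2 * real s)\<^sup>2 \<le> (2 * real d)\<^sup>2" by (intro power_mono) auto
    then have "real (card E) * p1 * (2 * real s)\<^sup>2 / a\<^sup>2 \<le> (2 * real n) * (2 * real d)\<^sup>2 / a\<^sup>2"
      by (intro divide_right_mono mult_mono[OF 1]) auto
    also have "\<dots> = 20000 * (real d)\<^sup>2 / (\<epsilon>\<^sup>2 * n)"
      using n_pos \<epsilon> by (simp add: a_def field_simps power2_eq_square)
    finally show ?thesis .
  qed
  also have "pr E p1 (\<lambda>F. a \<le> M F) \<le> expect E p1 M / a"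
    using p1_bounds a0 by (intro expect_markov) (auto simp: M_def)
  also have "\<dots> \<le> \<tau> * n / a" using EM a0 by (intro divide_right_mono) auto
  also have "\<dots> = 50 * \<tau> / \<epsilon>" using n_pos by (simp add: a_def)
  finally show ?thesis by simp
qed

text \<open>A failure probability of order \<open>exp (- const * d\<^sup>2)\<close> is needed
  against up to \<open>exp (C * d)\<close> vertices. It comes from independence: each of at least
  \<open>\<sigma> * d\<^sup>2\<close> ends \<open>y\<close> starts a large component within its own
  piece \<open>H y\<close> with probability at least \<open>\<epsilon>\<close>, and the pieces share
  no edges.\<close>

lemma pr_few_walks:
  "pr E p1 (\<lambda>F. \<exists>v\<in>V. real (\<Sum>x\<in>nb E v. card (nb E x \<inter> W F)) < \<epsilon> * \<sigma> / 2 * (real d)\<^sup>2)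
    \<le> n * exp (- (\<epsilon> * \<sigma> / 12 * (real d)\<^sup>2))"
proof -
  let ?M = "\<epsilon> * \<sigma> * (real d)\<^sup>2"
  have "pr E p1 (\<lambda>F. real (\<Sum>x\<in>nb E v. card (nb E x \<inter> W F)) < ?M / 2) \<le> exp (- ?M / (12 * 1))"
    if v: "v \<in> V" for v
  proof -
    obtain Y H where Y: "Y \<subseteq> V" "\<sigma> * (real d)\<^sup>2 \<le> card Y"
      and H: "\<And>y. y \<in> Y \<Longrightarrow> y \<in> H y \<and> H y \<subseteq> V \<and> (\<exists>x. x \<in> nb E v \<and> y \<in> nb E x) \<and> (\<forall>u\<in>H y. card (nb E u - H y) \<le> \<delta> * d)"
      and disj: "\<And>y z. y \<in> Y \<Longrightarrow> z \<in> Y \<Longrightarrow> y \<noteq> z \<Longrightarrow> H y \<inter> H z = {}"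
      using split[OF v] by metis
    have finY: "finite Y" using Y fin finite_subset by blast
    define P where "P = (\<lambda>(y :: 'v) F. d ^ 3 \<le> card (reach F {y}))"
    have nc: "nearly_closed (H y)" if "y \<in> Y" for y using H[OF that] by (auto simp: nearly_closed_def)
    have "pr E p1 (\<lambda>F. (\<Sum>y\<in>Y. 1 * of_bool (P y (F \<inter> inn E (H y)))) < ?M / 2) \<le> exp (- ?M / (12 * 1))"
    proof (rule pr_weighted_lower_tail)
      show "inn E (H y) \<inter> inn E (H z) = {}" if "y \<in> Y" "z \<in> Y" "y \<noteq> z" for y z
      proof (rule ccontr)
        assume "\<not> ?thesis"
        then obtain e where e: "e \<in> E" "e \<subseteq> H y" "e \<subseteq> H z" by (auto simp: inn_def)
        then have "e = {}" using disj[OF that] by blast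
        then show False using e graph by (auto simp: graph_on_def)
      qed
      have "?M \<le> \<epsilon> * card Y" using Y \<epsilon> by (simp add: mult.assoc)
      also have "\<dots> = (\<Sum>y\<in>Y. \<epsilon>)" by simp
      also have "\<dots> \<le> (\<Sum>y\<in>Y. 1 * pr E p1 (\<lambda>F. P y (F \<inter> inn E (H y))))"
      proof (intro sum_mono)
        fix y assume y: "y \<in> Y"
        have "E \<inter> inn E (H y) = inn E (H y)" by (auto simp: inn_def)
        then have "pr E p1 (\<lambda>F. P y (F \<inter> inn E (H y))) = pr (inn E (H y)) p1 (P y)"
          using expect_restrict[OF fin(2), where f = "\<lambda>F. of_bool (P y F)" and X = "inn E (H y)"] by simp
        then show "\<epsilon> \<le> 1 * pr E p1 (\<lambda>F. P y (F \<inter> inn E (H y)))"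
          using pr_big_component[OF nc[OF y], of y] H[OF y] by (simp add: P_def)
      qed
      finally show "?M \<le> (\<Sum>y\<in>Y. 1 * pr E p1 (\<lambda>F. P y (F \<inter> inn E (H y))))" .
    qed (use fin finY p1_bounds in auto)
    moreover have "pr E p1 (\<lambda>F. real (\<Sum>x\<in>nb E v. card (nb E x \<inter> W F)) < ?M / 2) \<le>
       pr E p1 (\<lambda>F. (\<Sum>y\<in>Y. 1 * of_bool (P y (F \<inter> inn E (H y)))) < ?M / 2)"
    proof (rule pr_mono)
      fix F assume F: "F \<subseteq> E" and less: "real (\<Sum>x\<in>nb E v. card (nb E x \<inter> W F)) < ?M / 2"
      define Y' where "Y' = {y \<in> Y. P y (F \<inter> inn E (H y))}"
      have "Y' \<subseteq> (\<Union>x\<in>nb E v. nb E x \<inter> W F)"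
      proof
        fix y assume y: "y \<in> Y'"
        then have yY: "y \<in> Y" "y \<in> V" using Y by (auto simp: Y'_def)
        have "card (reach (F \<inter> inn E (H y)) {y}) \<le> card (reach F {y})"
          using reach_subset[OF graph_on_subset[OF graph F], of "{y}"] yY fin
          by (intro card_mono reach_mono) (auto intro: finite_subset)
        then have "y \<in> W F" using y yY by (auto simp: W_def Y'_def P_def)
        then show "y \<in> (\<Union>x\<in>nb E v. nb E x \<inter> W F)" using H[OF yY(1)] by auto
      qed
      then have "card Y' \<le> card (\<Union>x\<in>nb E v. nb E x \<inter> W F)"
        using finite_nb[OF graph] by (intro card_mono) auto
      also have "\<dots> \<le> (\<Sum>x\<in>nb E v. card (nb E x \<inter> W F))" using finite_nb[OF graph] by (intro card_UN_le)
      finally have "real (card Y') \<le> real (\<Sum>x\<in>nb E v. card (nb E x \<inter> W F))" by linarith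
      moreover have "(\<Sum>y\<in>Y. 1 * of_bool (P y (F \<inter> inn E (H y)))) = real (card Y')"
        using finY by (simp add: Y'_def Int_def)
      ultimately show "(\<Sum>y\<in>Y. 1 * of_bool (P y (F \<inter> inn E (H y)))) < ?M / 2" using less by linarith
    qed (use p1_bounds in auto)
    ultimately show ?thesis by linarith
  qed
  then have each: "pr E p1 (\<lambda>F. real (\<Sum>x\<in>nb E v. card (nb E x \<inter> W F)) < \<epsilon> * \<sigma> / 2 * (real d)\<^sup>2)
      \<le> exp (- (\<epsilon> * \<sigma> / 12 * (real d)\<^sup>2))" if "v \<in> V" for v
    using that by simp
  have "pr E p1 (\<lambda>F. \<exists>v\<in>V. real (\<Sum>x\<in>nb E v. card (nb E x \<inter> W F)) < \<epsilon> * \<sigma> / 2 * (real d)\<^sup>2) \<le>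
    (\<Sum>v\<in>V. pr E p1 (\<lambda>F. real (\<Sum>x\<in>nb E v. card (nb E x \<inter> W F)) < \<epsilon> * \<sigma> / 2 * (real d)\<^sup>2))"
    using p1_bounds fin by (intro pr_union_bound) auto
  also have "\<dots> \<le> (\<Sum>v\<in>V. exp (- (\<epsilon> * \<sigma> / 12 * (real d)\<^sup>2)))" using each by (intro sum_mono)
  finally show ?thesis by (simp add: n_def)
qed

text \<open>Cut edges are estimated by the degrees of cut vertices. Up to \<open>3 * ln d\<close>
  per vertex this is affordable, and \<open>heavy\<close> collects the degrees of the exceptional
  vertices in full.\<close>

definition "heavy F = (\<Sum>v\<in>V. if 3 * ln d < card (nb F v) then real (card (nb F v)) else 0)"

text \<open>For \<open>k > a\<close> one has \<open>k \<le> exp (- a) * exp (2 * k)\<close>, and the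
  exponential moment of a degree is at most \<open>exp 16\<close> because
  \<open>p * d \<le> 2\<close>. With \<open>a = 3 * ln d\<close> the expected total is of order
  \<open>n / d ^ 3\<close>, a factor \<open>d\<close> below the threshold.\<close>

lemma pr_heavy: "pr E p (\<lambda>F. n / (real d)\<^sup>2 \<le> heavy F) \<le> exp 16 / d"
proof -
  have each: "expect E p (\<lambda>F. if 3 * ln d < card (nb F v) then real (card (nb F v)) else 0) \<le> exp 16 / d ^ 3"
    if v: "v \<in> V" for v
  proof -
    let ?S = "{e \<in> E. v \<in> e}"
    have "expect E p (\<lambda>F. if 3 * ln d < card (nb F v) then real (card (nb F v)) else 0) \<le>
      expect E p (\<lambda>F. exp (- (3 * ln d)) * exp 2 ^ card (F \<inter> ?S))"
    proof (rule expect_mono[OF p_bounds(1,4)])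
      fix F assume F: "F \<subseteq> E"
      let ?k = "real (card (nb F v))"
      have "F \<inter> ?S = {e \<in> F. v \<in> e}" using F by auto
      then have "card (F \<inter> ?S) = card (nb F v)" using card_star[OF graph_on_subset[OF graph F]] by simp
      then have eq: "exp (- (3 * ln d)) * exp 2 ^ card (F \<inter> ?S) = exp ?k * exp (?k - 3 * ln d)"
        by (simp add: exp_of_nat_mult[symmetric] mult_exp_exp)
      show "(if 3 * ln d < ?k then ?k else 0) \<le> exp (- (3 * ln d)) * exp 2 ^ card (F \<inter> ?S)"
      proof (cases "3 * ln d < ?k")
        case True
        have "?k \<le> exp ?k" using exp_ge_add_one_self[of ?k] by linarith
        then have "?k * 1 \<le> exp ?k * exp (?k - 3 * ln d)"
          using True by (intro mult_mono) auto
        then show ?thesis using True unfolding eq by simp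
      qed simp
    qed
    also have "\<dots> = exp (- (3 * ln d)) * (1 - p + p * exp 2) ^ card (E \<inter> ?S)"
      using fin by (simp add: expect_cmult expect_restrict[OF fin(2), where f = "\<lambda>F. exp 2 ^ card F"] expect_power_card)
    also have "E \<inter> ?S = ?S" by auto
    also have "card ?S = d" using card_star[OF graph] regular v by simp
    also have "(1 - p + p * exp 2) ^ d \<le> exp (p * 8) ^ d"
    proof (intro power_mono)
      have "exp (2 :: real) = exp 1 * exp 1" by (simp add: mult_exp_exp)
      also have "\<dots> \<le> 3 * 3" using exp_le by (intro mult_mono) auto
      finally have "p * exp 2 \<le> p * 9" using p_bounds by (intro mult_left_mono) auto
      then have "1 - p + p * exp 2 \<le> 1 + p * 8" by simp
      also have "\<dots> \<le> exp (p * 8)" by (rule exp_ge_add_one_self)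
      finally show "1 - p + p * exp 2 \<le> exp (p * 8)" .
    qed (use p_bounds in auto)
    also have "exp (p * 8) ^ d \<le> exp 16"
      using p_bounds by (simp add: exp_of_nat_mult[symmetric] algebra_simps)
    also have "exp (- (3 * ln d)) * exp 16 = exp 16 / d ^ 3"
    proof -
      have "exp (3 * ln (real d)) = real d ^ 3" using d0 exp_of_nat_mult[of 3 "ln (real d)"] by simp
      then show ?thesis by (simp add: exp_minus field_simps)
    qed
    finally show ?thesis by simp
  qed
  have "pr E p (\<lambda>F. n / (real d)\<^sup>2 \<le> heavy F) \<le> expect E p heavy / (n / (real d)\<^sup>2)"
    using p_bounds n_pos d0 by (intro expect_markov) (auto simp: heavy_def intro!: sum_nonneg)
  also have "expect E p heavy \<le> (\<Sum>v\<in>V. exp 16 / d ^ 3)"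
    unfolding heavy_def expect_sum using each by (intro sum_mono)
  also have "(\<Sum>v\<in>V. exp 16 / d ^ 3) / (n / (real d)\<^sup>2) = exp 16 / d"
    using n_pos d0 by (simp add: n_def[symmetric] power2_eq_square power3_eq_cube)
  finally show ?thesis using n_pos d0 by (simp add: divide_right_mono)
qed

text \<open>Such a \<open>P\<close>, together with the small first-round components it meets, is connected and has almost
  no first-round boundary edges, which the first-moment bound excludes.\<close>

definition "sparse_piece F1 F2 P \<longleftrightarrow> P \<subseteq> V \<and> conn (F1 \<union> F2) P \<and> K \<le> card P \<and>
  card P \<le> 1 + (d + 1) * K \<and> real (card (P \<inter> W F1)) < c0 * card P"

lemma K_bounds: "8 * C * d / \<epsilon>\<^sup>2 \<le> real K" "1 \<le> K" "K \<le> d\<^sup>2"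
proof -
  have pos: "0 < 8 * C * d / \<epsilon>\<^sup>2" using C d0 \<epsilon> by simp
  show 1: "8 * C * d / \<epsilon>\<^sup>2 \<le> real K" unfolding K_def by linarith
  show "1 \<le> K" using pos 1 by (cases "K = 0") auto
  have "real K \<le> 8 * C * d / \<epsilon>\<^sup>2 + 1" unfolding K_def using pos by linarith
  also have "\<dots> \<le> real (d\<^sup>2)" using K_small by simp
  finally show "K \<le> d\<^sup>2" by linarith
qed

text \<open>\<open>U\<close> adds to \<open>P\<close> the first-round components below
  \<open>d ^ 3\<close> that it meets. A first-round edge leaving \<open>U\<close> cannot start in
  such a component, so it meets \<open>Q = P \<inter> W F1\<close>. The size stays within
  \<open>d ^ 4 * d ^ 3\<close>, the range of \<open>iso_nearly_closed\<close>.\<close>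

lemma sparse_piece_closure:
  assumes F: "F1 \<subseteq> E" "F2 \<subseteq> E" and P: "sparse_piece F1 F2 P"
  shows "\<exists>v\<in>V. \<exists>m\<in>{K..d ^ 7}. \<exists>U\<in>{U. U \<subseteq> V \<and> v \<in> U \<and> card U = m}. \<exists>Q\<in>{Q. Q \<subseteq> U \<and> real (card Q) \<le> c0 * m}.
    conn (F1 \<union> F2) U \<and> (\<forall>e\<in>bd F1 U. e \<inter> Q \<noteq> {})"
proof -
  have P': "P \<subseteq> V" "conn (F1 \<union> F2) P" "K \<le> card P" "card P \<le> 1 + (d + 1) * K" "real (card (P \<inter> W F1)) < c0 * card P"
    using P by (auto simp: sparse_piece_def)
  have finP: "finite P" using P' fin finite_subset by blast
  obtain v where v: "v \<in> P" using P'(3) K_bounds(2) by (cases "P = {}") auto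
  define A where "A = (\<lambda>x. if x \<in> W F1 then {x} else reach F1 {x})"
  define U where "U = (\<Union>x\<in>P. A x)"
  have A_self: "x \<in> A x" for x by (simp add: A_def)
  have PU: "P \<subseteq> U" using A_self by (auto simp: U_def)
  have gF1: "graph_on V F1" by (rule graph_on_subset[OF graph F(1)])
  have UV: "U \<subseteq> V"
    unfolding U_def
  proof (intro UN_least)
    fix x assume "x \<in> P"
    then have "{x} \<subseteq> V" using P'(1) by auto
    then show "A x \<subseteq> V" using reach_subset[OF gF1, of "{x}"] by (simp add: A_def)
  qed
  have finU: "finite U" using UV fin finite_subset by blast
  have connU: "conn (F1 \<union> F2) U"
  proof -
    have "conn (F1 \<union> F2) (\<Union>x\<in>P. P \<union> A x)"
    proof (rule conn_UN[of _ _ _ v], intro conjI)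
      fix x assume x: "x \<in> P"
      have "conn (F1 \<union> F2) (A x)"
        using conn_mono[OF conn_comp[of F1 x], of "F1 \<union> F2"] by (simp add: A_def)
      then show "conn (F1 \<union> F2) (P \<union> A x)" using x A_self[of x] by (intro conn_Un P'(2)) auto
    qed (use v in auto)
    moreover have "(\<Union>x\<in>P. P \<union> A x) = U" using PU v by (auto simp: U_def)
    ultimately show ?thesis by simp
  qed
  have "card U \<le> (\<Sum>x\<in>P. card (A x))" unfolding U_def using finP by (rule card_UN_le)
  also have "\<dots> \<le> (\<Sum>x\<in>P. d ^ 3)"
  proof (intro sum_mono)
    fix x assume x: "x \<in> P"
    show "card (A x) \<le> d ^ 3" using x P'(1) d4 by (auto simp: A_def W_def)
  qed
  also have "\<dots> \<le> (1 + (d + 1) * d\<^sup>2) * d ^ 3"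
  proof -
    have "(d + 1) * K \<le> (d + 1) * d\<^sup>2" using K_bounds(3) by (rule mult_le_mono2)
    then have "card P \<le> 1 + (d + 1) * d\<^sup>2" using P'(4) by linarith
    then show ?thesis by (simp only: sum_constant of_nat_id mult_le_mono1)
  qed
  also have "\<dots> \<le> d ^ 4 * d ^ 3"
  proof (intro mult_le_mono1)
    have "1 \<le> d\<^sup>2" using d4 by simp
    then have "1 + (d + 1) * d\<^sup>2 \<le> (d + 2) * d\<^sup>2" by (simp add: algebra_simps)
    also have "\<dots> \<le> (2 * d) * d\<^sup>2" using d4 by (intro mult_le_mono1) simp
    also have "\<dots> \<le> (d * d) * d\<^sup>2" using d4 by (intro mult_le_mono1) simp
    finally show "1 + (d + 1) * d\<^sup>2 \<le> d ^ 4" by (simp add: power4_eq_xxxx power2_eq_square mult.assoc)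
  qed
  finally have U7: "card U \<le> d ^ 7" by (simp add: power_add[symmetric])
  have UP: "card P \<le> card U" using PU finU by (intro card_mono)
  have bdU: "\<forall>e\<in>bd F1 U. e \<inter> (P \<inter> W F1) \<noteq> {}"
  proof
    fix e assume "e \<in> bd F1 U"
    then obtain a b where e: "e \<in> F1" "e = {a, b}" "a \<in> U" "b \<notin> U" by (auto simp: bd_iff[OF gF1])
    then obtain x where x: "x \<in> P" "a \<in> A x" by (auto simp: U_def)
    show "e \<inter> (P \<inter> W F1) \<noteq> {}"
    proof (cases "x \<in> W F1")
      case True
      then have "a = x" using x by (simp add: A_def)
      then show ?thesis using True x e by auto
    next
      case False
      then have "b \<in> A x" using x e reach_step[of a F1 "{x}" b] by (simp add: A_def)
      then show ?thesis using x e by (auto simp: U_def)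
    qed
  qed
  have "c0 * card P \<le> c0 * card U" using UP by (intro mult_left_mono) (auto simp: c0_def)
  then have "real (card (P \<inter> W F1)) \<le> c0 * card U" using P'(5) by linarith
  then have "P \<inter> W F1 \<in> {Q. Q \<subseteq> U \<and> real (card Q) \<le> c0 * card U}" using PU by blast
  moreover have "U \<in> {U'. U' \<subseteq> V \<and> v \<in> U' \<and> card U' = card U}" using UV PU v by blast
  moreover have "card U \<in> {K..d ^ 7}" using UP P'(3) U7 by simp
  moreover have "v \<in> V" using v P'(1) by blast
  ultimately show ?thesis using connU bdU by (intro bexI conjI)
qed

text \<open>The choice of \<open>v\<close> costs a factor \<open>n \<le> exp (C * d)\<close>. Since
  \<open>\<epsilon>\<^sup>2 / 4 * K \<ge> 2 * (C * d)\<close> by the choice of \<open>K\<close>,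
  half of the exponent remains.\<close>

lemma pr_sparse_piece:
  "expect E p1 (\<lambda>F1. pr E p2 (\<lambda>F2. \<exists>P. sparse_piece F1 F2 P)) \<le> 8 / \<epsilon>\<^sup>2 * exp (- (C * d))"
proof -
  have innV: "inn E V = E" using graph by (auto simp: inn_def graph_on_def)
  let ?\<U> = "\<lambda>v m. {U. U \<subseteq> V \<and> v \<in> U \<and> card U = m}"
  let ?\<Q> = "\<lambda>U m. {Q. Q \<subseteq> U \<and> real (card Q) \<le> c0 * real m}"
  let ?ev = "\<lambda>U Q F1 F2. conn (F1 \<union> F2) U \<and> (\<forall>e\<in>bd F1 U. e \<inter> Q \<noteq> {})"
  have finU: "finite (?\<U> v m)" for v m using fin by auto
  have finQ: "finite (?\<Q> U m)" if "U \<in> ?\<U> v m" for U v m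
  proof -
    have "finite U" using that fin finite_subset[of U V] by blast
    then show ?thesis by simp
  qed
  have "expect E p1 (\<lambda>F1. pr E p2 (\<lambda>F2. \<exists>P. sparse_piece F1 F2 P)) \<le>
    expect E p1 (\<lambda>F1. expect E p2 (\<lambda>F2. \<Sum>v\<in>V. \<Sum>m=K..d ^ 7. \<Sum>U\<in>?\<U> v m. \<Sum>Q\<in>?\<Q> U m. of_bool (?ev U Q F1 F2)))"
  proof (intro expect_mono)
    fix F1 F2 assume F: "F1 \<subseteq> E" "F2 \<subseteq> E"
    show "of_bool (\<exists>P. sparse_piece F1 F2 P) \<le>
      (\<Sum>v\<in>V. \<Sum>m=K..d ^ 7. \<Sum>U\<in>?\<U> v m. \<Sum>Q\<in>?\<Q> U m. of_bool (?ev U Q F1 F2) :: real)"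
    proof (cases "\<exists>P. sparse_piece F1 F2 P")
      case True
      then obtain P where P: "sparse_piece F1 F2 P" by blast
      from sparse_piece_closure[OF F P] obtain v m U Q where *: "v \<in> V" "m \<in> {K..d ^ 7}" "U \<in> ?\<U> v m" "Q \<in> ?\<Q> U m" "?ev U Q F1 F2"
        by (elim bexE) (rule that; assumption)
      have "of_bool True \<le> (\<Sum>Q\<in>?\<Q> U m. of_bool (?ev U Q F1 F2) :: real)"
        using member_le_sum[OF *(4), of "\<lambda>Q. of_bool (?ev U Q F1 F2) :: real"] finQ[OF *(3)] *(5) by simp
      also have "\<dots> \<le> (\<Sum>U\<in>?\<U> v m. \<Sum>Q\<in>?\<Q> U m. of_bool (?ev U Q F1 F2))"
        by (intro member_le_sum[OF *(3), of "\<lambda>U. \<Sum>Q\<in>?\<Q> U m. of_bool (?ev U Q F1 F2)"] sum_nonneg finU) simp_all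
      also have "\<dots> \<le> (\<Sum>m=K..d ^ 7. \<Sum>U\<in>?\<U> v m. \<Sum>Q\<in>?\<Q> U m. of_bool (?ev U Q F1 F2))"
        by (intro member_le_sum[OF *(2), of "\<lambda>m. \<Sum>U\<in>?\<U> v m. \<Sum>Q\<in>?\<Q> U m. of_bool (?ev U Q F1 F2)"] sum_nonneg) simp_all
      also have "\<dots> \<le> (\<Sum>v\<in>V. \<Sum>m=K..d ^ 7. \<Sum>U\<in>?\<U> v m. \<Sum>Q\<in>?\<Q> U m. of_bool (?ev U Q F1 F2))"
        using fin by (intro member_le_sum[OF *(1), of "\<lambda>v. \<Sum>m=K..d ^ 7. \<Sum>U\<in>?\<U> v m. \<Sum>Q\<in>?\<Q> U m. of_bool (?ev U Q F1 F2)"] sum_nonneg) simp_all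
      finally show ?thesis using True by simp
    qed (simp add: sum_nonneg)
  qed (use p1_bounds p2_bounds in auto)
  also have "\<dots> = (\<Sum>v\<in>V. \<Sum>m=K..d ^ 7. \<Sum>U\<in>?\<U> v m. \<Sum>Q\<in>?\<Q> U m. expect E p1 (\<lambda>F1. pr E p2 (?ev U Q F1)))"
    by (simp only: expect_sum)
  also have "\<dots> \<le> (\<Sum>v\<in>V. \<Sum>m=K..d ^ 7. exp (- (\<epsilon>\<^sup>2 / 4 * real m)))"
    using confined_sum_le[OF nearly_closed_V, where q = p2] K_bounds(2) p2_bounds innV
    by (intro sum_mono) simp
  also have "\<dots> \<le> (\<Sum>v\<in>V. 2 / (\<epsilon>\<^sup>2 / 4) * exp (- (\<epsilon>\<^sup>2 / 4 * real K)))"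
    using \<epsilon> power_le_one[of \<epsilon> 2] by (intro sum_mono sum_exp_tail_le) auto
  also have "\<dots> = 8 / \<epsilon>\<^sup>2 * (n * exp (- (\<epsilon>\<^sup>2 / 4 * real K)))" by (simp add: n_def)
  also have "\<dots> \<le> 8 / \<epsilon>\<^sup>2 * exp (- (C * d))"
  proof (intro mult_left_mono)
    have "\<epsilon>\<^sup>2 / 4 * (8 * C * d / \<epsilon>\<^sup>2) \<le> \<epsilon>\<^sup>2 / 4 * real K" using K_bounds(1) by (intro mult_left_mono) auto
    then have "2 * (C * d) \<le> \<epsilon>\<^sup>2 / 4 * real K" using \<epsilon> by simp
    then have "n * exp (- (\<epsilon>\<^sup>2 / 4 * real K)) \<le> exp (C * d) * exp (- (2 * (C * d)))"
      using size_upper by (intro mult_mono) (auto simp: n_def)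
    then show "n * exp (- (\<epsilon>\<^sup>2 / 4 * real K)) \<le> exp (- (C * d))" by (simp add: mult_exp_exp)
  qed simp
  finally show ?thesis .
qed

lemma connected_meets_W:
  assumes F: "F1 \<subseteq> E" "F2 \<subseteq> E" and none: "\<nexists>P. sparse_piece F1 F2 P"
    and T: "T \<subseteq> V" "conn (F1 \<union> F2) T" "K \<le> card T"
  shows "c0 * card T \<le> card (T \<inter> W F1)"
proof (rule connected_dense_from_pieces[OF graph_on_subset[OF graph], of "F1 \<union> F2" d])
  show "card (nb (F1 \<union> F2) v) \<le> d" if "v \<in> V" for v
    using card_mono[OF finite_nb[OF graph] nb_mono[of "F1 \<union> F2" E v]] regular[OF that] F by auto
  show "c0 * real (card P) \<le> card (P \<inter> W F1)"
    if "P \<subseteq> V" "conn (F1 \<union> F2) P" "K \<le> card P" "card P \<le> 1 + (d + 1) * K" for P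
    using none that by (auto simp: sparse_piece_def not_less)
qed (use F K_bounds T in auto)

end

section \<open>Crossing paths for all relevant vertex sets\<close>

text \<open>The constant \<open>\<kappa>\<close> of \<open>pr_no_crossing\<close> times
  \<open>\<beta> / (6 * Ci)\<close>, taken at \<open>\<rho> = \<epsilon> * \<sigma> / 2\<close>,
  \<open>\<beta> = 3 / 10 * \<epsilon>\<close> and \<open>Ci = C\<close>.\<close>

definition crossing_const :: "real \<Rightarrow> real \<Rightarrow> real \<Rightarrow> real \<Rightarrow> real" where
  "crossing_const C \<delta> \<sigma> \<epsilon> =
    \<delta> * (\<delta>\<^sup>2 * (\<epsilon> * \<sigma> / 2) / 128)\<^sup>2 / 6 * (3 / 10 * \<epsilon> / (6 * C))"

text \<open>The three terms ensure, in this order, that the crossing exponent is at least twice the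
  entropy of the codes, that \<open>N\<close> is small enough for the sprinkling step, and that
  \<open>K\<close> times the number of cut edges is at most half of \<open>card S\<close>.\<close>

definition expansion_const :: "real \<Rightarrow> real \<Rightarrow> real \<Rightarrow> real \<Rightarrow> real" where
  "expansion_const C \<delta> \<sigma> \<epsilon> = min (min ((\<epsilon>\<^sup>2 / 50)\<^sup>2 / 2 * crossing_const C \<delta> \<sigma> \<epsilon> / 24)
     ((\<epsilon>\<^sup>2 / 50)\<^sup>2 / 2 * (3 / 10 * \<epsilon> * (\<epsilon> * \<sigma> / 2) / (54 * C)))) (\<epsilon>\<^sup>2 / (72 * C))"

locale expanding = sprinkled V E d C \<delta> \<sigma> \<epsilon>
  for V :: "'v set" and E d C \<delta> \<sigma> \<epsilon> +
  assumes \<sigma>1: "\<sigma> \<le> 1" and ln_d: "1 \<le> ln d"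
    and d_c: "1 \<le> expansion_const C \<delta> \<sigma> \<epsilon> * \<epsilon>\<^sup>2 * d"
    and n_large: "6 * ln d \<le> d / (2 * C)" "(real d) ^ 3 \<le> \<epsilon>\<^sup>2 * exp (d / (2 * C))"
begin

definition "c = expansion_const C \<delta> \<sigma> \<epsilon>"
definition "c1 = c0 / 2"
definition "\<kappa> = crossing_const C \<delta> \<sigma> \<epsilon>"
definition "\<beta> = 3 / 10 * \<epsilon>"
definition "q k = c * real k / (d * ln d)"
definition "r k = 4 * c * real k / d"
definition "L k = 1 + ln (n / real k)"

lemma c_bounds: "0 < c" "24 * c \<le> c1 * \<kappa>" "c \<le> c1 * (\<beta> * (\<epsilon> * \<sigma> / 2) / (54 * C))" "c \<le> \<epsilon>\<^sup>2 / (72 * C)"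
  "0 < c1" "c \<le> 1"
proof -
  have pos: "0 < C" "0 < \<epsilon>" "0 < \<sigma>" "0 < \<delta>" using C \<epsilon> \<sigma> \<delta>_bounds by auto
  then show "0 < c" by (simp add: c_def expansion_const_def crossing_const_def)
  show "0 < c1" using pos by (simp add: c1_def c0_def)
  have "c \<le> c1 * \<kappa> / 24"
    unfolding c_def expansion_const_def c1_def c0_def \<kappa>_def by (intro min.coboundedI1 order_refl)
  then show "24 * c \<le> c1 * \<kappa>" by simp
  show "c \<le> c1 * (\<beta> * (\<epsilon> * \<sigma> / 2) / (54 * C))"
    unfolding c_def expansion_const_def c1_def c0_def \<beta>_def by (auto intro: min.coboundedI1 min.coboundedI2)
  show "c \<le> \<epsilon>\<^sup>2 / (72 * C)"
    unfolding c_def expansion_const_def c1_def c0_def \<beta>_def by (auto intro: min.coboundedI1 min.coboundedI2)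
  also have "\<dots> \<le> 1 / 1" using pos C power_le_one[of \<epsilon> 2] \<epsilon> by (intro frac_le) auto
  finally show "c \<le> 1" by simp
qed

lemma ln_d_pos: "0 < ln (real d)" using ln_d by linarith

lemma ln_d_le: "ln d \<le> d" using ln_le_minus_one[of "real d"] d0 by linarith

lemma inv_c_le: "1 / c \<le> d" "1 / (c * \<epsilon>\<^sup>2) \<le> d"
proof -
  show 2: "1 / (c * \<epsilon>\<^sup>2) \<le> d" using d_c c_bounds \<epsilon> by (simp add: c_def[symmetric] field_simps)
  have "1 / c \<le> 1 / (c * \<epsilon>\<^sup>2)"
    using c_bounds \<epsilon> power_le_one[of \<epsilon> 2] by (intro divide_left_mono) auto
  then show "1 / c \<le> d" using 2 by linarith
qed

lemma dlnd_le: "d * ln d / c \<le> real d ^ 3"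
proof -
  have "d * ln d * (1 / c) \<le> d * real d * d"
    using ln_d_le ln_d inv_c_le c_bounds by (intro mult_mono) auto
  then show ?thesis by (simp add: power3_eq_cube)
qed

lemma n_ge: "exp (d / (2 * C)) \<le> real n" "6 * ln d \<le> ln n" "real d ^ 3 \<le> \<epsilon>\<^sup>2 * n"
proof -
  show 1: "exp (d / (2 * C)) \<le> real n" using size_lower by (simp add: n_def)
  then have "ln (exp (d / (2 * C))) \<le> ln n" by (subst ln_le_cancel_iff) (auto simp: n_pos)
  then show "6 * ln d \<le> ln n" using n_large by simp
  have "\<epsilon>\<^sup>2 * exp (d / (2 * C)) \<le> \<epsilon>\<^sup>2 * n" using 1 by (intro mult_left_mono) auto
  then show "real d ^ 3 \<le> \<epsilon>\<^sup>2 * n" using n_large by linarith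
qed

lemma L_ge: "1 \<le> k \<Longrightarrow> k \<le> n \<Longrightarrow> 1 \<le> L k"
  by (simp add: L_def)

lemma card_subsets_le:
  fixes x :: real
  assumes "0 < x" "x \<le> n"
  shows "real (card {N. N \<subseteq> V \<and> real (card N) \<le> x}) \<le> exp (x * (1 + ln (n / x)))"
proof -
  have "real (card {N. N \<subseteq> V \<and> real (card N) \<le> x}) \<le> (1 + x / n) ^ card V * (x / n) powr (- x)"
    using assms n_pos fin by (intro card_small_subsets) auto
  also have "\<dots> \<le> exp (x / n) ^ n * (x / n) powr (- x)"
    using assms exp_ge_add_one_self[of "x / n"] n_pos unfolding n_def[symmetric]
    by (intro mult_right_mono power_mono) auto
  also have "exp (x / n) ^ n = exp x" using n_pos by (simp add: exp_of_nat_mult[symmetric])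
  also have "(x / n) powr (- x) = exp (x * ln (n / x))"
    using assms n_pos by (simp add: powr_def ln_div algebra_simps)
  finally show ?thesis by (simp add: mult_exp_exp distrib_left)
qed

text \<open>Passing from \<open>k\<close> to \<open>q k\<close> enlarges the logarithm by
  \<open>ln (d * ln d / c) \<le> 3 * ln d\<close>. As \<open>ln d\<close> and \<open>L k\<close> are
  at least \<open>1\<close>, the total is at most \<open>4 * (ln d * L k)\<close>, and the divisor
  \<open>ln d\<close> in \<open>q k\<close> cancels.\<close>

lemma q_entropy:
  assumes k: "1 \<le> k" "k \<le> n"
  shows "q k * (1 + ln (n / q k)) \<le> 4 * c * (k * L k) / d" "0 < q k" "q k \<le> n"
proof -
  have pos: "0 < real k" "0 < real n" "0 < ln d" using k n_pos ln_d by auto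
  show q0: "0 < q k" using c_bounds pos d0 by (simp add: q_def)
  have "c * real k \<le> 1 * n * (d * ln d)"
  proof -
    have "c * real k \<le> 1 * real n" using c_bounds k by (intro mult_mono) auto
    moreover have "real n * 1 \<le> real n * (d * ln d)"
      using mult_mono[of 1 "real d" 1 "ln d"] ln_d d4 by (intro mult_left_mono) auto
    ultimately show ?thesis by linarith
  qed
  then show "q k \<le> n" using d0 pos by (simp add: q_def field_simps)
  have "n / q k = (n / k) * (d * ln d / c)" using pos d0 c_bounds by (simp add: q_def)
  then have "ln (n / q k) = ln (n / k) + ln (d * ln d / c)"
    using pos d0 c_bounds by (simp only:, subst ln_mult) auto
  moreover have "ln (d * ln d / c) \<le> 3 * ln d"
  proof -
    have "ln (d * ln d / c) \<le> ln (real d ^ 3)"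
      using dlnd_le pos d0 c_bounds by (subst ln_le_cancel_iff) auto
    then show ?thesis using d0 by (simp add: ln_realpow)
  qed
  ultimately have "1 + ln (n / q k) \<le> L k + 3 * ln d" by (simp add: L_def)
  also have "\<dots> \<le> 4 * (ln d * L k)"
  proof -
    have "1 * L k \<le> ln d * L k" "ln d * 1 \<le> ln d * L k"
      using ln_d L_ge[OF k] by (intro mult_right_mono mult_left_mono; simp)+
    then show ?thesis by linarith
  qed
  finally have "q k * (1 + ln (n / q k)) \<le> q k * (4 * (ln d * L k))" using q0 by (intro mult_left_mono) auto
  also have "\<dots> = 4 * c * (k * L k) / d" using pos by (simp add: q_def)
  finally show "q k * (1 + ln (n / q k)) \<le> 4 * c * (k * L k) / d" .
qed

text \<open>\<open>k / d ^ 3\<close> will count components with at least \<open>d ^ 3\<close>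
  vertices each; \<open>ln d / d ^ 3 \<le> c / d\<close> makes a list of their representatives as
  cheap as the set \<open>N\<close>.\<close>

lemma x_entropy:
  assumes k: "1 \<le> k" "k \<le> n"
  shows "k / real d ^ 3 * (1 + ln (n / (k / real d ^ 3))) \<le> 4 * c * (k * L k) / d" "k / real d ^ 3 \<le> n"
proof -
  have pos: "0 < real k" "0 < real n" "0 < ln d" using k n_pos ln_d by auto
  have "ln (n / (k / real d ^ 3)) = ln ((n / k) * real d ^ 3)" by simp
  also have "\<dots> = ln (n / k) + 3 * ln d" using pos d0 by (subst ln_mult) (auto simp: ln_realpow)
  finally have "1 + ln (n / (k / real d ^ 3)) = L k + 3 * ln d" by (simp add: L_def)
  also have "\<dots> \<le> 4 * (ln d * L k)"
  proof -
    have "1 * L k \<le> ln d * L k" "ln d * 1 \<le> ln d * L k"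
      using ln_d L_ge[OF k] by (intro mult_right_mono mult_left_mono; simp)+
    then show ?thesis by linarith
  qed
  finally have "k / real d ^ 3 * (1 + ln (n / (k / real d ^ 3))) \<le> k / real d ^ 3 * (4 * (ln d * L k))"
    by (intro mult_left_mono) auto
  also have "\<dots> = 4 * (k * L k) * (ln d / real d ^ 3)" by simp
  also have "\<dots> \<le> 4 * (k * L k) * (c / d)"
  proof (intro mult_left_mono)
    have "ln d * 1 \<le> d * (c * d)" using ln_d_le ln_d inv_c_le(1) c_bounds by (intro mult_mono) (auto simp: field_simps)
    then show "ln d / real d ^ 3 \<le> c / d" using d0 by (simp add: field_simps power3_eq_cube)
  qed (use L_ge[OF k] in auto)
  also have "\<dots> = 4 * c * (k * L k) / d" by (simp add: mult.commute mult.left_commute)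
  finally show "k / real d ^ 3 * (1 + ln (n / (k / real d ^ 3))) \<le> 4 * c * (k * L k) / d" .
  have "real k \<le> n * real d ^ 3"
    using k mult_mono[of "real k" "real n" 1 "real d ^ 3"] one_le_power[of "real d" 3] d4 by simp
  then show "k / real d ^ 3 \<le> n" using d0 by (simp add: field_simps)
qed

text \<open>A union of parts of large first-round components that is separated by \<open>N\<close> is determined by \<open>N\<close>,
  by its vertices next to \<open>N\<close>, and by representatives of the components it contains entirely.\<close>

definition "grown F1 N I X = reach {e \<in> F1. e \<inter> N = {}} (I \<union> X)"

definition "next_to F1 N = {v. \<exists>w\<in>N. {v, w} \<in> F1}"

definition "codes F1 k = {(N, I, X). N \<subseteq> V \<and> real (card N) \<le> q k \<and> X \<subseteq> V \<and> real (card X) \<le> k / real d ^ 3 \<and>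
    (I \<subseteq> V \<and> real (card I) \<le> q k \<or> I \<subseteq> next_to F1 N \<and> real (card (next_to F1 N)) \<le> r k)}"

text \<open>All conjuncts but the last are determined by \<open>F1\<close>. For a fixed first round
  only the last one is random, and it is the event of \<open>pr_no_crossing\<close>.\<close>

definition "separates F1 F2 k = (\<lambda>(N, I, X). let A = grown F1 N I X in
    A \<subseteq> W F1 \<and> c1 * k \<le> card A \<and> card A \<le> k \<and> \<beta> * n \<le> card (W F1 - A) \<and>
    reach {e \<in> F2. e \<inter> N = {}} (A - N) \<inter> (W F1 - A - N) = {})"

lemma finite_next_to: "F1 \<subseteq> E \<Longrightarrow> finite (next_to F1 N)"
proof -
  assume "F1 \<subseteq> E"
  then have "next_to F1 N \<subseteq> (\<Union>w\<in>N. nb E w)" by (auto simp: next_to_def nb_def insert_commute) blast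
  then have "next_to F1 N \<subseteq> V" using nb_subset[OF graph] by blast
  then show ?thesis using fin finite_subset by blast
qed

lemma card_codes:
  assumes F1: "F1 \<subseteq> E" and k: "1 \<le> k" "k \<le> n"
  shows "real (card (codes F1 k)) \<le> 2 * exp (12 * c * (k * L k) / d)" "finite (codes F1 k)"
proof -
  let ?e = "4 * c * (k * L k) / d"
  define Ns where "Ns = {N. N \<subseteq> V \<and> real (card N) \<le> q k}"
  define Xs where "Xs = {X. X \<subseteq> V \<and> real (card X) \<le> k / real d ^ 3}"
  define Is where "Is = (\<lambda>N. Ns \<union> (if real (card (next_to F1 N)) \<le> r k then Pow (next_to F1 N) else {}))"
  have finN: "finite Ns" "finite Xs" using fin by (auto simp: Ns_def Xs_def)
  have finI: "finite (Is N)" for N using finN finite_next_to[OF F1] by (auto simp: Is_def)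
  have Ns: "real (card Ns) \<le> exp ?e"
    using card_subsets_le[of "q k"] q_entropy[OF k] unfolding Ns_def by (meson exp_le_cancel_iff order_trans)
  have "0 < k / real d ^ 3" using k d0 by simp
  then have Xs: "real (card Xs) \<le> exp ?e"
    using card_subsets_le[of "k / real d ^ 3"] x_entropy[OF k] unfolding Xs_def by (meson exp_le_cancel_iff order_trans)
  have Is: "real (card (Is N)) \<le> 2 * exp ?e" for N
  proof -
    have "real (card (if real (card (next_to F1 N)) \<le> r k then Pow (next_to F1 N) else {})) \<le> exp ?e"
    proof (cases "real (card (next_to F1 N)) \<le> r k")
      case True
      have "real (card (Pow (next_to F1 N))) = 2 ^ card (next_to F1 N)"
        using finite_next_to[OF F1] by (simp add: card_Pow)
      also have "\<dots> \<le> exp 1 ^ card (next_to F1 N)" using exp_ge_add_one_self[of 1] by (intro power_mono) auto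
      also have "\<dots> = exp (card (next_to F1 N))" by (simp add: exp_of_nat_mult[symmetric])
      also have "\<dots> \<le> exp (r k)" using True by simp
      also have "\<dots> \<le> exp ?e"
      proof -
        have "4 * c * real k * 1 \<le> 4 * c * real k * L k" using L_ge[OF k] c_bounds by (intro mult_left_mono) auto
        then show ?thesis using d0 by (simp add: r_def divide_right_mono mult.assoc)
      qed
      finally show ?thesis using True by simp
    qed simp
    moreover have "card (Is N) \<le> card Ns + card (if real (card (next_to F1 N)) \<le> r k then Pow (next_to F1 N) else {})"
      unfolding Is_def by (rule card_Un_le)
    ultimately show ?thesis using Ns by linarith
  qed
  have sub: "codes F1 k \<subseteq> (\<lambda>(N, I, X). (N, I, X)) ` (SIGMA N:Ns. Is N \<times> Xs)"
    by (auto simp: codes_def Ns_def Xs_def Is_def image_iff)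
  have finS: "finite (SIGMA N:Ns. Is N \<times> Xs)" using finN finI by auto
  show "finite (codes F1 k)" using sub finS finite_subset by blast
  have "card (codes F1 k) \<le> card ((\<lambda>(N, I, X). (N, I, X)) ` (SIGMA N:Ns. Is N \<times> Xs))"
    using sub finS by (intro card_mono) auto
  also have "\<dots> \<le> card (SIGMA N:Ns. Is N \<times> Xs)" using finS by (rule card_image_le)
  also have "\<dots> = (\<Sum>N\<in>Ns. card (Is N) * card Xs)"
    using finN finI by (simp add: card_SigmaI card_cartesian_product)
  finally have "real (card (codes F1 k)) \<le> real (\<Sum>N\<in>Ns. card (Is N) * card Xs)" by (simp only: of_nat_le_iff)
  also have "\<dots> = (\<Sum>N\<in>Ns. real (card (Is N)) * real (card Xs))" by simp
  also have "\<dots> \<le> (\<Sum>N\<in>Ns. (2 * exp ?e) * exp ?e)" using Is Xs by (intro sum_mono mult_mono) auto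
  also have "\<dots> = real (card Ns) * ((2 * exp ?e) * exp ?e)" by simp
  also have "\<dots> \<le> exp ?e * ((2 * exp ?e) * exp ?e)" using Ns by (intro mult_right_mono) auto
  also have "\<dots> = 2 * exp (12 * c * (k * L k) / d)" by (simp add: mult_exp_exp)
  finally show "real (card (codes F1 k)) \<le> 2 * exp (12 * c * (k * L k) / d)" .
qed

text \<open>The exponent is twice that of the number of codes, so half of it survives the union
  bound. \<open>card A\<close> is known only up to the factor \<open>c1\<close>, but
  \<open>card A \<le> k\<close> gives \<open>1 + ln (n / card A) \<ge> L k\<close>.\<close>

lemma pr_separates:
  assumes F1: "F1 \<subseteq> E" and k: "1 \<le> k" "k \<le> n"
    and walks: "\<And>v. v \<in> V \<Longrightarrow> \<epsilon> * \<sigma> / 2 * (real d)\<^sup>2 \<le> real (\<Sum>x\<in>nb E v. card (nb E x \<inter> W F1))"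
    and z: "z \<in> codes F1 k"
  shows "pr E p2 (\<lambda>F2. separates F1 F2 k z) \<le> 5 * exp (- (24 * c * (k * L k) / d))"
proof -
  obtain N I X where zN: "z = (N, I, X)" by (cases z)
  then have N: "N \<subseteq> V" "real (card N) \<le> q k" using z by (auto simp: codes_def)
  define A where "A = grown F1 N I X"
  show ?thesis
  proof (cases "A \<subseteq> W F1 \<and> c1 * k \<le> card A \<and> card A \<le> k \<and> \<beta> * n \<le> card (W F1 - A)")
    case False
    then have "\<not> separates F1 F2 k z" for F2 by (auto simp: separates_def zN A_def Let_def)
    then show ?thesis using fin by simp
  next
    case True
    then have A: "A \<subseteq> W F1" "c1 * k \<le> card A" "card A \<le> k" "\<beta> * card V \<le> card (W F1 - A)"
      by (auto simp: n_def)
    have a0: "0 < real (card A)"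
    proof -
      have "0 < c1 * k" using c_bounds k by simp
      then show ?thesis using A(2) by linarith
    qed
    have pos: "0 < C" "0 < \<epsilon>" "0 < \<sigma>" "0 < \<delta>" using C \<epsilon> \<sigma> \<delta>_bounds by auto
    have "pr E p2 (\<lambda>F2. separates F1 F2 k z) \<le>
      pr E (1 - (1 - \<delta> / d) ^ 5) (\<lambda>R. reach {e \<in> R. e \<inter> N = {}} (A - N) \<inter> (W F1 - A - N) = {})"
      using p2_bounds unfolding p2_def[symmetric]
      by (intro pr_mono) (auto simp: separates_def zN A_def Let_def)
    also have "\<dots> \<le> 5 * exp (- (\<delta> * (\<delta>\<^sup>2 * (\<epsilon> * \<sigma> / 2) / 128)\<^sup>2 / 6 *
        (\<beta> / (6 * C) * (card A * (1 + ln (card V / card A)))) / d))"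
    proof (rule pr_no_crossing[OF graph deg_le])
      show "1 \<le> d" using d4 by simp
      show "W F1 \<subseteq> V" by (auto simp: W_def)
      show "0 < \<epsilon> * \<sigma> / 2" "\<epsilon> * \<sigma> / 2 \<le> 1" using pos mult_le_one[of \<epsilon> \<sigma>] \<epsilon> \<sigma>1 by auto
      show "\<epsilon> * \<sigma> / 2 * (real d)\<^sup>2 \<le> real (\<Sum>x\<in>nb E v. card (nb E x \<inter> W F1))" if "v \<in> V" for v
        by (rule walks[OF that])
      show "0 < C" by (rule pos)
      show "card U * ln (card V / card U) / C \<le> card (bd E U)" if "U \<subseteq> V" for U by (rule iso_log[OF that])
      show "A \<subseteq> W F1" by (rule A)
      show "A \<noteq> {}" using a0 by auto
      show "0 < \<beta>" "\<beta> \<le> 1" using \<epsilon> by (auto simp: \<beta>_def)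
      show "\<beta> * card V \<le> card (W F1 - A)" by (rule A)
      show "N \<subseteq> V" by (rule N)
      let ?\<theta> = "\<beta> * (\<epsilon> * \<sigma> / 2) / (54 * C)"
      show "card N \<le> ?\<theta> * card A / d"
      proof -
        have "q k \<le> c * k / (real d * 1)"
          unfolding q_def using c_bounds ln_d ln_d_pos d0 by (intro divide_left_mono mult_left_mono) auto
        also have "\<dots> = c * k / d" by simp
        also have "\<dots> \<le> (c1 * ?\<theta>) * k / d"
          using c_bounds(3) by (intro divide_right_mono mult_right_mono) auto
        also have "\<dots> = ?\<theta> * (c1 * k) / d" by simp
        also have "\<dots> \<le> ?\<theta> * card A / d"
          using A(2) pos by (intro divide_right_mono mult_left_mono) (auto simp: \<beta>_def)
        finally show ?thesis using N(2) by linarith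
      qed
    qed (use pos \<delta>_bounds in auto)
    also have "\<dots> \<le> 5 * exp (- (24 * c * (k * L k) / d))"
    proof -
      have "\<delta> * (\<delta>\<^sup>2 * (\<epsilon> * \<sigma> / 2) / 128)\<^sup>2 / 6 * (\<beta> / (6 * C) * (card A * (1 + ln (card V / card A)))) =
        \<kappa> * (card A * (1 + ln (n / card A)))"
        by (simp add: \<kappa>_def crossing_const_def \<beta>_def n_def)
      moreover have "24 * c * (k * L k) \<le> \<kappa> * (card A * (1 + ln (n / card A)))"
      proof -
        have \<kappa>0: "0 \<le> \<kappa>" using pos by (simp add: \<kappa>_def crossing_const_def)
        have "n / real k \<le> n / real (card A)" using A(3) a0 by (intro divide_left_mono) auto
        then have "L k \<le> 1 + ln (n / card A)"
          using k n_pos a0 unfolding L_def by (subst add_le_cancel_left, subst ln_le_cancel_iff) auto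
        then have "(c1 * k) * L k \<le> card A * (1 + ln (n / card A))"
          using A(2) L_ge[OF k] c_bounds by (intro mult_mono) auto
        then have "\<kappa> * ((c1 * k) * L k) \<le> \<kappa> * (card A * (1 + ln (n / card A)))" using \<kappa>0 by (rule mult_left_mono)
        moreover have "24 * c * (k * L k) \<le> (c1 * \<kappa>) * (k * L k)"
          using c_bounds L_ge[OF k] by (intro mult_right_mono) auto
        ultimately show ?thesis by (simp add: mult_ac)
      qed
      ultimately show ?thesis using d0 by (simp add: divide_right_mono)
    qed
    finally show ?thesis .
  qed
qed

text \<open>\<open>k * L k\<close> does not decrease with \<open>k\<close>, by
  \<open>ln x \<le> x - 1\<close>, so the smallest admissible value \<open>k0 = d * ln d / c\<close>
  decides: there \<open>c * k0 / d = ln d \<ge> 1\<close> and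
  \<open>1 + ln (n / k0) \<ge> ln n / 2\<close>. The outcome makes the failure probabilities
  summable over \<open>k \<le> n\<close>.\<close>

lemma kL_large:
  assumes k: "d * ln d / c \<le> real k" "k \<le> n"
  shows "6 * ln n \<le> 12 * c * (k * L k) / d"
proof -
  define k0 where "k0 = d * ln d / c"
  have k00: "0 < k0" using d0 ln_d_pos c_bounds by (simp add: k0_def)
  have kk: "k0 \<le> k" using k by (simp add: k0_def)
  then have kpos: "0 < real k" using k00 by linarith
  have k1: "1 \<le> k" using kpos by simp
  have "ln (k / k0) \<le> k / k0 - 1" using k00 kpos by (intro ln_le_minus_one) auto
  then have 1: "k0 * ln (k / k0) \<le> k - k0" using k00 by (simp add: field_simps)
  have "(k - k0) * 1 \<le> (k - k0) * L k" using kk L_ge[OF k1 k(2)] by (intro mult_left_mono) auto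
  moreover have "k0 * L k = k0 * (1 + ln (n / k0)) - k0 * ln (k / k0)"
    using k00 kpos n_pos by (simp add: L_def ln_div algebra_simps)
  ultimately have "k0 * (1 + ln (n / k0)) \<le> k * L k" using 1 by (simp add: algebra_simps)
  moreover have "ln n / 2 \<le> 1 + ln (n / k0)"
  proof -
    have "ln k0 \<le> ln (real d ^ 3)" using dlnd_le k00 d0 unfolding k0_def by (subst ln_le_cancel_iff) auto
    then have "ln k0 \<le> 3 * ln d" using d0 by (simp add: ln_realpow)
    then show ?thesis using n_ge(2) n_pos k00 by (simp add: ln_div)
  qed
  ultimately have "k0 * (ln n / 2) \<le> k * L k" using mult_left_mono[of "ln n / 2" "1 + ln (n / k0)" k0] k00 by linarith
  then have "12 * c / d * (k0 * (ln n / 2)) \<le> 12 * c / d * (k * L k)"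
    using c_bounds d0 by (intro mult_left_mono) auto
  moreover have "12 * c / d * (k0 * (ln n / 2)) = 6 * (ln d * ln n)" using c_bounds d0 by (simp add: k0_def)
  moreover have "1 * ln n \<le> ln d * ln n" using ln_d n_ge(2) by (intro mult_right_mono) auto
  ultimately show ?thesis by simp
qed

text \<open>The range of \<open>k\<close> is that of \<open>q k \<ge> 1\<close>; below it a single
  cut edge already meets the claimed bound.\<close>

definition "all_cross F1 F2 \<longleftrightarrow> (\<forall>k. d * ln d / c \<le> real k \<and> k \<le> n \<longrightarrow> (\<forall>z\<in>codes F1 k. \<not> separates F1 F2 k z))"

lemma pr_not_all_cross:
  assumes F1: "F1 \<subseteq> E"
    and walks: "\<And>v. v \<in> V \<Longrightarrow> \<epsilon> * \<sigma> / 2 * (real d)\<^sup>2 \<le> real (\<Sum>x\<in>nb E v. card (nb E x \<inter> W F1))"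
  shows "pr E p2 (\<lambda>F2. \<not> all_cross F1 F2) \<le> 10 / n"
proof -
  let ?ks = "{k. d * ln d / c \<le> real k \<and> k \<le> n}"
  have fink: "finite ?ks" by (rule finite_subset[of _ "{..n}"]) auto
  have k1: "1 \<le> k" if "k \<in> ?ks" for k
  proof -
    have "0 < d * ln d / c" using d0 ln_d_pos c_bounds by simp
    then show ?thesis using that by (cases k) auto
  qed
  have "pr E p2 (\<lambda>F2. \<not> all_cross F1 F2) \<le> (\<Sum>k\<in>?ks. pr E p2 (\<lambda>F2. \<exists>z\<in>codes F1 k. separates F1 F2 k z))"
    using p2_bounds fink by (intro pr_union_bound) (auto simp: all_cross_def)
  also have "\<dots> \<le> (\<Sum>k\<in>?ks. 10 / (real n)\<^sup>2)"
  proof (intro sum_mono)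
    fix k assume k: "k \<in> ?ks"
    have kn: "1 \<le> k" "k \<le> n" "d * ln d / c \<le> real k" using k k1[OF k] by auto
    let ?y = "c * (k * L k) / d"
    have "pr E p2 (\<lambda>F2. \<exists>z\<in>codes F1 k. separates F1 F2 k z) \<le> (\<Sum>z\<in>codes F1 k. pr E p2 (\<lambda>F2. separates F1 F2 k z))"
      using p2_bounds card_codes[OF F1 kn(1,2)] by (intro pr_union_bound) auto
    also have "\<dots> \<le> (\<Sum>z\<in>codes F1 k. 5 * exp (- (24 * c * (k * L k) / d)))"
      using pr_separates[OF F1 kn(1,2) walks] by (intro sum_mono)
    also have "\<dots> = real (card (codes F1 k)) * (5 * exp (- (24 * c * (k * L k) / d)))" by simp
    also have "\<dots> \<le> 2 * exp (12 * c * (k * L k) / d) * (5 * exp (- (24 * c * (k * L k) / d)))"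
      using card_codes[OF F1 kn(1,2)] by (intro mult_right_mono) auto
    also have "\<dots> = 10 * exp (- (12 * c * (k * L k) / d))" by (simp add: mult_exp_exp)
    also have "\<dots> \<le> 10 * exp (- (2 * ln n))"
    proof -
      have "0 \<le> ln n" using n_pos by simp
      then show ?thesis using kL_large[OF kn(3,2)] by simp
    qed
    also have "exp (- (2 * ln n)) = 1 / (real n)\<^sup>2"
    proof -
      have "exp (2 * ln (real n)) = (real n)\<^sup>2" using n_pos exp_of_nat_mult[of 2 "ln (real n)"] by simp
      then show ?thesis by (simp add: exp_minus field_simps)
    qed
    finally show "pr E p2 (\<lambda>F2. \<exists>z\<in>codes F1 k. separates F1 F2 k z) \<le> 10 / (real n)\<^sup>2" by simp
  qed
  also have "\<dots> = real (card ?ks) * (10 / (real n)\<^sup>2)" by simp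
  also have "\<dots> \<le> real n * (10 / (real n)\<^sup>2)"
  proof (intro mult_right_mono)
    have "?ks \<subseteq> {1..n}" using k1 by auto
    then have "card ?ks \<le> card {1..n}" by (intro card_mono) auto
    then show "real (card ?ks) \<le> n" by simp
  qed simp
  also have "\<dots> = 10 / n" using n_pos by (simp add: power2_eq_square)
  finally show ?thesis .
qed

end

section \<open>Expansion of the giant component\<close>

definition outer :: "'v set \<Rightarrow> 'v set set \<Rightarrow> 'v set \<Rightarrow> 'v set" where
  "outer V H S = {v \<in> V - S. \<exists>u\<in>S. {u, v} \<in> H}"

lemma card_le_card_edges:
  assumes "finite B" "\<And>x. x \<in> A \<Longrightarrow> \<exists>e\<in>B. x \<in> e" "\<And>e x y. e \<in> B \<Longrightarrow> x \<in> A \<Longrightarrow> y \<in> A \<Longrightarrow> x \<in> e \<Longrightarrow> y \<in> e \<Longrightarrow> x = y"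
  shows "card A \<le> card B"
proof -
  obtain f where f: "\<And>x. x \<in> A \<Longrightarrow> f x \<in> B \<and> x \<in> f x" using assms(2) by metis
  have "inj_on f A" using f assms(3) by (intro inj_onI) metis
  moreover have "f ` A \<subseteq> B" using f by auto
  ultimately show ?thesis using assms(1) by (rule card_inj_on_le)
qed

context expanding
begin

text \<open>Both rounds are now fixed and have the typical properties; the arguments in this context
  are deterministic.\<close>

context
  fixes F1 F2 :: "'v set set" and H :: "'v set set"
  defines "H \<equiv> F1 \<union> F2"
  assumes F: "F1 \<subseteq> E" "F2 \<subseteq> E"
    and big: "185 / 100 * \<epsilon> * n \<le> card (W F1)"
    and light: "heavy H < n / (real d)\<^sup>2"
    and none: "\<nexists>P. sparse_piece F1 F2 P"
    and cross: "all_cross F1 F2"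
begin

lemma H_sub: "H \<subseteq> E" using F by (simp add: H_def)
lemma gH: "graph_on V H" using H_sub graph graph_on_subset by blast
lemma gF1: "graph_on V F1" using F graph graph_on_subset by blast
lemma finH: "finite H" using H_sub fin finite_subset by blast
lemma W_sub: "W F1 \<subseteq> V" by (auto simp: W_def)
lemma finW: "finite (W F1)" using W_sub fin finite_subset by blast

lemma edge_in_V: "{a, b} \<in> E \<Longrightarrow> b \<in> V"
  using nb_subset[OF graph, of a] by (auto simp: nb_def)

lemma bd_unique:
  assumes "e \<in> bd H S"
  shows "x \<in> e \<Longrightarrow> y \<in> e \<Longrightarrow> x \<in> S \<Longrightarrow> y \<in> S \<Longrightarrow> x = y"
    and "x \<in> e \<Longrightarrow> y \<in> e \<Longrightarrow> x \<notin> S \<Longrightarrow> y \<notin> S \<Longrightarrow> x = y"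
proof -
  obtain a b where "e = {a, b}" "a \<in> S" "b \<notin> S" using assms bd_iff[OF gH] by blast
  then show "x \<in> e \<Longrightarrow> y \<in> e \<Longrightarrow> x \<in> S \<Longrightarrow> y \<in> S \<Longrightarrow> x = y"
    "x \<in> e \<Longrightarrow> y \<in> e \<Longrightarrow> x \<notin> S \<Longrightarrow> y \<notin> S \<Longrightarrow> x = y" by auto
qed

lemma fin_bd: "finite (bd H S)" using finH by (auto simp: bd_def)

lemma card_outer_le: "card (outer V H S) \<le> card (bd H S)"
proof (rule card_le_card_edges[OF fin_bd])
  fix x assume "x \<in> outer V H S"
  then obtain u where "u \<in> S" "{u, x} \<in> H" "x \<notin> S" by (auto simp: outer_def)
  then show "\<exists>e\<in>bd H S. x \<in> e" by (intro bexI[of _ "{u, x}"] edge_in_bd) auto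
qed (use bd_unique(2) in \<open>auto simp: outer_def\<close>)

lemma card_next_outer_le: "card (S \<inter> next_to F1 (outer V H S)) \<le> card (bd H S)"
proof (rule card_le_card_edges[OF fin_bd])
  fix x assume "x \<in> S \<inter> next_to F1 (outer V H S)"
  then obtain w where "x \<in> S" "{x, w} \<in> H" "w \<notin> S" by (auto simp: outer_def next_to_def H_def)
  then show "\<exists>e\<in>bd H S. x \<in> e" by (intro bexI[of _ "{x, w}"] edge_in_bd) auto
qed (use bd_unique(1) in auto)

lemma card_bd_le_deg: "card (bd H S) \<le> (\<Sum>w\<in>outer V H S. card (nb H w))"
proof -
  have fin_o: "finite (outer V H S)" using fin by (auto simp: outer_def)
  have "bd H S \<subseteq> (\<Union>w\<in>outer V H S. {e \<in> H. w \<in> e})"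
  proof
    fix e assume "e \<in> bd H S"
    then obtain x y where e: "e \<in> H" "e = {x, y}" "x \<in> S" "y \<notin> S" using bd_iff[OF gH] by blast
    then have "y \<in> outer V H S" using gH by (auto simp: outer_def graph_on_def)
    then show "e \<in> (\<Union>w\<in>outer V H S. {e \<in> H. w \<in> e})" using e by blast
  qed
  then have "card (bd H S) \<le> card (\<Union>w\<in>outer V H S. {e \<in> H. w \<in> e})"
    using finH fin_o by (intro card_mono) auto
  also have "\<dots> \<le> (\<Sum>w\<in>outer V H S. card {e \<in> H. w \<in> e})" using fin_o by (rule card_UN_le)
  also have "\<dots> = (\<Sum>w\<in>outer V H S. card (nb H w))" by (simp add: card_star[OF gH])
  finally show ?thesis .
qed

lemma card_next_le_deg: "N \<subseteq> V \<Longrightarrow> card (next_to F1 N) \<le> (\<Sum>w\<in>N. card (nb H w))"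
proof -
  assume N: "N \<subseteq> V"
  then have finN: "finite N" using fin finite_subset by blast
  have "next_to F1 N \<subseteq> (\<Union>w\<in>N. nb H w)" by (auto simp: next_to_def nb_def H_def insert_commute)
  then have "card (next_to F1 N) \<le> card (\<Union>w\<in>N. nb H w)"
    using finN finite_nb[OF gH] by (intro card_mono) auto
  also have "\<dots> \<le> (\<Sum>w\<in>N. card (nb H w))" using finN by (rule card_UN_le)
  finally show ?thesis .
qed

lemma deg_sum_le:
  assumes "N \<subseteq> V"
  shows "real (\<Sum>w\<in>N. card (nb H w)) \<le> 3 * ln d * card N + n / (real d)\<^sup>2"
proof -
  let ?h = "\<lambda>v. if 3 * ln d < card (nb H v) then real (card (nb H v)) else 0"
  have "real (\<Sum>w\<in>N. card (nb H w)) \<le> (\<Sum>w\<in>N. 3 * ln d + ?h w)"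
    unfolding of_nat_sum using ln_d_pos by (intro sum_mono) auto
  also have "\<dots> = 3 * ln d * card N + (\<Sum>w\<in>N. ?h w)" by (simp add: sum.distrib)
  also have "(\<Sum>w\<in>N. ?h w) \<le> heavy H" unfolding heavy_def using assms fin by (intro sum_mono2) auto
  finally show ?thesis using light by linarith
qed

lemma W_closed: "v \<in> W F1 \<Longrightarrow> u \<in> reach F1 {v} \<Longrightarrow> u \<in> W F1"
  using comp_eq[of u F1 v] reach_subset[OF gF1, of "{v}"] by (auto simp: W_def)

text \<open>\<open>S \<inter> W F1\<close> is regrown off \<open>N\<close> from its vertices next to
  \<open>N\<close> and from one representative of each first-round component that it contains, so it
  has a code. Every edge of \<open>H\<close> leaving \<open>S\<close> ends in \<open>N\<close>;
  hence no second-round path off \<open>N\<close> leads to \<open>W F1 - S\<close>, against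
  \<open>cross\<close>.\<close>

lemma no_separation:
  assumes S: "S \<subseteq> V" and k: "d * ln d / c \<le> real k" "k \<le> n"
    and out: "card (outer V H S) \<le> q k"
    and I: "real (card (bd H S)) \<le> q k \<or> real (card (next_to F1 (outer V H S))) \<le> r k"
    and A: "c1 * k \<le> card (S \<inter> W F1)" "card (S \<inter> W F1) \<le> k" and rest: "\<beta> * n \<le> card (W F1 - S)"
  shows False
proof -
  define N where "N = outer V H S"
  define A where "A = S \<inter> W F1"
  define I where "I = A \<inter> next_to F1 N"
  define \<C> where "\<C> = {reach F1 {v} | v. v \<in> A \<and> reach F1 {v} \<subseteq> A}"
  define rep where "rep = (\<lambda>D :: 'v set. SOME x. x \<in> D)"
  let ?F = "{e \<in> F1. e \<inter> N = {}}"
  have finA: "finite A" using finW by (auto simp: A_def)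
  have AN: "A \<inter> N = {}" by (auto simp: A_def N_def outer_def)
  have rep: "rep D \<in> D" if D: "D \<in> \<C>" for D
  proof -
    obtain v where "D = reach F1 {v}" using D by (auto simp: \<C>_def)
    then have "\<exists>x. x \<in> D" using self_in_comp[of v F1] by blast
    then show ?thesis unfolding rep_def by (rule someI_ex)
  qed
  have C_sub: "D \<subseteq> A" if "D \<in> \<C>" for D using that by (auto simp: \<C>_def)
  have "\<C> \<subseteq> Pow A" using C_sub by blast
  then have finC: "finite \<C>" using finA finite_subset by blast
  have inside: "b \<in> A" if "a \<in> A" "{a, b} \<in> F1" "b \<notin> N" for a b
  proof -
    have "b \<in> V" using gF1 that(2) by (auto simp: graph_on_def)
    moreover have "b \<in> W F1" using that reach_step[of a F1 "{a}" b] W_closed[of a b] by (auto simp: A_def)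
    ultimately show ?thesis using that by (auto simp: A_def N_def outer_def H_def)
  qed
  have cardX: "real (card (rep ` \<C>)) \<le> k / real d ^ 3"
  proof -
    have "card \<C> * d ^ 3 = (\<Sum>D\<in>\<C>. d ^ 3)" by simp
    also have "\<dots> \<le> (\<Sum>D\<in>\<C>. card D)"
      by (intro sum_mono) (auto simp: \<C>_def A_def W_def)
    also have "\<dots> = card (\<Union>\<C>)"
    proof (rule card_Union_disjoint[symmetric])
      show "pairwise disjnt \<C>"
      proof (rule pairwiseI)
        fix D D' assume D: "D \<in> \<C>" "D' \<in> \<C>" "D \<noteq> D'"
        then obtain v v' where v: "D = reach F1 {v}" "D' = reach F1 {v'}" by (auto simp: \<C>_def)
        show "disjnt D D'"
          unfolding disjnt_def using comp_eq[of _ F1 v] comp_eq[of _ F1 v'] D(3) v by blast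
      qed
      show "finite D" if "D \<in> \<C>" for D using C_sub[OF that] finA finite_subset by blast
    qed
    also have "\<dots> \<le> card A" using C_sub finA by (intro card_mono) auto
    also have "\<dots> \<le> k" using A(2) by (simp add: A_def)
    finally have "card \<C> * d ^ 3 \<le> k" .
    then have "card (rep ` \<C>) * d ^ 3 \<le> k" using card_image_le[OF finC, of rep] by (meson le_trans mult_le_mono1)
    then have "real (card (rep ` \<C>) * d ^ 3) \<le> real k" by (simp only: of_nat_le_iff)
    then show ?thesis using d0 by (simp add: field_simps)
  qed
  have A_eq: "grown F1 N I (rep ` \<C>) = A"
  proof
    show "grown F1 N I (rep ` \<C>) \<subseteq> A"
      unfolding grown_def
    proof (rule reach_least)
      show "I \<union> rep ` \<C> \<subseteq> A" using rep C_sub by (auto simp: I_def)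
      fix a b assume "a \<in> A" "{a, b} \<in> ?F"
      then show "b \<in> A" using inside[of a b] by auto
    qed
    show "A \<subseteq> grown F1 N I (rep ` \<C>)"
    proof
      fix v assume v: "v \<in> A"
      let ?D = "reach ?F {v}"
      have DA: "?D \<subseteq> A"
      proof (rule reach_least)
        fix a b assume "a \<in> A" "{a, b} \<in> ?F"
        then show "b \<in> A" using inside[of a b] by auto
      qed (use v in auto)
      \<comment> \<open>Either the part of the component reachable off \<open>N\<close> contains a
        vertex next to \<open>N\<close>, or it is an entire first-round component and contains its
        representative.\<close>
      have "\<exists>x\<in>?D. x \<in> I \<union> rep ` \<C>"
      proof (cases "?D \<inter> I = {}")
        case True
        have "reach F1 {v} \<subseteq> ?D"
        proof (rule reach_least)
          fix a b assume ab: "a \<in> ?D" "{a, b} \<in> F1"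
          then have a: "a \<in> A" "a \<notin> I" using DA True by auto
          have "b \<notin> N"
          proof
            assume "b \<in> N"
            then have "a \<in> next_to F1 N" using ab(2) by (auto simp: next_to_def)
            then show False using a by (simp add: I_def)
          qed
          moreover have "a \<notin> N" using a(1) AN by blast
          ultimately have "{a, b} \<in> ?F" using ab(2) by simp
          then show "b \<in> ?D" using ab(1) by (rule reach_step[rotated])
        qed simp
        then have "reach F1 {v} \<in> \<C>" using DA v by (auto simp: \<C>_def)
        then show ?thesis using rep[of "reach F1 {v}"] \<open>reach F1 {v} \<subseteq> ?D\<close> by blast
      qed blast
      then obtain x where x: "x \<in> ?D" "x \<in> I \<union> rep ` \<C>" by blast
      then have "v \<in> reach ?F {x}" using comp_sym by fast
      then show "v \<in> grown F1 N I (rep ` \<C>)"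
        unfolding grown_def using reach_mono[of ?F ?F "{x}" "I \<union> rep ` \<C>"] x(2) by blast
    qed
  qed
  have "(N, I, rep ` \<C>) \<in> codes F1 k"
  proof -
    have "I \<subseteq> V" "rep ` \<C> \<subseteq> V" "N \<subseteq> V"
      using S rep C_sub by (auto simp: I_def A_def N_def outer_def)
    moreover have "real (card I) \<le> q k \<or> I \<subseteq> next_to F1 N \<and> real (card (next_to F1 N)) \<le> r k"
      using I
    proof
      assume bd: "real (card (bd H S)) \<le> q k"
      have "card I \<le> card (S \<inter> next_to F1 N)"
        using finite_next_to[OF F(1)] by (intro card_mono) (auto simp: I_def A_def)
      also have "\<dots> \<le> card (bd H S)" unfolding N_def by (rule card_next_outer_le)
      finally show ?thesis using bd by linarith
    qed (auto simp: I_def N_def)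
    ultimately show ?thesis using out cardX by (auto simp: codes_def N_def)
  qed
  moreover have "separates F1 F2 k (N, I, rep ` \<C>)"
  proof -
    have "reach {e \<in> F2. e \<inter> N = {}} (A - N) \<subseteq> S"
    proof (rule reach_least)
      fix a b assume ab: "a \<in> S" "{a, b} \<in> {e \<in> F2. e \<inter> N = {}}"
      then have "{a, b} \<in> E" using F(2) by blast
      from edge_in_V[OF this] have "b \<in> V" .
      moreover have "b \<notin> N" using ab(2) by blast
      moreover have "{a, b} \<in> H" using ab(2) by (simp add: H_def)
      ultimately show "b \<in> S" using ab(1) unfolding N_def outer_def by blast
    qed (simp add: A_def le_infI1 subset_iff)
    moreover have "W F1 - A - N \<subseteq> - S" "W F1 - A = W F1 - S" by (auto simp: A_def)
    ultimately have "reach {e \<in> F2. e \<inter> N = {}} (A - N) \<inter> (W F1 - A - N) = {}" "W F1 - A = W F1 - S" by blast+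
    then show ?thesis using A rest A_eq by (auto simp: separates_def A_def)
  qed
  ultimately show False using cross k by (auto simp: all_cross_def)
qed

lemma k0_le: "d * ln d / c \<le> \<beta> * n" "d * ln d / c \<le> \<epsilon>\<^sup>2 * n"
proof -
  show 1: "d * ln d / c \<le> \<epsilon>\<^sup>2 * n" using dlnd_le n_ge(3) by linarith
  have "\<epsilon>\<^sup>2 \<le> \<beta>" using \<epsilon> mult_right_mono[of \<epsilon> "1 / 100" \<epsilon>] by (simp add: \<beta>_def power2_eq_square)
  then have "\<epsilon>\<^sup>2 * n \<le> \<beta> * n" by (intro mult_right_mono) auto
  then show "d * ln d / c \<le> \<beta> * n" using 1 by linarith
qed

text \<open>A set without cut edges has empty outer boundary, so \<open>no_separation\<close>
  applies with empty \<open>N\<close> and \<open>k = card (S \<inter> W F1)\<close>.\<close>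

lemma closed_split:
  assumes S: "S \<subseteq> V" "bd H S = {}" "\<beta> * n \<le> card (S \<inter> W F1)"
  shows "card (W F1 - S) < \<beta> * n"
proof (rule ccontr)
  assume "\<not> ?thesis"
  let ?k = "card (S \<inter> W F1)"
  have "card (outer V H S) = 0" using card_outer_le[of S] S(2) by simp
  moreover have "?k \<le> n" unfolding n_def using fin S by (intro card_mono) auto
  moreover have "0 \<le> q ?k" using c_bounds ln_d_pos by (simp add: q_def)
  moreover have "c1 * ?k \<le> 1 * real ?k"
  proof (intro mult_right_mono)
    have "\<epsilon>\<^sup>2 / 50 \<le> 1" using \<epsilon> power_le_one[of \<epsilon> 2] by simp
    then show "c1 \<le> 1" using power_le_one[of "\<epsilon>\<^sup>2 / 50" 2] by (simp add: c1_def c0_def)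
  qed simp
  ultimately show False
    using no_separation[OF S(1), of ?k] S k0_le(1) \<open>\<not> card (W F1 - S) < \<beta> * n\<close> by simp
qed

text \<open>To a closed set with the most vertices of \<open>W\<close> below
  \<open>\<beta> * n\<close> a further component \<open>D\<close> is added. The union passes
  \<open>\<beta> * n\<close>, so it misses less than \<open>\<beta> * n\<close> of \<open>W\<close>,
  and \<open>D\<close> keeps more than \<open>(185 - 30 - 30) / 100 * \<epsilon> * n\<close>.
  Applied to \<open>D\<close> alone, \<open>closed_split\<close> improves this to more than
  \<open>155 / 100 * \<epsilon> * n\<close>.\<close>

lemma giant: "\<exists>u\<in>V. 3 / 2 * \<epsilon> * n < card (reach H {u})"
proof -
  have wn: "real (card (W F1)) = card (S \<inter> W F1) + card (W F1 - S)" for S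
    using card_Int_Diff[OF finW, of S] by (simp add: Int_commute)
  have eps: "0 < \<epsilon> * n" using \<epsilon> n_pos by simp
  let ?\<S> = "{S. S \<subseteq> V \<and> bd H S = {} \<and> real (card (S \<inter> W F1)) < \<beta> * n}"
  have fS: "finite ?\<S>" using fin by auto
  have "bd H {} = {}" by (simp add: bd_def)
  then have "{} \<in> ?\<S>" using eps by (simp add: \<beta>_def)
  then have "?\<S> \<noteq> {}" by blast
  obtain S where S: "S \<in> ?\<S>" "\<And>T. T \<in> ?\<S> \<Longrightarrow> real (card (T \<inter> W F1)) \<le> real (card (S \<inter> W F1))"
    by (rule finite_max_witness[OF fS \<open>?\<S> \<noteq> {}\<close>, of "\<lambda>T. real (card (T \<inter> W F1))"]) blast
  have "0 < card (W F1 - S)"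
  proof -
    have "\<beta> * n \<le> 185 / 100 * \<epsilon> * n" using eps by (simp add: \<beta>_def)
    then show ?thesis using wn[of S] S(1) big by (cases "card (W F1 - S) = 0") auto
  qed
  then obtain v where v: "v \<in> W F1" "v \<notin> S" by (metis Diff_eq_empty_iff card.empty less_irrefl subsetI)
  define D where "D = reach H {v}"
  have vV: "v \<in> V" using v W_sub by auto
  have DV: "D \<subseteq> V" unfolding D_def using vV by (intro reach_subset[OF gH]) auto
  have bdD: "bd H D = {}" unfolding D_def by (rule bd_comp[OF gH])
  have SD: "S \<union> D \<subseteq> V" "bd H (S \<union> D) = {}" using S(1) DV bdD by (auto simp: bd_def)
  have gt: "\<beta> * n \<le> card ((S \<union> D) \<inter> W F1)"
  proof (rule ccontr)
    assume "\<not> ?thesis"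
    then have "real (card ((S \<union> D) \<inter> W F1)) \<le> real (card (S \<inter> W F1))" using SD by (intro S(2)) auto
    moreover have "card (S \<inter> W F1) < card ((S \<union> D) \<inter> W F1)"
    proof (rule psubset_card_mono)
      have "v \<in> D" by (simp add: D_def)
      then show "S \<inter> W F1 \<subset> (S \<union> D) \<inter> W F1" using v by blast
    qed (use finW in simp)
    ultimately show False by simp
  qed
  have "real (card ((S \<union> D) \<inter> W F1)) \<le> card (S \<inter> W F1) + card (D \<inter> W F1)"
    using card_Un_le[of "S \<inter> W F1" "D \<inter> W F1"] by (simp add: Int_Un_distrib2 flip: of_nat_add)
  moreover have "card (W F1 - (S \<union> D)) < \<beta> * n" by (rule closed_split[OF SD gt])
  ultimately have "\<beta> * n \<le> card (D \<inter> W F1)"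
    using wn[of "S \<union> D"] S(1) big eps by (simp add: \<beta>_def)
  then have "card (W F1 - D) < \<beta> * n" by (rule closed_split[OF DV bdD])
  moreover have "card (D \<inter> W F1) \<le> card D" using DV fin finite_subset by (intro card_mono) auto
  ultimately have "3 / 2 * \<epsilon> * n < card D" using wn[of D] big eps by (simp add: \<beta>_def)
  then show ?thesis using vV by (auto simp: D_def)
qed

text \<open>As \<open>S\<close> is a proper part of a component, each component of the graph induced
  on \<open>S\<close> has a cut edge, and different ones have different cut edges. So those smaller
  than \<open>K\<close> cover at most half of \<open>S\<close>; the others have a proportion
  \<open>c0\<close> in \<open>W\<close>, whence \<open>c1 = c0 / 2\<close>.\<close>

lemma meets_W:
  assumes u: "u \<in> V" and S: "S \<subseteq> reach H {u}" "S \<noteq> reach H {u}"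
    and few: "real K * card (bd H S) \<le> card S / 2"
  shows "c1 * card S \<le> card (S \<inter> W F1)"
proof -
  have SV: "S \<subseteq> V" using S reach_subset[OF gH, of "{u}"] u by auto
  have finS: "finite S" using SV fin finite_subset by blast
  define \<D> where "\<D> = {reach (inn H S) {v} | v. v \<in> S}"
  have D_sub: "D \<subseteq> S" if D: "D \<in> \<D>" for D
  proof -
    obtain v where v: "v \<in> S" "D = reach (inn H S) {v}" using D by (auto simp: \<D>_def)
    show ?thesis unfolding v(2) using v(1) by (intro reach_least) (auto simp: inn_def)
  qed
  have "\<D> \<subseteq> Pow S" using D_sub by blast
  then have finD: "finite \<D>" using finS finite_subset by blast
  have pw: "D = D'" if D: "D \<in> \<D>" "D' \<in> \<D>" and x: "x \<in> D" "x \<in> D'" for D D' x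
  proof -
    obtain v v' where "D = reach (inn H S) {v}" "D' = reach (inn H S) {v'}" using D by (auto simp: \<D>_def)
    then show ?thesis using comp_eq[of x "inn H S" v] comp_eq[of x "inn H S" v'] x by simp
  qed
  have S_un: "S = \<Union>\<D>"
  proof
    show "S \<subseteq> \<Union>\<D>"
    proof
      fix v assume "v \<in> S"
      then have "reach (inn H S) {v} \<in> \<D>" by (auto simp: \<D>_def)
      then show "v \<in> \<Union>\<D>" using self_in_comp[of v "inn H S"] by blast
    qed
  qed (use D_sub in auto)
  have card_S: "card (S \<inter> X) = (\<Sum>D\<in>\<D>. card (D \<inter> X))" for X
  proof -
    have "S \<inter> X = (\<Union>D\<in>\<D>. D \<inter> X)" using S_un by blast
    also have "card \<dots> = (\<Sum>D\<in>\<D>. card (D \<inter> X))"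
      using finD D_sub finS pw by (intro card_UN_disjoint) (blast intro: finite_subset)+
    finally show ?thesis .
  qed
  have "card \<D> \<le> card (bd H S)"
  proof -
    have ex: "\<exists>e\<in>bd H S. e \<inter> D \<noteq> {}" if D: "D \<in> \<D>" for D
    proof -
      obtain v where v: "v \<in> S" "D = reach (inn H S) {v}" using D by (auto simp: \<D>_def)
      have "v \<in> D" unfolding v(2) by simp
      then have "D \<subseteq> reach H {u}" "D \<noteq> {}" "D \<noteq> reach H {u}"
        using D_sub[OF D] S by blast+
      then obtain x y where xy: "x \<in> D" "y \<in> reach H {u} - D" "{x, y} \<in> H"
        using conn_comp[of H u] unfolding conn_def by meson
      have "y \<notin> S"
      proof
        assume "y \<in> S"
        then have "{x, y} \<in> inn H S" using xy D_sub[OF D] by (auto simp: inn_def)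
        then have "y \<in> D" using xy(1) unfolding v(2) by (rule reach_step[rotated])
        then show False using xy by auto
      qed
      then show ?thesis using xy D_sub[OF D] by (intro bexI[of _ "{x, y}"] edge_in_bd) auto
    qed
    then obtain f where f: "\<And>D. D \<in> \<D> \<Longrightarrow> f D \<in> bd H S \<and> f D \<inter> D \<noteq> {}" by metis
    have "inj_on f \<D>"
    proof (rule inj_onI)
      fix D D' assume D: "D \<in> \<D>" "D' \<in> \<D>" "f D = f D'"
      then obtain x x' where x: "x \<in> f D" "x \<in> D" "x' \<in> f D" "x' \<in> D'" using f by blast
      then have "x = x'" using bd_unique(1)[of "f D" S x x'] f[OF D(1)] D_sub D by blast
      then show "D = D'" using pw D x by blast
    qed
    moreover have "f ` \<D> \<subseteq> bd H S" using f by auto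
    ultimately show ?thesis using fin_bd by (rule card_inj_on_le)
  qed
  then have "real K * card \<D> \<le> real K * card (bd H S)" by (intro mult_left_mono) auto
  then have KD: "real K * card \<D> \<le> card S / 2" using few by linarith
  have each: "c0 * card D \<le> c0 * K + card (D \<inter> W F1)" if D: "D \<in> \<D>" for D
  proof (cases "K \<le> card D")
    case True
    have "conn (F1 \<union> F2) D"
      using D conn_mono[OF conn_comp[of "inn H S"], where F' = H] by (auto simp: \<D>_def inn_def H_def)
    then have "c0 * card D \<le> card (D \<inter> W F1)"
      using D_sub[OF D] SV True by (intro connected_meets_W[OF F none]) auto
    moreover have "0 \<le> c0 * K" by (simp add: c0_def)
    ultimately show ?thesis by linarith
  next
    case False
    then have "c0 * card D \<le> c0 * K" by (intro mult_left_mono) (auto simp: c0_def)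
    then show ?thesis by linarith
  qed
  have "c0 * card S = (\<Sum>D\<in>\<D>. c0 * card D)" using card_S[of UNIV] by (simp add: sum_distrib_left)
  also have "\<dots> \<le> (\<Sum>D\<in>\<D>. c0 * K + card (D \<inter> W F1))" using each by (intro sum_mono)
  also have "\<dots> = c0 * (real K * card \<D>) + card (S \<inter> W F1)"
    using card_S[of "W F1"] by (simp add: sum.distrib algebra_simps)
  also have "\<dots> \<le> c0 * (card S / 2) + card (S \<inter> W F1)"
    using KD by (intro add_right_mono mult_left_mono) (auto simp: c0_def)
  finally show ?thesis by (simp add: c1_def)
qed

lemma K_le: "real K \<le> 9 * C * d / \<epsilon>\<^sup>2"
proof -
  have "1 \<le> C * d / \<epsilon>\<^sup>2"
  proof -
    have "\<epsilon>\<^sup>2 \<le> 1 * 1" using \<epsilon> power_le_one[of \<epsilon> 2] by simp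
    also have "\<dots> \<le> C * d" using C d4 by (intro mult_mono) auto
    finally show ?thesis using \<epsilon> by (simp add: field_simps)
  qed
  moreover have "real K \<le> 8 * C * d / \<epsilon>\<^sup>2 + 1"
  proof -
    have "0 \<le> 8 * C * d / \<epsilon>\<^sup>2" using C by simp
    then show ?thesis unfolding K_def by linarith
  qed
  moreover have "8 * C * d / \<epsilon>\<^sup>2 = 8 * (C * d / \<epsilon>\<^sup>2)" "9 * C * d / \<epsilon>\<^sup>2 = 9 * (C * d / \<epsilon>\<^sup>2)" by simp_all
  ultimately show ?thesis by linarith
qed

text \<open>\<open>K \<le> 9 * C * d / \<epsilon>\<^sup>2\<close> and
  \<open>r k = 4 * c * k / d\<close>; the product is at most \<open>k / 2\<close> by the third term
  of \<open>expansion_const\<close>.\<close>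

lemma few_comps:
  assumes "real b \<le> r k"
  shows "real K * b \<le> k / 2"
proof -
  have "real K * b \<le> (9 * C * d / \<epsilon>\<^sup>2) * r k" using K_le assms C by (intro mult_mono) auto
  also have "\<dots> = 36 * C / \<epsilon>\<^sup>2 * c * k" using d0 by (simp add: r_def)
  also have "\<dots> \<le> 36 * C / \<epsilon>\<^sup>2 * (\<epsilon>\<^sup>2 / (72 * C)) * k"
    using c_bounds C by (intro mult_right_mono mult_left_mono) auto
  also have "\<dots> = k / 2" using C \<epsilon> by simp
  finally show ?thesis .
qed

lemma q_le_r: "q k \<le> r k"
proof -
  have "q k \<le> c * k / (real d * 1)"
    unfolding q_def using c_bounds ln_d ln_d_pos d0 by (intro divide_left_mono mult_left_mono) auto
  also have "\<dots> \<le> r k" unfolding r_def using c_bounds d0 by (simp add: divide_right_mono)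
  finally show ?thesis .
qed

text \<open>A smaller cut would be a separation excluded by \<open>no_separation\<close>:
  \<open>meets_W\<close> places enough of \<open>W\<close> in \<open>S\<close>, and enough lies
  outside because \<open>3 / 2\<close> is below \<open>185 / 100\<close> by more than
  \<open>3 / 10\<close>.\<close>

lemma expansion_large_component:
  assumes L: "u \<in> V" "\<And>v. v \<in> V \<Longrightarrow> card (reach H {v}) \<le> card (reach H {u})"
    and S: "S \<subseteq> reach H {u}" "card S \<le> 3 / 2 * \<epsilon> * n"
  shows "q (card S) \<le> card (bd H S)" "\<epsilon>\<^sup>2 * n \<le> card S \<Longrightarrow> q (card S) \<le> card (outer V H S)"
proof -
  let ?k = "card S"
  have SV: "S \<subseteq> V" using S reach_subset[OF gH, of "{u}"] L(1) by auto
  have finS: "finite S" using SV fin finite_subset by blast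
  obtain v where "v \<in> V" "3 / 2 * \<epsilon> * n < card (reach H {v})" using giant by blast
  then have "3 / 2 * \<epsilon> * n < card (reach H {u})" using L(2)[of v] by linarith
  then have SL: "S \<noteq> reach H {u}" using S(2) by auto
  have kn: "?k \<le> n" unfolding n_def using SV fin by (intro card_mono)
  have rest: "\<beta> * n \<le> card (W F1 - S)"
  proof -
    have "card (W F1) \<le> card S + card (W F1 - S)"
      using card_mono[of "S \<union> (W F1 - S)" "W F1"] card_Un_le[of S "W F1 - S"] finS finW by auto
    then show ?thesis using S(2) big \<epsilon> n_pos by (simp add: \<beta>_def)
  qed
  have SW: "card (S \<inter> W F1) \<le> ?k" using finS by (intro card_mono) auto
  show "q ?k \<le> card (bd H S)"
  proof (cases "S = {}")
    case False
    show ?thesis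
    proof (rule ccontr)
      assume "\<not> ?thesis"
      then have lt: "real (card (bd H S)) \<le> q ?k" "real (card (bd H S)) < q ?k" by auto
      \<comment> \<open>A nonempty proper part of a component has a cut edge, so a violation forces
        \<open>q ?k \<ge> 1\<close>, which is the range covered by \<open>all_cross\<close>.\<close>
      obtain x y where "x \<in> S" "y \<in> reach H {u} - S" "{x, y} \<in> H"
        using conn_comp[of H u] S(1) SL False unfolding conn_def by meson
      then have "bd H S \<noteq> {}" using edge_in_bd[of x y H S] by auto
      then have "0 < card (bd H S)" using fin_bd by (simp add: card_gt_0_iff)
      then have "1 \<le> q ?k" using lt by linarith
      then have k0: "d * ln d / c \<le> real ?k"
        using d0 ln_d_pos c_bounds by (simp add: q_def field_simps)
      have "real K * card (bd H S) \<le> ?k / 2" using lt q_le_r[of ?k] by (intro few_comps) linarith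
      then have "c1 * ?k \<le> card (S \<inter> W F1)" by (rule meets_W[OF L(1) S(1) SL])
      moreover have "real (card (outer V H S)) \<le> q ?k" using card_outer_le[of S] lt by linarith
      ultimately show False using no_separation[OF SV k0 kn] lt(1) SW rest by blast
    qed
  qed (simp add: q_def)
  assume large: "\<epsilon>\<^sup>2 * n \<le> ?k"
  show "q ?k \<le> card (outer V H S)"
  proof (rule ccontr)
    assume "\<not> ?thesis"
    then have lt: "real (card (outer V H S)) \<le> q ?k" by auto
    let ?N = "outer V H S"
    have k0: "d * ln d / c \<le> real ?k" using k0_le(2) large by linarith
    have NV: "?N \<subseteq> V" by (auto simp: outer_def)
    \<comment> \<open>Ordinary degrees contribute at most
      \<open>3 * ln d * q ?k = 3 * c * ?k / d\<close>. The exceptional ones may add up to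
      \<open>n / d\<^sup>2\<close>, and \<open>\<epsilon>\<^sup>2 * n \<le> ?k\<close> turns this
      into at most \<open>c * ?k / d\<close>; the sum explains the \<open>4\<close> in
      \<open>r\<close>.\<close>
    have deg: "real (\<Sum>w\<in>?N. card (nb H w)) \<le> r ?k"
    proof -
      have "3 * ln d * card ?N \<le> 3 * ln d * q ?k" using lt ln_d_pos by (intro mult_left_mono) auto
      also have "\<dots> = 3 * c * ?k / d" using ln_d_pos d0 by (simp add: q_def)
      finally have 1: "3 * ln d * card ?N \<le> 3 * c * ?k / d" .
      have "n \<le> ?k / \<epsilon>\<^sup>2" using large \<epsilon> by (simp add: field_simps)
      then have "n / (real d)\<^sup>2 \<le> (?k / \<epsilon>\<^sup>2) / (real d)\<^sup>2" by (rule divide_right_mono) simp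
      also have "\<dots> = ?k / d * (1 / (\<epsilon>\<^sup>2 * d))" by (simp add: power2_eq_square)
      also have "\<dots> \<le> ?k / d * c"
      proof (intro mult_left_mono)
        show "1 / (\<epsilon>\<^sup>2 * d) \<le> c" using inv_c_le(2) c_bounds \<epsilon> d0 by (simp add: field_simps)
      qed auto
      finally have "n / (real d)\<^sup>2 \<le> c * ?k / d" by (simp add: mult.commute)
      moreover have "3 * c * ?k / d + c * ?k / d = r ?k" by (simp add: r_def add_divide_distrib[symmetric])
      ultimately show ?thesis using deg_sum_le[OF NV] 1 by linarith
    qed
    have "real (card (bd H S)) \<le> r ?k" using card_bd_le_deg[of S] deg by linarith
    then have "real K * card (bd H S) \<le> ?k / 2" by (rule few_comps)
    then have "c1 * ?k \<le> card (S \<inter> W F1)" by (rule meets_W[OF L(1) S(1) SL])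
    moreover have "real (card (next_to F1 ?N)) \<le> r ?k" using card_next_le_deg[OF NV] deg by linarith
    ultimately show False using no_separation[OF SV k0 kn lt] SW rest by blast
  qed
qed

end

end

section \<open>The main theorem\<close>

text \<open>The terms bound, in order: too small \<open>W\<close> (the first two), too few walks
  into \<open>W\<close>, heavy degrees, sparse pieces, and missing crossing paths. Here
  \<open>n\<close> is replaced by its exponential bounds in \<open>d\<close>.\<close>

definition failure_bound :: "real \<Rightarrow> real \<Rightarrow> real \<Rightarrow> real \<Rightarrow> real \<Rightarrow> real" where
  "failure_bound C \<delta> \<sigma> \<epsilon> d = 20000 * d\<^sup>2 / (\<epsilon>\<^sup>2 * exp (d / (2 * C))) +
     50 * (8 / \<epsilon>\<^sup>2 * exp (- (\<epsilon>\<^sup>2 / 4 * (\<delta> * d - 1)))) / \<epsilon> + exp (C * d - \<epsilon> * \<sigma> / 12 * d\<^sup>2) +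
     exp 16 / d + 8 / \<epsilon>\<^sup>2 * exp (- (C * d)) + 10 / exp (d / (2 * C))"

lemma failure_bound_tendsto:
  assumes "0 < C" "0 < \<delta>" "0 < \<sigma>" "0 < \<epsilon>"
  shows "(failure_bound C \<delta> \<sigma> \<epsilon> \<longlongrightarrow> 0) at_top"
proof -
  define a where "a = \<epsilon> * \<sigma> / 12"
  have a: "0 < a" using assms by (simp add: a_def)
  have "((\<lambda>d. 20000 * d\<^sup>2 / (\<epsilon>\<^sup>2 * exp (d / (2 * C)))) \<longlongrightarrow> 0) at_top"
    "((\<lambda>d. 50 * (8 / \<epsilon>\<^sup>2 * exp (- (\<epsilon>\<^sup>2 / 4 * (\<delta> * d - 1)))) / \<epsilon>) \<longlongrightarrow> 0) at_top"
    "((\<lambda>d. exp (C * d - a * d\<^sup>2)) \<longlongrightarrow> 0) at_top"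
    "((\<lambda>d :: real. exp 16 / d) \<longlongrightarrow> 0) at_top"
    "((\<lambda>d. 8 / \<epsilon>\<^sup>2 * exp (- (C * d))) \<longlongrightarrow> 0) at_top"
    "((\<lambda>d. 10 / exp (d / (2 * C))) \<longlongrightarrow> 0) at_top"
    using assms a by real_asymp+
  from tendsto_add[OF tendsto_add[OF tendsto_add[OF tendsto_add[OF tendsto_add[OF this(1,2)] this(3)] this(4)] this(5)] this(6)]
  show ?thesis by (simp add: failure_bound_def[abs_def] a_def)
qed

lemma large_degree_conditions:
  fixes C \<delta> \<epsilon> c :: real
  assumes "0 < C" "0 < \<delta>" "0 < \<epsilon>" "0 < c"
  shows "\<forall>\<^sub>F d in at_top. 4 \<le> d \<and> 1 \<le> \<delta> * d \<and> 14 * C\<^sup>2 * ln d \<le> \<delta> * d \<and>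
     8 / \<epsilon>\<^sup>2 * exp (- (\<epsilon>\<^sup>2 / 4 * (\<delta> * d - 1))) \<le> \<epsilon> / 2 \<and> 8 * C * d / \<epsilon>\<^sup>2 + 1 \<le> d\<^sup>2 \<and>
     1 \<le> ln d \<and> 1 \<le> c * \<epsilon>\<^sup>2 * d \<and> 6 * ln d \<le> d / (2 * C) \<and> d ^ 3 \<le> \<epsilon>\<^sup>2 * exp (d / (2 * C))"
proof (intro eventually_conj)
  show "\<forall>\<^sub>F d in at_top. 8 / \<epsilon>\<^sup>2 * exp (- (\<epsilon>\<^sup>2 / 4 * (\<delta> * d - 1))) \<le> \<epsilon> / 2"
  proof -
    have "((\<lambda>d. 8 / \<epsilon>\<^sup>2 * exp (- (\<epsilon>\<^sup>2 / 4 * (\<delta> * d - 1)))) \<longlongrightarrow> 0) at_top"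
      using assms by real_asymp
    then show ?thesis using assms by (auto dest!: order_tendstoD(2)[where a = "\<epsilon> / 2"] elim: eventually_mono)
  qed
qed (use assms in real_asymp)+

context expanding
begin

definition "expands H \<longleftrightarrow> (\<forall>u\<in>V. (\<forall>v\<in>V. card (reach H {v}) \<le> card (reach H {u})) \<longrightarrow>
  (\<forall>S. S \<subseteq> reach H {u} \<longrightarrow> card S \<le> 3 / 2 * \<epsilon> * n \<longrightarrow>
    q (card S) \<le> card (bd H S) \<and> (\<epsilon>\<^sup>2 * n \<le> card S \<longrightarrow> q (card S) \<le> card (outer V H S))))"

lemma pr_not_expands: "pr E p (\<lambda>H. \<not> expands H) \<le> failure_bound C \<delta> \<sigma> \<epsilon> d"
proof -
  define few_walks where "few_walks = (\<lambda>F. \<exists>v\<in>V. real (\<Sum>x\<in>nb E v. card (nb E x \<inter> W F)) < \<epsilon> * \<sigma> / 2 * (real d)\<^sup>2)"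
  define few_big where "few_big = (\<lambda>F. real (card (W F)) < 185 / 100 * \<epsilon> * n)"
  have two: "expect E p f = expect E p1 (\<lambda>F1. expect E p2 (\<lambda>F2. f (F1 \<union> F2)))" for f
    using expect_two_rounds[OF fin(2), of p1 p2 f] p_split by simp
  note b = p1_bounds(3,4) p2_bounds(1,3)
  have "pr E p (\<lambda>H. \<not> expands H) = expect E p1 (\<lambda>F1. pr E p2 (\<lambda>F2. \<not> expands (F1 \<union> F2)))"
    by (rule two)
  \<comment> \<open>Crossing paths are estimated only for first rounds with enough walks into
    \<open>W\<close>, hence the conjunction in the last term.\<close>
  also have "\<dots> \<le> expect E p1 (\<lambda>F1. expect E p2 (\<lambda>F2. of_bool (few_big F1) + of_bool (few_walks F1) +
      of_bool (n / (real d)\<^sup>2 \<le> heavy (F1 \<union> F2)) + of_bool (\<exists>P. sparse_piece F1 F2 P) +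
      of_bool (\<not> few_walks F1 \<and> \<not> all_cross F1 F2)))"
  proof (intro expect_mono b)
    fix F1 F2 assume F: "F1 \<subseteq> E" "F2 \<subseteq> E"
    have "expands (F1 \<union> F2)"
      if "\<not> few_big F1" "\<not> n / (real d)\<^sup>2 \<le> heavy (F1 \<union> F2)" "\<nexists>P. sparse_piece F1 F2 P" "all_cross F1 F2"
      using that expansion_large_component[OF F] unfolding expands_def few_big_def not_le not_less by blast
    then show "of_bool (\<not> expands (F1 \<union> F2)) \<le> of_bool (few_big F1) + of_bool (few_walks F1) +
      of_bool (n / (real d)\<^sup>2 \<le> heavy (F1 \<union> F2)) + of_bool (\<exists>P. sparse_piece F1 F2 P) +
      (of_bool (\<not> few_walks F1 \<and> \<not> all_cross F1 F2) :: real)"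
      by (cases "few_walks F1") auto
  qed
  also have "\<dots> = pr E p1 few_big + pr E p1 few_walks +
      expect E p1 (\<lambda>F1. pr E p2 (\<lambda>F2. n / (real d)\<^sup>2 \<le> heavy (F1 \<union> F2))) +
      expect E p1 (\<lambda>F1. pr E p2 (\<lambda>F2. \<exists>P. sparse_piece F1 F2 P)) +
      expect E p1 (\<lambda>F1. pr E p2 (\<lambda>F2. \<not> few_walks F1 \<and> \<not> all_cross F1 F2))"
    using fin by (simp only: expect_add expect_const)
  also have "expect E p1 (\<lambda>F1. pr E p2 (\<lambda>F2. n / (real d)\<^sup>2 \<le> heavy (F1 \<union> F2))) = pr E p (\<lambda>H. n / (real d)\<^sup>2 \<le> heavy H)"
    by (rule two[symmetric])
  also have "expect E p1 (\<lambda>F1. pr E p2 (\<lambda>F2. \<not> few_walks F1 \<and> \<not> all_cross F1 F2)) \<le> 10 / n"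
  proof (rule expect_le_const[OF fin(2) b(1,2)])
    fix F1 assume F1: "F1 \<subseteq> E"
    show "pr E p2 (\<lambda>F2. \<not> few_walks F1 \<and> \<not> all_cross F1 F2) \<le> 10 / n"
    proof (cases "few_walks F1")
      case False
      then show ?thesis using pr_not_all_cross[OF F1] by (simp add: few_walks_def not_less)
    qed (use fin n_pos in simp)
  qed
  also have "pr E p1 few_big + pr E p1 few_walks + pr E p (\<lambda>H. n / (real d)\<^sup>2 \<le> heavy H) +
      expect E p1 (\<lambda>F1. pr E p2 (\<lambda>F2. \<exists>P. sparse_piece F1 F2 P)) + 10 / n \<le> failure_bound C \<delta> \<sigma> \<epsilon> d"
  proof -
    have "20000 * (real d)\<^sup>2 / (\<epsilon>\<^sup>2 * n) \<le> 20000 * (real d)\<^sup>2 / (\<epsilon>\<^sup>2 * exp (d / (2 * C)))"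
      using n_ge(1) n_pos \<epsilon> by (intro divide_left_mono mult_left_mono mult_pos_pos) auto
    then have 1: "pr E p1 few_big \<le> 20000 * (real d)\<^sup>2 / (\<epsilon>\<^sup>2 * exp (d / (2 * C))) + 50 * \<tau> / \<epsilon>"
      using pr_few_big unfolding few_big_def by linarith
    have "n * exp (- (\<epsilon> * \<sigma> / 12 * (real d)\<^sup>2)) \<le> exp (C * d) * exp (- (\<epsilon> * \<sigma> / 12 * (real d)\<^sup>2))"
      using size_upper by (intro mult_right_mono) (auto simp: n_def)
    then have 2: "pr E p1 few_walks \<le> exp (C * d - \<epsilon> * \<sigma> / 12 * (real d)\<^sup>2)"
      using pr_few_walks unfolding few_walks_def by (simp add: mult_exp_exp)
    have 3: "10 / n \<le> 10 / exp (d / (2 * C))" using n_ge(1) n_pos by (intro divide_left_mono) auto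
    show ?thesis
      using 1 2 3 pr_heavy pr_sparse_piece unfolding failure_bound_def \<tau>_def by linarith
  qed
  finally show ?thesis by simp
qed

end

section \<open>From weighted sums back to the percolation measure and to the largest
  component\<close>

lemma prob_percolation:
  assumes "finite (edges G)" and p: "0 \<le> p" "p \<le> 1"
  shows "measure_pmf.prob (percolation G p) {H. P H} = pr (edges G) p (\<lambda>F. P \<lparr>verts = verts G, edges = F\<rparr>)"
proof -
  let ?E = "edges G" and ?\<chi> = "\<lambda>F e. e \<in> (F :: 'a set set)"
  let ?M = "Pi_pmf ?E False (\<lambda>_. bernoulli_pmf p)"
  let ?Q = "\<lambda>F. P \<lparr>verts = verts G, edges = F\<rparr>"
  have inj: "inj_on ?\<chi> X" for X by (auto simp: inj_on_def fun_eq_iff)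
  have eq: "{e \<in> ?E. ?\<chi> F e} = F" if "F \<subseteq> ?E" for F using that by auto
  \<comment> \<open>Samples take the default value \<open>False\<close> off the edge set, so they
    are indicator functions of subsets of \<open>?E\<close>, and the probability becomes the finite
    sum behind \<open>expect\<close>.\<close>
  have supp: "set_pmf ?M \<subseteq> ?\<chi> ` Pow ?E"
  proof
    fix \<omega> assume "\<omega> \<in> set_pmf ?M"
    from subsetD[OF set_Pi_pmf_subset[OF assms(1)] this] have "\<forall>e. e \<notin> ?E \<longrightarrow> \<omega> e = False" by auto
    then have "\<omega> = ?\<chi> {e \<in> ?E. \<omega> e}" by (auto simp: fun_eq_iff)
    then show "\<omega> \<in> ?\<chi> ` Pow ?E" by blast
  qed
  have "measure_pmf.prob (percolation G p) {H. P H} = measure_pmf.prob ?M {\<omega>. ?Q {e \<in> ?E. \<omega> e}}"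
    by (simp add: percolation_def vimage_def)
  also have "\<dots> = measure_pmf.prob ?M (?\<chi> ` {F \<in> Pow ?E. ?Q F})"
  proof (intro measure_eq_AE AE_pmfI)
    fix \<omega> assume "\<omega> \<in> set_pmf ?M"
    then obtain F where F: "F \<subseteq> ?E" "\<omega> = ?\<chi> F" using supp by auto
    show "\<omega> \<in> {\<omega>. ?Q {e \<in> ?E. \<omega> e}} \<longleftrightarrow> \<omega> \<in> ?\<chi> ` {F \<in> Pow ?E. ?Q F}"
      unfolding F(2) using F(1) eq[OF F(1)] by (simp add: inj_image_mem_iff[OF inj])
  qed auto
  also have "\<dots> = (\<Sum>\<omega>\<in>?\<chi> ` {F \<in> Pow ?E. ?Q F}. pmf ?M \<omega>)"
    using assms(1) by (intro measure_measure_pmf_finite) auto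
  also have "\<dots> = (\<Sum>F | F \<in> Pow ?E \<and> ?Q F. pmf ?M (?\<chi> F))" by (simp add: sum.reindex[OF inj])
  also have "\<dots> = (\<Sum>F | F \<in> Pow ?E \<and> ?Q F. p ^ card F * (1 - p) ^ card (?E - F))"
  proof (intro sum.cong refl)
    fix F assume "F \<in> {F. F \<in> Pow ?E \<and> ?Q F}"
    then have F: "F \<subseteq> ?E" by auto
    have "pmf ?M (?\<chi> F) = (\<Prod>e\<in>?E. pmf (bernoulli_pmf p) (e \<in> F))"
      using assms(1) F by (intro pmf_Pi') auto
    also have "\<dots> = (\<Prod>e\<in>?E. if e \<in> F then p else 1 - p)" using p by (intro prod.cong) auto
    also have "\<dots> = p ^ card F * (1 - p) ^ card (?E - F)"
      using assms(1) F by (simp add: prod.If_cases Int_absorb1 Diff_eq)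
    finally show "pmf ?M (?\<chi> F) = p ^ card F * (1 - p) ^ card (?E - F)" .
  qed
  also have "\<dots> = (\<Sum>F\<in>Pow ?E. p ^ card F * (1 - p) ^ card (?E - F) * of_bool (?Q F))"
    using assms(1) by (intro sum.mono_neutral_cong_left) auto
  finally show ?thesis by (simp add: expect_def)
qed

lemma edge_boundary_eq_bd:
  assumes "graph_on V F"
  shows "edge_boundary \<lparr>verts = V, edges = F\<rparr> S = bd F S"
proof -
  have "card (e \<inter> S) = 1 \<longleftrightarrow> e \<inter> S \<noteq> {} \<and> \<not> e \<subseteq> S" if e: "e \<in> F" for e
  proof -
    obtain x y where "e = {x, y}" "x \<noteq> y" by (rule edge_cases[OF assms e])
    then show ?thesis by (cases "x \<in> S"; cases "y \<in> S") (auto simp: Int_insert_left)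
  qed
  then show ?thesis by (auto simp: edge_boundary_def bd_def)
qed

lemma nbhd_eq_outer: "nbhd \<lparr>verts = V, edges = F\<rparr> S = outer V F S"
  by (auto simp: nbhd_def outer_def adj_def)

lemma largest_componentD:
  assumes F: "graph_on V F" and L: "largest_component \<lparr>verts = V, edges = F\<rparr> L"
  obtains u where "u \<in> V" "L = reach F {u}" "\<forall>v\<in>V. card (reach F {v}) \<le> card (reach F {u})"
proof -
  have comp: "{v \<in> V. (adj \<lparr>verts = V, edges = F\<rparr>)\<^sup>*\<^sup>* u v} = reach F {u}" if "u \<in> V" for u
  proof -
    have "adj \<lparr>verts = V, edges = F\<rparr> = (\<lambda>x y. {x, y} \<in> F)" by (auto simp: adj_def fun_eq_iff)
    then show ?thesis using reach_subset[OF F, of "{u}"] that by (auto simp: reach_def)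
  qed
  then have comps: "components \<lparr>verts = V, edges = F\<rparr> = {reach F {u} | u. u \<in> V}"
    by (auto simp: components_def)
  then obtain u where u: "u \<in> V" "L = reach F {u}" using L by (auto simp: largest_component_def)
  have "\<forall>v\<in>V. card (reach F {v}) \<le> card (reach F {u})"
    using L comps u(2) by (auto simp: largest_component_def)
  with u show ?thesis by (rule that)
qed

text \<open>The expansion constant may only depend on \<open>\<epsilon>\<close>; since \<open>\<epsilon> \<le> 1 / (100 * C)\<close>, this is a bound for \<open>C\<close>.\<close>

definition size_bound :: "real \<Rightarrow> nat" where
  "size_bound \<epsilon> = max 2 (nat \<lfloor>1 / \<epsilon>\<rfloor>)"

theorem theorem3:
  "\<exists>(\<epsilon>\<^sub>0 :: nat \<Rightarrow> real) (c :: real \<Rightarrow> real).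
     (\<forall>C>1. 0 < \<epsilon>\<^sub>0 C) \<and> (\<forall>\<epsilon>>0. 0 < c \<epsilon>) \<and>
     (\<forall>C>1. \<forall>\<epsilon>. 0 < \<epsilon> \<and> \<epsilon> \<le> \<epsilon>\<^sub>0 C \<longrightarrow>
       (\<forall>(B :: nat \<Rightarrow> nat \<Rightarrow> 'a ugraph) (deg :: nat \<Rightarrow> nat \<Rightarrow> nat).
         (\<forall>t. \<forall>j\<in>{1..t}. simple_graph (B t j) \<and> connected_graph (B t j) \<and>
            regular_graph (B t j) (deg t j) \<and>
            1 < card (verts (B t j)) \<and> card (verts (B t j)) \<le> C) \<longrightarrow>
         (\<lambda>t. let G = cartesian_product t (B t);
                  n = real (card (verts G));
                  d = real (\<Sum>j=1..t. deg t j);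
                  p = (1 + \<epsilon>) / d
              in measure_pmf.prob (percolation G p)
                {H. \<forall>L. largest_component H L \<longrightarrow>
                  (\<forall>k::nat. real k \<le> 3 * \<epsilon> * n / 2 \<longrightarrow>
                    (\<forall>S. S \<subseteq> L \<and> card S = k \<longrightarrow>
                      real (card (edge_boundary H S)) \<ge> c \<epsilon> * real (card S) / (d * ln d))) \<and>
                  (\<forall>k::nat. \<epsilon>\<^sup>2 * n \<le> real k \<and> real k \<le> 3 * \<epsilon> * n / 2 \<longrightarrow>
                    (\<forall>S. S \<subseteq> L \<and> card S = k \<longrightarrow>
                      real (card (nbhd H S)) \<ge> c \<epsilon> * real (card S) / (d * ln d)))})
           \<longlonglongrightarrow> 1))"
proof -
  define \<delta> where "\<delta> = (\<lambda>\<epsilon> :: real. \<epsilon>\<^sup>2 / 1000)"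
  define \<sigma> where "\<sigma> = (\<lambda>\<epsilon>. (\<delta> \<epsilon>)\<^sup>2 / (16 * real (size_bound \<epsilon>) ^ 4))"
  define c where "c = (\<lambda>\<epsilon>. expansion_const (real (size_bound \<epsilon>)) (\<delta> \<epsilon>) (\<sigma> \<epsilon>) \<epsilon>)"
  have sb: "2 \<le> size_bound \<epsilon>" for \<epsilon> by (simp add: size_bound_def)
  have pos: "0 < \<delta> \<epsilon>" "0 < \<sigma> \<epsilon>" "0 < c \<epsilon>" if "0 < \<epsilon>" for \<epsilon>
  proof -
    have "0 < real (size_bound \<epsilon>)" using sb[of \<epsilon>] by linarith
    moreover show "0 < \<delta> \<epsilon>" using that by (simp add: \<delta>_def)
    ultimately show "0 < \<sigma> \<epsilon>" by (simp add: \<sigma>_def)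
    with \<open>0 < \<delta> \<epsilon>\<close> \<open>0 < real (size_bound \<epsilon>)\<close> that show "0 < c \<epsilon>"
      by (simp add: c_def expansion_const_def crossing_const_def)
  qed
  show ?thesis
  proof (intro exI[of _ "\<lambda>C. 1 / (100 * real C)"] exI[of _ c] conjI allI impI)
    fix C :: nat and \<epsilon> :: real and B :: "nat \<Rightarrow> nat \<Rightarrow> 'a ugraph" and deg :: "nat \<Rightarrow> nat \<Rightarrow> nat"
    assume C: "1 < C" and "0 < \<epsilon> \<and> \<epsilon> \<le> 1 / (100 * real C)"
      and base: "\<forall>t. \<forall>j\<in>{1..t}. simple_graph (B t j) \<and> connected_graph (B t j) \<and>
            regular_graph (B t j) (deg t j) \<and> 1 < card (verts (B t j)) \<and> card (verts (B t j)) \<le> C"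
    then have \<epsilon>: "0 < \<epsilon>" "\<epsilon> \<le> 1 / (100 * real C)" by auto
    have "1 / (100 * real C) \<le> 1 / (100 * 1)" using C by (intro divide_left_mono) auto
    then have \<epsilon>100: "\<epsilon> \<le> 1 / 100" using \<epsilon> by linarith
    \<comment> \<open>From here on \<open>D\<close> takes the role of \<open>C\<close>: it depends
      on \<open>\<epsilon>\<close> only and still bounds the size of every base graph.\<close>
    define D where "D = size_bound \<epsilon>"
    have c_\<epsilon>: "c \<epsilon> = expansion_const (real D) (\<delta> \<epsilon>) (\<sigma> \<epsilon>) \<epsilon>" by (simp add: c_def D_def)
    have CD: "C \<le> D"
    proof -
      have "\<epsilon> * (100 * real C) \<le> 1" using \<epsilon>(2) C by (simp add: field_simps)
      moreover have "\<epsilon> * real C \<le> \<epsilon> * (100 * real C)" using \<epsilon> by (intro mult_left_mono) auto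
      ultimately have "real C \<le> 1 / \<epsilon>" using \<epsilon> by (simp add: field_simps)
      then show ?thesis unfolding D_def size_bound_def by (simp add: le_nat_floor max.coboundedI2)
    qed
    note pos' = pos[OF \<epsilon>(1)]
    have D2: "2 \<le> D" "0 < real D" using sb[of \<epsilon>] by (auto simp: D_def)
    have ok: "base_ok D (B t j)" and reg: "\<And>v. v \<in> verts (B t j) \<Longrightarrow> card (nb (edges (B t j)) v) = deg t j"
      if "j \<in> {1..t}" for t j
    proof -
      have b: "graph_on (verts (B t j)) (edges (B t j))" using base that by (auto simp: simple_graph_def graph_on_def)
      then show "base_ok D (B t j)" using base that CD by (force simp: base_ok_def)
      show "card (nb (edges (B t j)) v) = deg t j" if "v \<in> verts (B t j)" for v
        using card_star[OF b, of v] base \<open>j \<in> {1..t}\<close> that by (auto simp: regular_graph_def)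
    qed
    define d where "d = (\<lambda>t. \<Sum>j=1..t. deg t j)"
    \<comment> \<open>Every conclusion for large degree thereby becomes one for large
      \<open>t\<close>, uniformly in the base graphs.\<close>
    have td: "t \<le> d t" for t
      using sum_mono[of "{1..t}" "\<lambda>_. 1" "deg t"] deg_bounds[of t D "B t" "deg t"] ok[of _ t] reg[of _ t]
      by (simp add: d_def)
    have d_lim: "filterlim (\<lambda>t. real (d t)) at_top sequentially"
      by (rule filterlim_at_top_mono[OF filterlim_real_sequentially]) (use td in auto)
    let ?P = "\<lambda>t. let G = cartesian_product t (B t);
                  n = real (card (verts G));
                  d = real (\<Sum>j=1..t. deg t j);
                  p = (1 + \<epsilon>) / d
              in measure_pmf.prob (percolation G p)
                {H. \<forall>L. largest_component H L \<longrightarrow>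
                  (\<forall>k::nat. real k \<le> 3 * \<epsilon> * n / 2 \<longrightarrow>
                    (\<forall>S. S \<subseteq> L \<and> card S = k \<longrightarrow>
                      real (card (edge_boundary H S)) \<ge> c \<epsilon> * real (card S) / (d * ln d))) \<and>
                  (\<forall>k::nat. \<epsilon>\<^sup>2 * n \<le> real k \<and> real k \<le> 3 * \<epsilon> * n / 2 \<longrightarrow>
                    (\<forall>S. S \<subseteq> L \<and> card S = k \<longrightarrow>
                      real (card (nbhd H S)) \<ge> c \<epsilon> * real (card S) / (d * ln d)))}"
    let ?fb = "\<lambda>t. failure_bound (real D) (\<delta> \<epsilon>) (\<sigma> \<epsilon>) \<epsilon> (real (d t))"
    have lower: "\<forall>\<^sub>F t in sequentially. 1 - ?fb t \<le> ?P t"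
    proof -
      have ev1: "\<forall>\<^sub>F t in sequentially. 0 < t \<and> 4 * real D / \<delta> \<epsilon> \<le> real t"
        by (intro eventually_conj eventually_gt_at_top
            filterlim_at_top[THEN iffD1, OF filterlim_real_sequentially, rule_format])
      note ev2 = eventually_compose_filterlim[OF large_degree_conditions[OF D2(2) pos'(1) \<epsilon>(1) pos'(3)] d_lim]
      show ?thesis using ev1 ev2
      proof eventually_elim
        case (elim t)
        let ?G = "cartesian_product t (B t)"
        have \<delta>1: "\<delta> \<epsilon> \<le> 1" using \<epsilon>(1) \<epsilon>100 power_le_one[of \<epsilon> 2] by (simp add: \<delta>_def)
        have \<sigma>1: "\<sigma> \<epsilon> \<le> 1"
        proof -
          have "(\<delta> \<epsilon>)\<^sup>2 \<le> 1" using \<delta>1 pos' by (intro power_le_one) auto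
          moreover have "1 \<le> real D ^ 4" using D2 by (intro one_le_power) auto
          ultimately have "(\<delta> \<epsilon>)\<^sup>2 \<le> 16 * real D ^ 4" by linarith
          then show ?thesis using D2 by (simp add: \<sigma>_def D_def[symmetric] divide_le_eq)
        qed
        have "host_graph (verts ?G) (edges ?G) (d t) (real D) (\<delta> \<epsilon>) (\<sigma> \<epsilon>)"
          using product_host_graph[of t D "B t" "deg t" "\<delta> \<epsilon>"] ok[of _ t] reg[of _ t] elim \<delta>1 pos'
          by (simp add: d_def \<sigma>_def D_def[symmetric])
        then interpret host_graph "verts ?G" "edges ?G" "d t" "real D" "\<delta> \<epsilon>" "\<sigma> \<epsilon>" .
        interpret expanding "verts ?G" "edges ?G" "d t" "real D" "\<delta> \<epsilon>" "\<sigma> \<epsilon>" \<epsilon>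
          using elim \<epsilon> \<epsilon>100 pos' \<sigma>1 by unfold_locales (simp_all add: \<delta>_def[symmetric] c_def D_def[symmetric], simp add: \<delta>_def)
        let ?n = "real (card (verts ?G))" and ?d = "real (d t)"
        let ?Q = "\<lambda>H. \<forall>L. largest_component H L \<longrightarrow>
                  (\<forall>k::nat. real k \<le> 3 * \<epsilon> * ?n / 2 \<longrightarrow>
                    (\<forall>S. S \<subseteq> L \<and> card S = k \<longrightarrow>
                      real (card (edge_boundary H S)) \<ge> c \<epsilon> * real (card S) / (?d * ln ?d))) \<and>
                  (\<forall>k::nat. \<epsilon>\<^sup>2 * ?n \<le> real k \<and> real k \<le> 3 * \<epsilon> * ?n / 2 \<longrightarrow>
                    (\<forall>S. S \<subseteq> L \<and> card S = k \<longrightarrow>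
                      real (card (nbhd H S)) \<ge> c \<epsilon> * real (card S) / (?d * ln ?d)))"
        have P_eq: "?P t = measure_pmf.prob (percolation ?G p) {H. ?Q H}"
          unfolding Let_def p_def unfolding d_def by (rule refl)
        have imp: "?Q \<lparr>verts = verts ?G, edges = F\<rparr>" if F: "F \<subseteq> edges ?G" and e: "expands F" for F
        proof (intro allI impI)
          have gF: "graph_on (verts ?G) F" by (rule graph_on_subset[OF graph F])
          fix L assume "largest_component \<lparr>verts = verts ?G, edges = F\<rparr> L"
          then obtain u where u: "u \<in> verts ?G" "L = reach F {u}"
            "\<forall>v\<in>verts ?G. card (reach F {v}) \<le> card (reach F {u})"
            by (rule largest_componentD[OF gF])
          have ex: "q (card S) \<le> card (bd F S)"
            "\<epsilon>\<^sup>2 * ?n \<le> card S \<Longrightarrow> q (card S) \<le> card (outer (verts ?G) F S)"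
            if "S \<subseteq> L" "card S \<le> 3 * \<epsilon> * ?n / 2" for S
            using e u that unfolding expands_def n_def by auto
          have q_eq: "c \<epsilon> * real (card S) / (?d * ln ?d) = q (card S)" for S
            unfolding q_def c_def c_\<epsilon> by (rule refl)
          show "(\<forall>k::nat. real k \<le> 3 * \<epsilon> * ?n / 2 \<longrightarrow>
                    (\<forall>S. S \<subseteq> L \<and> card S = k \<longrightarrow>
                      real (card (edge_boundary \<lparr>verts = verts ?G, edges = F\<rparr> S)) \<ge> c \<epsilon> * real (card S) / (?d * ln ?d))) \<and>
                  (\<forall>k::nat. \<epsilon>\<^sup>2 * ?n \<le> real k \<and> real k \<le> 3 * \<epsilon> * ?n / 2 \<longrightarrow>
                    (\<forall>S. S \<subseteq> L \<and> card S = k \<longrightarrow>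
                      real (card (nbhd \<lparr>verts = verts ?G, edges = F\<rparr> S)) \<ge> c \<epsilon> * real (card S) / (?d * ln ?d)))"
            unfolding edge_boundary_eq_bd[OF gF] nbhd_eq_outer q_eq using ex by blast
        qed
        have "1 - ?fb t \<le> 1 - pr (edges ?G) p (\<lambda>H. \<not> expands H)" using pr_not_expands by simp
        also have "\<dots> = pr (edges ?G) p expands" using pr_not[OF fin(2), of p expands] by simp
        also have "\<dots> \<le> pr (edges ?G) p (\<lambda>F. ?Q \<lparr>verts = verts ?G, edges = F\<rparr>)"
          using imp by (intro pr_mono p_bounds) auto
        also have "\<dots> = ?P t" unfolding P_eq using fin p_bounds by (intro prob_percolation[symmetric]) auto
        finally show ?case .
      qed
    qed
    have upper: "\<forall>\<^sub>F t in sequentially. ?P t \<le> 1" by (simp add: Let_def)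
    have "?fb \<longlonglongrightarrow> 0"
      by (rule filterlim_compose[OF failure_bound_tendsto[OF D2(2) pos'(1,2) \<epsilon>(1)] d_lim])
    then have "(\<lambda>t. 1 - ?fb t) \<longlonglongrightarrow> 1 - 0" by (intro tendsto_diff tendsto_const)
    then have lim: "(\<lambda>t. 1 - ?fb t) \<longlonglongrightarrow> 1" by simp
    show "?P \<longlonglongrightarrow> 1" by (rule tendsto_sandwich[OF lower upper lim tendsto_const])
  qed (use pos in auto)
qed

end
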